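(* Let $\varphi\in\mathscr K(\mathbb R^d)$ and, for $t\in\mathbb R\setminus\pi\mathbb Z$, set $k(t)=\lfloor t/\pi\rfloor$. Then for every $x\in\mathbb R^d$ and $t\in\mathbb R\setminus\pi\mathbb Z$, $$\left(e^{it\mathscr L}\varphi\right)(x)=\frac{(4\pi)^{-\frac d2}e^{\frac{idt}{2}}e^{-\frac{i\pi d}{4}(2k(t)+1)}}{|\sin t|^{\frac d2}}\int_{\mathbb R^d}\exp\!\left\{\frac{i\,\operatorname{sgn}(\sin t)}{4|\sin t|}\left(e^{it}|y|^2+e^{-it}|x|^2-2\langle x,y\rangle\right)\right\}\varphi(y)\,dy .$$ At the times $t=k\pi$, $$\left(e^{ik\pi\mathscr L}\varphi\right)(x)=\varphi((-1)^kx),\qquad k\in\mathbb Z .$$ These formulas give the solution in $\mathbb R^d\times\mathbb R$ of the Cauchy problem $i\partial_tu+\mathscr Lu=0$, $u(\cdot,0)=\varphi$.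
   Context: $d\gamma(x)=(2\pi)^{-d/2}e^{-|x|^2/2}dx$ on $\mathbb R^d$ and $\mathscr L=\Delta-\langle x,\nabla\rangle$ with its natural self-adjoint realization in $L^2(\mathbb R^d,d\gamma)$ (the Hermite polynomials $H_\alpha$ form a complete orthogonal system with $\mathscr L H_\alpha=-|\alpha|H_\alpha$); $\{e^{it\mathscr L}\}_{t\in\mathbb R}$ is the associated strongly continuous unitary group on $L^2(\mathbb R^d,d\gamma)$. $\mathscr K(\mathbb R^d)=\{\varphi\in C^\infty(\mathbb R^d): e^{-|x|^2/4}\varphi\in\mathscr S(\mathbb R^d)\}$, where $\mathscr S(\mathbb R^d)$ is the Schwartz space (functions are complex-valued). $\lfloor s\rfloor$ is the greatest integer not exceeding $s$. *)

theory Defs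
  imports "HOL-Analysis.Analysis" "HOL-Computational_Algebra.Polynomial"
begin

section \<open>Partial derivatives, smooth functions and the space K\<close>

definition partial :: "'n \<Rightarrow> (real ^ 'n \<Rightarrow> complex) \<Rightarrow> real ^ 'n \<Rightarrow> complex" where
  "partial i f x = frechet_derivative f (at x) (axis i 1)"

fun partials :: "'n list \<Rightarrow> (real ^ 'n \<Rightarrow> complex) \<Rightarrow> real ^ 'n \<Rightarrow> complex" where
  "partials [] f = f"
| "partials (i # is) f = partial i (partials is f)"

text \<open>Every iterated partial derivative exists and is differentiable (hence continuous).\<close>

definition smooth :: "(real ^ 'n \<Rightarrow> complex) \<Rightarrow> bool" where
  "smooth f \<longleftrightarrow> (\<forall>is. partials is f differentiable_on UNIV)"

definition schwartz_space :: "(real ^ 'n \<Rightarrow> complex) set" where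
  "schwartz_space =
    {f. smooth f \<and> (\<forall>is k. \<exists>C. \<forall>x. norm x ^ k * norm (partials is f x) \<le> C)}"

definition K_space :: "(real ^ 'n \<Rightarrow> complex) set" where
  "K_space =
    {\<phi>. smooth \<phi> \<and> (\<lambda>x. of_real (exp (- (norm x)\<^sup>2 / 4)) * \<phi> x) \<in> schwartz_space}"

section \<open>The complex Hilbert space of the Gaussian measure\<close>

definition gauss :: "(real ^ 'n) measure" where
  "gauss = density lborel
    (\<lambda>x. ennreal ((2 * pi) powr (- real CARD('n) / 2) * exp (- (norm x)\<^sup>2 / 2)))"

text \<open>
  Elements of the Hilbert space are represented by square-integrable functions; equality in the
  Hilbert space is equality almost everywhere and is written out as such.
\<close>

definition L2 :: "(real ^ 'n \<Rightarrow> complex) set" where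
  "L2 = {f \<in> borel_measurable gauss. integrable gauss (\<lambda>x. (norm (f x))\<^sup>2)}"

definition L2_inner :: "(real ^ 'n \<Rightarrow> complex) \<Rightarrow> (real ^ 'n \<Rightarrow> complex) \<Rightarrow> complex" where
  "L2_inner f g = (LINT x|gauss. f x * cnj (g x))"

definition L2_norm :: "(real ^ 'n \<Rightarrow> complex) \<Rightarrow> real" where
  "L2_norm f = sqrt (LINT x|gauss. (norm (f x))\<^sup>2)"

definition has_L2_derivative ::
    "(real \<Rightarrow> real ^ 'n \<Rightarrow> complex) \<Rightarrow> (real ^ 'n \<Rightarrow> complex) \<Rightarrow> real \<Rightarrow> bool" where
  "has_L2_derivative v w t \<longleftrightarrow>
    ((\<lambda>h. L2_norm (\<lambda>x. (v (t + h) x - v t x) / of_real h - w x)) \<longlongrightarrow> 0) (at 0)"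

section \<open>The Ornstein-Uhlenbeck operator\<close>

definition OU_diff :: "(real ^ 'n \<Rightarrow> complex) \<Rightarrow> real ^ 'n \<Rightarrow> complex" where
  "OU_diff f x =
    (\<Sum>i\<in>UNIV. partial i (partial i f) x) - (\<Sum>i\<in>UNIV. of_real (x $ i) * partial i f x)"

text \<open>
  Probabilists' Hermite polynomials (orthogonal for the Gaussian weight with variance 1); the
  recursion is the Rodrigues formula after cancelling the weight.
\<close>

fun hermite_poly :: "nat \<Rightarrow> real poly" where
  "hermite_poly 0 = 1"
| "hermite_poly (Suc n) = [:0, 1:] * hermite_poly n - pderiv (hermite_poly n)"

definition hermite :: "('n \<Rightarrow> nat) \<Rightarrow> real ^ 'n \<Rightarrow> complex" where
  "hermite \<alpha> x = of_real (\<Prod>i\<in>UNIV. poly (hermite_poly (\<alpha> i)) (x $ i))"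

definition hermite_span :: "(real ^ 'n \<Rightarrow> complex) set" where
  "hermite_span = {(\<lambda>x. \<Sum>\<alpha>\<in>A. c \<alpha> * hermite \<alpha> x) | A c. finite A}"

text \<open>
  The graph of the self-adjoint realization, as the closure of the differential operator on the
  span of the Hermite polynomials. As these form a complete orthogonal system of eigenfunctions
  with real eigenvalues, the operator is essentially self-adjoint on that span. Thus
  \<open>OU f g\<close> says that \<open>f\<close> lies in the domain and is mapped to \<open>g\<close>.
\<close>

definition OU :: "(real ^ 'n \<Rightarrow> complex) \<Rightarrow> (real ^ 'n \<Rightarrow> complex) \<Rightarrow> bool" where
  "OU f g \<longleftrightarrow> f \<in> L2 \<and> g \<in> L2 \<and>
    (\<forall>\<epsilon>>0. \<exists>p\<in>hermite_span.
       L2_norm (\<lambda>x. f x - p x) < \<epsilon> \<and> L2_norm (\<lambda>x. g x - OU_diff p x) < \<epsilon>)"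

section \<open>The unitary group\<close>

text \<open>
  Compatibility with almost everywhere equality follows from linearity and preservation of the
  inner product, and surjectivity of each \<open>U t\<close> from the group law.
\<close>

definition unitary_group ::
    "(real \<Rightarrow> (real ^ 'n \<Rightarrow> complex) \<Rightarrow> real ^ 'n \<Rightarrow> complex) \<Rightarrow> bool" where
  "unitary_group U \<longleftrightarrow>
    (\<forall>t. \<forall>f\<in>L2. U t f \<in> L2) \<and>
    (\<forall>t. \<forall>f\<in>L2. \<forall>g\<in>L2. \<forall>a b.
       AE x in gauss. U t (\<lambda>y. a * f y + b * g y) x = a * U t f x + b * U t g x) \<and>
    (\<forall>t. \<forall>f\<in>L2. \<forall>g\<in>L2. L2_inner (U t f) (U t g) = L2_inner f g) \<and>
    (\<forall>f\<in>L2. AE x in gauss. U 0 f x = f x) \<and>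
    (\<forall>s t. \<forall>f\<in>L2. AE x in gauss. U (s + t) f x = U s (U t f) x) \<and>
    (\<forall>f\<in>L2. \<forall>t. ((\<lambda>s. L2_norm (\<lambda>x. U s f x - U t f x)) \<longlongrightarrow> 0) (at t))"

text \<open>
  The strongly continuous unitary group associated with the self-adjoint realization: its
  infinitesimal generator, with its exact domain, is \<open>\<i>\<close> times the operator. By Stone's theorem
  it exists and is unique up to almost everywhere equality.
\<close>

definition OU_group ::
    "(real \<Rightarrow> (real ^ 'n \<Rightarrow> complex) \<Rightarrow> real ^ 'n \<Rightarrow> complex) \<Rightarrow> bool" where
  "OU_group U \<longleftrightarrow> unitary_group U \<and>
    (\<forall>f\<in>L2. \<forall>g\<in>L2. has_L2_derivative (\<lambda>t. U t f) (\<lambda>x. \<i> * g x) 0 \<longleftrightarrow> OU f g)"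

section \<open>The Cauchy problem\<close>

definition L2_solution ::
    "(real ^ 'n \<Rightarrow> complex) \<Rightarrow> (real \<Rightarrow> real ^ 'n \<Rightarrow> complex) \<Rightarrow> bool" where
  "L2_solution \<phi> v \<longleftrightarrow>
    (\<forall>t. \<exists>g. OU (v t) g \<and> has_L2_derivative v (\<lambda>x. \<i> * g x) t) \<and>
    (AE x in gauss. v 0 x = \<phi> x)"

definition classical_solution ::
    "(real ^ 'n \<Rightarrow> complex) \<Rightarrow> (real \<Rightarrow> real ^ 'n \<Rightarrow> complex) \<Rightarrow> bool" where
  "classical_solution \<phi> u \<longleftrightarrow>
    (\<forall>x. (\<lambda>t. u t x) differentiable_on UNIV) \<and>
    (\<forall>t. u t differentiable_on UNIV) \<and>
    (\<forall>t i. partial i (u t) differentiable_on UNIV) \<and>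
    continuous_on UNIV (\<lambda>(t, x). u t x) \<and>
    continuous_on UNIV (\<lambda>(t, x). vector_derivative (\<lambda>s. u s x) (at t)) \<and>
    (\<forall>i. continuous_on UNIV (\<lambda>(t, x). partial i (u t) x)) \<and>
    (\<forall>i j. continuous_on UNIV (\<lambda>(t, x). partial j (partial i (u t)) x)) \<and>
    (\<forall>t x. \<i> * vector_derivative (\<lambda>s. u s x) (at t) + OU_diff (u t) x = 0) \<and>
    (\<forall>x. u 0 x = \<phi> x)"

definition kernel_integrand ::
    "(real ^ 'n \<Rightarrow> complex) \<Rightarrow> real \<Rightarrow> real ^ 'n \<Rightarrow> real ^ 'n \<Rightarrow> complex" where
  "kernel_integrand \<phi> t x y =
    exp (\<i> * of_real (sgn (sin t)) / of_real (4 * \<bar>sin t\<bar>) *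
         (exp (\<i> * of_real t) * of_real ((norm y)\<^sup>2) + exp (- \<i> * of_real t) * of_real ((norm x)\<^sup>2)
          - 2 * of_real (x \<bullet> y))) * \<phi> y"

end

theory Submission
  imports Defs "HOL-Probability.Characteristic_Functions" "HOL-Real_Asymp.Real_Asymp"
begin

text \<open>
  Expand \<open>\<phi>\<close> in Hermite polynomials, \<open>\<phi> = \<Sum> c\<^sub>\<alpha> H\<^sub>\<alpha>\<close>, and let each eigenfunction evolve by its phase:
  \<open>u t x = \<Sum> c\<^sub>\<alpha> exp(-i|\<alpha>|t) H\<^sub>\<alpha> x\<close>. This one series gives all parts of the theorem; it is
  smooth across the times \<open>k\<pi>\<close>, where the kernel is singular.

  Three inputs make the series work. First, a bound
  \<open>|H\<^sub>\<alpha> x| \<le> K \<surd>\<alpha>! q(\<alpha>)\<^sup>2 exp(|x|\<^sup>2/4) w(x)\<close> with \<open>q(\<alpha>) = \<Prod>(1 + \<alpha>\<^sub>i)\<close> and the integrable weight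
  \<open>w(x) = \<Prod> 1 / (1 + x\<^sub>i\<^sup>2)\<close> (\<open>hermite_bound\<close>). In one variable it is read off from Mehler's formula on the
  diagonal, all of whose terms are nonnegative there, and multiplication by \<open>x\<^sup>2\<close> only costs powers of \<open>n\<close>.
  A function below \<open>exp(|x|\<^sup>2/4) w(x)\<close> is in the Gaussian \<open>L\<^sup>2\<close>, so this single bound controls
  pointwise convergence of the series and of its derivatives as well as convergence in \<open>L\<^sup>2\<close>.
  Second, \<open>c\<^sub>\<alpha> \<surd>\<alpha>!\<close> decays faster than every power of \<open>q(\<alpha>)\<close> when \<open>\<phi>\<close> is in \<open>K\<close> (\<open>rapid_coef\<close>):
  integration by parts moves \<open>H\<^sub>\<alpha>\<close> to \<open>H(\<alpha> - e\<^sub>i)\<close> at the price of a derivative of \<open>\<phi>\<close>, and each such step gains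
  a factor of order \<open>1 / \<surd>\<alpha>\<^sub>i\<close>. Third, for \<open>|z| < 1\<close> the damped series \<open>\<Sum> z^|\<alpha>| c\<^sub>\<alpha> H\<^sub>\<alpha> x\<close> is the integral of
  \<open>\<phi>\<close> against Mehler's kernel (\<open>mehler_integral\<close>).

  Now let \<open>z\<close> tend radially to the unit circle. Towards \<open>z = 1\<close> the Mehler kernel is an approximate identity, so
  the series at \<open>t = 0\<close> is \<open>\<phi>\<close> (\<open>hermite_expansion\<close>).
  Towards \<open>z = exp(-it)\<close> with \<open>sin t \<noteq> 0\<close> the kernel times the Gaussian density stays below a multiple of \<open>exp(-|y|\<^sup>2/4)\<close>, dominated convergence
  applies, and the boundary value of the kernel is the stated one (\<open>kernel_formula\<close>); the floor of \<open>t / \<pi>\<close> records which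
  branch the principal square root of \<open>1 - z\<^sup>2\<close> selects. At \<open>t = k\<pi>\<close> the phases are \<open>(-1)^(k|\<alpha>|)\<close>, which is the parity of
  \<open>H\<^sub>\<alpha>\<close> (\<open>hseries_half_period\<close>).

  The abstract group enters only through its generator. If \<open>v\<close> is an \<open>L\<^sup>2\<close> solution then \<open>U (-t) (v t)\<close> has
  derivative zero, hence \<open>v t = U t \<phi>\<close> (\<open>L2_solution_unique\<close>). Applied to \<open>u\<close> this identifies \<open>u\<close> with the
  group, and applied to any other solution it gives uniqueness.
\<close>

section \<open>Hermite polynomials in one variable\<close>

lemma pderiv_hermite_poly:
  "pderiv (hermite_poly n) = of_nat n * hermite_poly (n - 1)"
proof (induction n rule: less_induct)
  case (less n)
  show ?case
  proof (cases n)
    case 0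
    then show ?thesis by simp
  next
    case (Suc m)
    have X: "[:0, 1:] * p = pCons 0 p" for p :: "real poly" by simp
    show ?thesis
    proof (cases m)
      case 0
      then show ?thesis using Suc by (simp add: pderiv_pCons one_pCons)
    next
      case (Suc k)
      have IH: "pderiv (hermite_poly m) = of_nat m * hermite_poly k"
        using less.IH[of m] \<open>n = Suc m\<close> Suc by simp
      have IH2: "pderiv (hermite_poly k) = of_nat k * hermite_poly (k - 1)"
        using less.IH[of k] \<open>n = Suc m\<close> Suc by simp
      have "pderiv (hermite_poly n) = hermite_poly m + [:0, 1:] * pderiv (hermite_poly m)
              - pderiv (pderiv (hermite_poly m))"
        unfolding \<open>n = Suc m\<close> hermite_poly.simps pderiv_diff pderiv_mult
        by (simp add: pderiv_pCons)
      also have "\<dots> = hermite_poly m + of_nat m * ([:0, 1:] * hermite_poly k - pderiv (hermite_poly k))"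
        unfolding IH by (simp add: pderiv_mult algebra_simps)
      also have "\<dots> = of_nat n * hermite_poly m"
        using Suc \<open>n = Suc m\<close> by (simp add: algebra_simps)
      finally show ?thesis using \<open>n = Suc m\<close> by simp
    qed
  qed
qed

definition herm :: "nat \<Rightarrow> real \<Rightarrow> real" where
  "herm n x = poly (hermite_poly n) x"

lemma herm_0 [simp]: "herm 0 x = 1"
  by (simp add: herm_def)

lemma herm_Suc: "herm (Suc n) x = x * herm n x - n * herm (n - 1) x"
  by (simp add: herm_def pderiv_hermite_poly)

lemma herm_Suc_0: "herm (Suc 0) x = x"
  by (simp add: herm_Suc)

lemma herm_Suc_Suc: "herm (Suc (Suc n)) x = x * herm (Suc n) x - Suc n * herm n x"
  by (simp add: herm_Suc[of "Suc n"])

lemma herm_derivative: "(herm n has_real_derivative n * herm (n - 1) x) (at x)"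
  using poly_DERIV[of "hermite_poly n" x]
  unfolding herm_def pderiv_hermite_poly by simp

lemma herm_minus: "herm n (- x) = (- 1) ^ n * herm n x"
proof (induction n rule: less_induct)
  case (less n)
  show ?case
  proof (cases n)
    case 0
    then show ?thesis by simp
  next
    case (Suc m)
    show ?thesis
      by (cases m) (use less.IH Suc in \<open>simp_all add: herm_Suc_0 herm_Suc_Suc algebra_simps\<close>)
  qed
qed

text \<open>
  Subexponential growth, just enough for power series with coefficients of this kind to converge in the unit disc.
  After division by \<open>\<surd>n!\<close> the recurrence reads \<open>a(n+2) \<le> \<epsilon>(n) a(n+1) + a(n)\<close> with \<open>\<epsilon>(n) \<rightarrow> 0\<close>, and \<open>D s\<^sup>n\<close>
  dominates every such sequence once \<open>\<epsilon>(n) \<le> s - 1/s\<close>.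
\<close>

lemma herm_exp_bound:
  assumes "s > (1::real)"
  shows "\<exists>D\<ge>0. \<forall>n. \<bar>herm n x\<bar> \<le> D * s ^ n * sqrt (fact n)"
proof -
  define a where "a n = \<bar>herm n x\<bar> / sqrt (fact n)" for n
  have rec: "a (Suc (Suc n)) \<le> \<bar>x\<bar> / sqrt (Suc (Suc n)) * a (Suc n) + a n" for n
  proof -
    have "\<bar>herm (Suc (Suc n)) x\<bar> \<le> \<bar>x\<bar> * \<bar>herm (Suc n) x\<bar> + Suc n * \<bar>herm n x\<bar>"
      using abs_triangle_ineq4[of "x * herm (Suc n) x" "Suc n * herm n x"]
      by (simp add: herm_Suc[of "Suc n"] abs_mult del: of_nat_Suc)
    hence "a (Suc (Suc n)) \<le> (\<bar>x\<bar> * \<bar>herm (Suc n) x\<bar> + Suc n * \<bar>herm n x\<bar>) / sqrt (fact (Suc (Suc n)))"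
      unfolding a_def by (intro divide_right_mono) auto
    also have "\<dots> = \<bar>x\<bar> / sqrt (Suc (Suc n)) * a (Suc n) + Suc n / sqrt (real (Suc n) * Suc (Suc n)) * a n"
    proof -
      have f1: "fact (Suc (Suc n)) = real (Suc (Suc n)) * fact (Suc n)"
        and f2: "fact (Suc (Suc n)) = (real (Suc n) * Suc (Suc n)) * fact n" by simp_all
      have "\<bar>x\<bar> * \<bar>herm (Suc n) x\<bar> / sqrt (fact (Suc (Suc n))) = \<bar>x\<bar> / sqrt (Suc (Suc n)) * a (Suc n)"
        unfolding a_def f1 real_sqrt_mult by simp
      moreover have "Suc n * \<bar>herm n x\<bar> / sqrt (fact (Suc (Suc n)))
          = Suc n / sqrt (real (Suc n) * Suc (Suc n)) * a n"
        unfolding a_def f2 real_sqrt_mult[of _ "fact n"] by simp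
      ultimately show ?thesis by (simp only: add_divide_distrib)
    qed
    also have "real (Suc n) / sqrt (real (Suc n) * Suc (Suc n)) \<le> 1"
    proof -
      have "real (Suc n) = sqrt (real (Suc n) * Suc n)" by simp
      also have "\<dots> \<le> sqrt (real (Suc n) * Suc (Suc n))" 
        by (intro real_sqrt_le_mono mult_left_mono) auto
      finally show ?thesis by (simp add: divide_le_eq)
    qed
    hence "Suc n / sqrt (real (Suc n) * Suc (Suc n)) * a n \<le> 1 * a n"
      by (intro mult_right_mono) (auto simp: a_def)
    finally show ?thesis by simp
  qed
  have sp: "s - 1 / s > 0" using assms by (simp add: field_simps) (smt (verit) mult_less_cancel_left1)
  have "(\<lambda>n. \<bar>x\<bar> / sqrt (Suc (Suc n))) \<longlonglongrightarrow> 0"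
    by real_asymp
  hence "eventually (\<lambda>n. \<bar>x\<bar> / sqrt (Suc (Suc n)) < s - 1 / s) sequentially"
    using order_tendstoD(2) sp by blast
  then obtain N where N: "\<And>n. n \<ge> N \<Longrightarrow> \<bar>x\<bar> / sqrt (Suc (Suc n)) < s - 1 / s"
    by (auto simp: eventually_sequentially)
  \<comment> \<open>Large enough for the finitely many indices below the threshold.\<close>
  define D where "D = (\<Sum>n\<le>Suc N. a n / s ^ n)"
  have a0: "a n \<ge> 0" for n by (simp add: a_def)
  have D0: "D \<ge> 0" using assms unfolding D_def by (intro sum_nonneg) (simp add: a0)
  have bnd: "a n \<le> D * s ^ n" for n
  proof (induction n rule: less_induct)
    case (less n)
    show ?case
    proof (cases "n \<le> Suc N")
      case True
      hence "a n / s ^ n \<le> D" unfolding D_def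
        using assms by (intro member_le_sum) (auto simp: a0)
      then show ?thesis using assms by (simp add: field_simps)
    next
      case False
      then obtain m where m: "n = Suc (Suc m)" "m \<ge> N"
        by (metis Suc_le_eq not_less_eq_eq old.nat.exhaust le0 nat_le_linear Suc_le_mono)
      have "a n \<le> \<bar>x\<bar> / sqrt (Suc (Suc m)) * a (Suc m) + a m" using rec m by simp
      also have "\<dots> \<le> (s - 1 / s) * (D * s ^ Suc m) + D * s ^ m"
        using less.IH[of "Suc m"] less.IH[of m] m N[of m] sp a0 D0 assms
        by (intro add_mono mult_mono) (auto intro: less_imp_le)
      also have "\<dots> = D * s ^ n" using assms m by (simp add: field_simps)
      finally show ?thesis .
    qed
  qed
  have "\<forall>n. \<bar>herm n x\<bar> \<le> D * s ^ n * sqrt (fact n)"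
    using bnd unfolding a_def by (simp add: field_simps)
  with D0 show ?thesis by blast
qed

section \<open>Mehler's formula in one variable\<close>

lemma sums_power_shift:
  fixes z :: complex
  assumes "(\<lambda>n. g n * z ^ n) sums s"
  shows "(\<lambda>n. (if n = 0 then 0 else g (n - 1)) * z ^ n) sums (z * s)"
proof -
  have "(\<lambda>n. (if Suc n = 0 then 0 else g (Suc n - 1)) * z ^ Suc n) sums (z * s)"
    using sums_mult[OF assms, of z] by (simp add: mult_ac)
  from this[unfolded sums_Suc_iff[of "\<lambda>n. (if n = 0 then 0 else g (n - 1)) * z ^ n"]]
  show ?thesis by simp
qed

text \<open>
  The shifts \<open>j\<close> and \<open>k\<close> cover Mehler's series, its derivative and the two mixed series that the proof of
  Mehler's formula needs.
\<close>

lemma summable_herm_product: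
  fixes z :: complex
  assumes "norm z < 1" "j \<le> 1" "k \<le> 1"
  shows "summable (\<lambda>n. of_real (herm (n + j) x * herm (n + k) y / fact n) * z ^ n)"
proof -
  \<comment> \<open>Then \<open>s > 1\<close> and still \<open>|z| s\<^sup>2 < 1\<close>.\<close>
  define s where "s = sqrt (2 / (1 + norm z))"
  have s2: "s ^ 2 = 2 / (1 + norm z)"
    unfolding s_def by (rule real_sqrt_pow2) (simp add: add_nonneg_nonneg)
  have s1: "s > 1" unfolding s_def using assms(1)
    by (simp add: add_nonneg_pos less_divide_eq add_pos_nonneg)
  define q where "q = norm z * s ^ 2"
  have q: "0 \<le> q" "q < 1" unfolding q_def s2 using assms(1)
    by (simp_all add: add_pos_nonneg divide_less_eq)
  have "\<exists>D\<ge>0. \<forall>n. \<bar>herm n x\<bar> \<le> D * s ^ n * sqrt (fact n)" by (rule herm_exp_bound[OF s1])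
  then obtain D where D: "D \<ge> 0" "\<And>n. \<bar>herm n x\<bar> \<le> D * s ^ n * sqrt (fact n)" by blast
  have "\<exists>D\<ge>0. \<forall>n. \<bar>herm n y\<bar> \<le> D * s ^ n * sqrt (fact n)" by (rule herm_exp_bound[OF s1])
  then obtain D' where D': "D' \<ge> 0" "\<And>n. \<bar>herm n y\<bar> \<le> D' * s ^ n * sqrt (fact n)" by blast
  have mono: "s ^ (n + i) * sqrt (fact (n + i)) \<le> s ^ (n + 1) * sqrt (fact (n + 1))" if "i \<le> 1" for n i
    using s1 that by (intro mult_mono power_increasing real_sqrt_le_mono fact_mono) auto
  have b: "\<bar>herm (n + i) x\<bar> \<le> D * (s ^ (n + 1) * sqrt (fact (n + 1)))" if "i \<le> 1" for n i
    using order_trans[OF D(2) mult_left_mono[OF mono[OF that] D(1), of n, folded mult.assoc]]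
    by (simp only: mult.assoc)
  have b': "\<bar>herm (n + i) y\<bar> \<le> D' * (s ^ (n + 1) * sqrt (fact (n + 1)))" if "i \<le> 1" for n i
    using order_trans[OF D'(2) mult_left_mono[OF mono[OF that] D'(1), of n, folded mult.assoc]]
    by (simp only: mult.assoc)
  have "summable (\<lambda>n. D * D' * s ^ 2 * (of_nat (Suc n) * q ^ n))"
    using geometric_deriv_sums[of q] q by (intro summable_mult) (auto simp: sums_iff)
  thus ?thesis
  proof (rule summable_comparison_test'[where N = 0])
    fix n :: nat
    have "norm (of_real (herm (n + j) x * herm (n + k) y / fact n) * z ^ n)
        = \<bar>herm (n + j) x\<bar> * \<bar>herm (n + k) y\<bar> / fact n * norm z ^ n"
      by (simp add: norm_mult norm_divide norm_power abs_mult)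
    also have "\<dots> \<le> (D * (s ^ (n + 1) * sqrt (fact (n + 1)))) * (D' * (s ^ (n + 1) * sqrt (fact (n + 1)))) / fact n * norm z ^ n"
      using b[OF assms(2), of n] b'[OF assms(3), of n] D(1) D'(1) s1
      by (intro mult_right_mono divide_right_mono mult_mono) auto
    also have "\<dots> = D * D' * s ^ 2 * (sqrt (fact (n + 1)) * sqrt (fact (n + 1)) / fact n * q ^ n)"
      unfolding q_def power_mult_distrib by (simp add: power_mult[symmetric] power_add power2_eq_square field_simps power_even_eq)
    also have "sqrt (fact (n + 1)) * sqrt (fact (n + 1)) / fact n = real (Suc n)"
      by (subst real_sqrt_mult_self) simp
    finally show "norm (of_real (herm (n + j) x * herm (n + k) y / fact n) * z ^ n)
        \<le> D * D' * s ^ 2 * (of_nat (Suc n) * q ^ n)" .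
  qed
qed

text \<open>
  The kernel is taken relative to the Gaussian measure and normalised to be 1 at \<open>z = 0\<close>.
\<close>

definition mehler :: "complex \<Rightarrow> real \<Rightarrow> real \<Rightarrow> complex" where
  "mehler z x y =
    exp ((z * (of_real x * of_real y) - z ^ 2 * (of_real x ^ 2 + of_real y ^ 2) / 2) / (1 - z ^ 2))
      / csqrt (1 - z ^ 2)"

lemma Re_one_minus_square_pos:
  assumes "norm (z::complex) < 1" shows "Re (1 - z ^ 2) > 0"
proof -
  have "Re (z ^ 2) \<le> norm z ^ 2" using complex_Re_le_cmod[of "z ^ 2"] by (simp add: norm_power)
  also have "\<dots> < 1" using assms by (simp add: power_less_one_iff)
  finally show ?thesis by simp
qed

text \<open>
  Both sides solve the same first-order linear differential equation in \<open>z\<close> and agree at \<open>0\<close>.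
  Write \<open>A\<close> for the series and \<open>B\<close>, \<open>C\<close> for the series in which \<open>x\<close>, respectively \<open>y\<close>, carries degree \<open>n + 1\<close> instead of \<open>n\<close>.
  The three-term recurrence gives \<open>B = x A - z C\<close>, \<open>C = y A - z B\<close> and
  \<open>A' = x C - z y C + z (A + z A')\<close>; eliminating \<open>B\<close> and \<open>C\<close> yields
  \<open>(1 - z\<^sup>2)\<^sup>2 A' = ((x - z y) (y - z x) + z (1 - z\<^sup>2)) A\<close>.
\<close>

lemma mehler_formula:
  fixes z :: complex and x y :: real
  assumes "norm z < 1"
  shows "(\<lambda>n. of_real (herm n x * herm n y / fact n) * z ^ n) sums mehler z x y"
proof -
  define c B C where "c n = complex_of_real (herm n x * herm n y / fact n)"
    and "B n = complex_of_real (herm (Suc n) x * herm n y / fact n)"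
    and "C n = complex_of_real (herm n x * herm (Suc n) y / fact n)" for n
  define A where "A w = (\<Sum>n. c n * w ^ n)" for w :: complex
  define D where "D w = (\<Sum>n. diffs c n * w ^ n)" for w :: complex
  have Brec: "B n = x * c n - (if n = 0 then 0 else C (n - 1))" for n
    by (cases n) (simp_all add: B_def c_def C_def herm_Suc[of "Suc _"] herm_Suc_0 field_simps del: of_nat_Suc)
  have Crec: "C n = y * c n - (if n = 0 then 0 else B (n - 1))" for n
    by (cases n) (simp_all add: B_def c_def C_def herm_Suc[of "Suc _"] herm_Suc_0 field_simps del: of_nat_Suc)
  have diffs_c: "diffs c n = complex_of_real (herm (Suc n) x * herm (Suc n) y / fact n)" for n
    unfolding diffs_def c_def by (simp add: field_simps del: of_nat_Suc)
  have Drec: "diffs c n = x * C n - y * (if n = 0 then 0 else C (n - 1))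
      + (if n = 0 then 0 else c (n - 1) + (if n - 1 = 0 then 0 else diffs c (n - 1 - 1)))" for n
  proof (cases n)
    case 0
    then show ?thesis by (simp add: diffs_c C_def herm_Suc_0)
  next
    case (Suc m)
    have e: "(if n - 1 = 0 then 0 else diffs c (n - 1 - 1)) = of_nat m * c m"
      by (cases m) (simp_all add: Suc diffs_def)
    have h: "herm (Suc n) x * herm (Suc n) y = x * (herm n x * herm (Suc n) y)
        - real n * (y * (herm m x * herm n y)) + real n * (real n * (herm m x * herm m y))"
    proof -
      have hx: "herm (Suc n) x = x * herm n x - real n * herm m x"
        and hy: "herm (Suc n) y = y * herm n y - real n * herm m y"
        by (simp_all add: herm_Suc_Suc Suc)
      have "herm (Suc n) x * herm (Suc n) y
          = x * (herm n x * herm (Suc n) y) - real n * (herm m x * herm (Suc n) y)"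
        unfolding hx by (simp add: algebra_simps)
      also have "herm m x * herm (Suc n) y = y * (herm m x * herm n y) - real n * (herm m x * herm m y)"
        unfolding hy by (simp add: algebra_simps)
      finally show ?thesis by (simp add: algebra_simps)
    qed
    have fn: "fact n = real n * fact m" "real n \<noteq> 0" by (simp_all add: Suc)
    have "herm (Suc n) x * herm (Suc n) y / fact n = x * (herm n x * herm (Suc n) y / fact n)
       - y * (herm m x * herm n y / fact m) + real n * (herm m x * herm m y / fact m)"
      unfolding h unfolding fn(1) using fn(2) by (simp add: field_simps)
    hence "complex_of_real (herm (Suc n) x * herm (Suc n) y / fact n)
       = of_real (x * (herm n x * herm (Suc n) y / fact n)
         - y * (herm m x * herm n y / fact m) + real n * (herm m x * herm m y / fact m))"
      by (rule arg_cong)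
    moreover have "C m = complex_of_real (herm m x * herm n y / fact m)"
      by (simp add: C_def Suc)
    ultimately have "diffs c n = x * C n - y * C m + of_nat n * c m"
      unfolding diffs_c c_def C_def[of n]
      by (simp only: of_real_add of_real_diff of_real_mult[of x] of_real_mult[of y]
          of_real_mult[of "real n"] of_real_of_nat_eq)
    thus ?thesis unfolding e using Suc by (simp add: algebra_simps)
  qed
  have sumc: "(\<lambda>n. c n * w ^ n) sums A w" if "norm w < 1" for w :: complex
    unfolding A_def c_def using summable_herm_product[OF that, of 0 0 x y] by (simp add: summable_sums)
  have sumD: "(\<lambda>n. diffs c n * w ^ n) sums D w" if "norm w < 1" for w :: complex
    unfolding D_def diffs_c using summable_herm_product[OF that, of 1 1 x y] by (simp add: summable_sums)
  have ode: "(1 - w ^ 2) * ((1 - w ^ 2) * D w) = ((x - w * y) * (y - w * x) + w * (1 - w ^ 2)) * A w"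
    if w: "norm w < 1" for w :: complex
  proof -
    define SB SC where "SB = (\<Sum>n. B n * w ^ n)" and "SC = (\<Sum>n. C n * w ^ n)"
    have sB: "(\<lambda>n. B n * w ^ n) sums SB" and sC: "(\<lambda>n. C n * w ^ n) sums SC"
      unfolding SB_def B_def SC_def C_def
      using summable_herm_product[OF w, of 1 0 x y] summable_herm_product[OF w, of 0 1 x y]
      by (simp_all add: summable_sums)
    have "(\<lambda>n. x * (c n * w ^ n) - (if n = 0 then 0 else C (n - 1)) * w ^ n) sums (x * A w - w * SC)"
      by (intro sums_diff sums_mult sumc sums_power_shift sC w)
    hence 1: "SB = x * A w - w * SC"
      by (intro sums_unique2[OF sB]) (simp add: Brec algebra_simps)
    have "(\<lambda>n. y * (c n * w ^ n) - (if n = 0 then 0 else B (n - 1)) * w ^ n) sums (y * A w - w * SB)"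
      by (intro sums_diff sums_mult sumc sums_power_shift sB w)
    hence 2: "SC = y * A w - w * SB"
      by (intro sums_unique2[OF sC]) (simp add: Crec algebra_simps)
    have "(\<lambda>n. c n * w ^ n + (if n = 0 then 0 else diffs c (n - 1)) * w ^ n) sums (A w + w * D w)"
      by (intro sums_add sumc sums_power_shift sumD w)
    hence "(\<lambda>n. (c n + (if n = 0 then 0 else diffs c (n - 1))) * w ^ n) sums (A w + w * D w)"
      by (simp only: distrib_right)
    note sh = sums_power_shift[OF this]
    have "(\<lambda>n. x * (C n * w ^ n) - y * ((if n = 0 then 0 else C (n - 1)) * w ^ n)
       + (if n = 0 then 0 else c (n - 1) + (if n - 1 = 0 then 0 else diffs c (n - 1 - 1))) * w ^ n)
       sums (x * SC - y * (w * SC) + w * (A w + w * D w))"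
      by (intro sums_add sums_diff sums_mult sC sh sums_power_shift[OF sC])
    hence 3: "D w = x * SC - y * (w * SC) + w * (A w + w * D w)"
    proof (intro sums_unique2[OF sumD[OF w]], elim back_subst[of "\<lambda>f. f sums _"], intro ext)
      fix n
      show "x * (C n * w ^ n) - y * ((if n = 0 then 0 else C (n - 1)) * w ^ n)
         + (if n = 0 then 0 else c (n - 1) + (if n - 1 = 0 then 0 else diffs c (n - 1 - 1))) * w ^ n
         = diffs c n * w ^ n"
        unfolding Drec[of n] by (simp only: algebra_simps)
    qed
    have "SC = y * A w - w * (x * A w - w * SC)"
      using 2 unfolding 1 .
    hence 4: "(1 - w ^ 2) * SC = (y - w * x) * A w"
      by (simp add: algebra_simps power2_eq_square)
    have 5: "(1 - w ^ 2) * D w = (x - w * y) * SC + w * A w"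
      using 3 by (simp add: algebra_simps power2_eq_square)
    have "(1 - w ^ 2) * ((1 - w ^ 2) * D w) = (1 - w ^ 2) * ((x - w * y) * SC + w * A w)"
      by (simp only: 5)
    also have "\<dots> = (x - w * y) * ((1 - w ^ 2) * SC) + w * (1 - w ^ 2) * A w"
      by (simp add: algebra_simps)
    finally show ?thesis unfolding 4 by (simp add: algebra_simps)
  qed
  define G where "G w = A w * csqrt (1 - w ^ 2) *
    exp (- ((w * (of_real x * of_real y) - w ^ 2 * (of_real x ^ 2 + of_real y ^ 2) / 2) / (1 - w ^ 2)))" for w :: complex
  have dA: "(A has_field_derivative D w) (at w)" if "norm w < 1" for w :: complex
    unfolding A_def[abs_def] D_def
  proof (rule termdiffs_strong'[of 1])
    show "\<And>z. norm z < 1 \<Longrightarrow> summable (\<lambda>n. c n * z ^ n)" using sumc by (auto simp: sums_iff)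
  qed (use that in auto)
  have dG: "(G has_field_derivative 0) (at w)" if w: "norm w < 1" for w :: complex
  proof -
    define v where "v = 1 - w ^ 2"
    have Re: "Re v > 0" unfolding v_def by (rule Re_one_minus_square_pos[OF w])
    hence v0: "v \<noteq> 0" "v \<notin> \<real>\<^sub>\<le>\<^sub>0" by (auto simp: complex_nonpos_Reals_iff)
    have cs: "csqrt v * csqrt v = v" by (metis power2_csqrt power2_eq_square)
    have cs0: "csqrt v \<noteq> 0" using v0 by simp
    define N where "N = w * (of_real x * of_real y) - w ^ 2 * (of_real x ^ 2 + of_real y ^ 2) / 2"
    define N' where "N' = of_real x * of_real y - w * (of_real x ^ 2 + of_real y ^ 2 :: complex)"
    define E' where "E' = (N' * v + 2 * w * N) / v ^ 2"
    have NE: "N' * v + 2 * w * N = (x - w * y) * (y - w * x)"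
      unfolding N'_def N_def v_def by (simp add: power2_eq_square algebra_simps)
    have "(G has_field_derivative ((D w * csqrt v + A w * (- (2 * w) * (1 / (2 * csqrt v)))) * exp (- (N / v))
       + A w * csqrt v * (exp (- (N / v)) * (- E')))) (at w)"
      unfolding G_def[abs_def] E'_def N'_def N_def v_def
      by (rule derivative_eq_intros dA w refl
         | (use v0 in \<open>simp add: v_def field_simps power2_eq_square\<close>; fail))+
        (use v0 in \<open>simp add: v_def divide_simps; simp add: power2_eq_square algebra_simps\<close>)
    also have "(D w * csqrt v + A w * (- (2 * w) * (1 / (2 * csqrt v)))) * exp (- (N / v))
       + A w * csqrt v * (exp (- (N / v)) * (- E'))
       = exp (- (N / v)) / csqrt v * (v * D w - w * A w - A w * v * E')"
    proof -
      have "(d * s + a * (- (2 * w) * (1 / (2 * s)))) * e + a * s * (e * (- E))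
          = e / s * ((s * s) * d - w * a - a * (s * s) * E)" if "s \<noteq> 0" for a d e s E :: complex
        using that by (simp add: field_simps)
      from this[OF cs0] show ?thesis unfolding cs .
    qed
    also have "v * D w - w * A w - A w * v * E' = 0"
    proof -
      have "v * (v * D w) - v * (w * A w) - A w * (v ^ 2 * E') = 0"
      proof -
        have vE: "v ^ 2 * E' = (x - w * y) * (y - w * x)"
          unfolding E'_def NE using v0 by simp
        show ?thesis unfolding vE using ode[OF w, folded v_def] by (simp add: algebra_simps)
      qed
      hence "v * (v * D w - w * A w - A w * v * E') = 0" by (simp add: algebra_simps power2_eq_square)
      thus ?thesis using v0 by simp
    qed
    finally show ?thesis by simp
  qed
  have "\<exists>k. \<forall>w\<in>ball 0 1. G w = k"
    by (rule has_field_derivative_zero_constant) (auto intro!: has_field_derivative_at_within dG)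
  then obtain k where k: "\<And>w. norm w < 1 \<Longrightarrow> G w = k" by auto
  have "A 0 = 1" using powser_zero[of c] unfolding A_def by (simp add: c_def)
  hence "G 0 = 1" unfolding G_def by simp
  with k[of 0] k[OF assms] have Gz: "G z = 1" by simp
  have "csqrt (1 - z ^ 2) \<noteq> 0" using Re_one_minus_square_pos[OF assms] by auto
  hence "A z = mehler z x y"
    using Gz unfolding G_def mehler_def exp_minus by (simp add: field_simps)
  thus ?thesis using sumc[OF assms] unfolding c_def by simp
qed

section \<open>Growth of the Hermite polynomials\<close>

lemma csqrt_of_pos_real: "w > 0 \<Longrightarrow> csqrt (complex_of_real w) = of_real (sqrt w)"
  by (simp add: csqrt_of_real_nonneg)

text \<open>
  For \<open>x = y\<close> and real \<open>z = r\<close> all terms of Mehler's series are nonnegative, so each one is at most the sum.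
  The choice \<open>r = n / (n + 1)\<close> keeps \<open>r\<^sup>n\<close> above \<open>1/3\<close> while \<open>1 / sqrt (1 - r\<^sup>2)\<close> grows only like \<open>sqrt n\<close>.
\<close>

lemma herm_square_bound: "herm n x ^ 2 \<le> 4 * (real n + 1) * fact n * exp (x ^ 2 / 2)"
proof (cases "n = 0")
  case True
  have "1 \<le> exp (x ^ 2 / 2)" by simp
  hence "1 \<le> 4 * exp (x ^ 2 / 2)" by linarith
  then show ?thesis using True by simp
next
  case False
  define r where "r = real n / (real n + 1)"
  have r: "0 < r" "r < 1" using False by (simp_all add: r_def)
  define F where "F = exp ((r * (x * x) - r ^ 2 * (x ^ 2 + x ^ 2) / 2) / (1 - r ^ 2)) / sqrt (1 - r ^ 2)"
  have r2: "1 - r ^ 2 > 0" using r by (simp add: power_less_one_iff)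
  have "mehler (of_real r) x x = of_real F"
    unfolding mehler_def F_def using csqrt_of_pos_real[OF r2]
    by (simp add: exp_of_real[symmetric] power2_eq_square)
  with mehler_formula[of "of_real r" x x] r
  have "(\<lambda>n. complex_of_real (herm n x * herm n x / fact n * r ^ n)) sums of_real F"
    by simp
  hence s: "(\<lambda>n. herm n x * herm n x / fact n * r ^ n) sums F"
    unfolding sums_of_real_iff .
  have "herm n x * herm n x / fact n * r ^ n \<le> (\<Sum>k. herm k x * herm k x / fact k * r ^ k)"
    using sum_le_suminf[of "\<lambda>k. herm k x * herm k x / fact k * r ^ k" "{n}"] s r
    by (auto simp: sums_iff)
  hence 1: "herm n x ^ 2 / fact n * r ^ n \<le> F" using s by (simp add: sums_iff power2_eq_square)
  have rn: "r ^ n \<ge> 1 / 3"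
  proof -
    have "(1 + 1 / real n) ^ n \<le> exp 1"
      using exp_ge_one_plus_x_over_n_power_n[of n 1] False by simp
    also have "exp 1 \<le> (3::real)" by (rule exp_le)
    finally have "(1 / r) ^ n \<le> 3" using False by (simp add: r_def add_divide_distrib)
    thus ?thesis using r by (simp add: power_divide field_simps)
  qed
  have F: "F \<le> exp (x ^ 2 / 2) * sqrt (real n + 1)"
  proof -
    have e: "(r * (x * x) - r ^ 2 * (x ^ 2 + x ^ 2) / 2) / (1 - r ^ 2) = r / (1 + r) * x ^ 2"
      using r2 r by (simp add: divide_simps) (simp add: power2_eq_square algebra_simps)
    have "r / (1 + r) * x ^ 2 \<le> 1 / 2 * x ^ 2"
      using r by (intro mult_right_mono) (simp_all add: field_simps)
    hence a: "exp (r / (1 + r) * x ^ 2) \<le> exp (x ^ 2 / 2)" by simp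
    have "1 - r ^ 2 \<ge> 1 - r" using r by (simp add: power2_eq_square mult_left_le)
    also have "1 - r = 1 / (real n + 1)" by (simp add: r_def field_simps)
    finally have "1 / (real n + 1) \<le> 1 - r ^ 2" .
    hence "sqrt (1 / (real n + 1)) \<le> sqrt (1 - r ^ 2)" by simp
    hence b: "1 / sqrt (1 - r ^ 2) \<le> sqrt (real n + 1)"
      using r2 by (simp add: real_sqrt_divide field_simps)
    show ?thesis unfolding F_def e using mult_mono[OF a b] r2 by simp
  qed
  have "sqrt (real n + 1) \<le> real n + 1" by (rule real_le_lsqrt) (auto simp: power2_eq_square)
  have "herm n x ^ 2 / fact n * (1 / 3) \<le> exp (x ^ 2 / 2) * (real n + 1)"
  proof -
    have "herm n x ^ 2 / fact n * (1 / 3) \<le> herm n x ^ 2 / fact n * r ^ n"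
      by (rule mult_left_mono[OF rn]) simp
    also have "\<dots> \<le> F" by (rule 1)
    also have "\<dots> \<le> exp (x ^ 2 / 2) * sqrt (real n + 1)" by (rule F)
    also have "\<dots> \<le> exp (x ^ 2 / 2) * (real n + 1)"
      by (rule mult_left_mono[OF \<open>sqrt (real n + 1) \<le> real n + 1\<close>]) simp
    finally show ?thesis .
  qed
  hence "herm n x ^ 2 \<le> 3 * ((real n + 1) * fact n * exp (x ^ 2 / 2))"
    by (simp add: field_simps)
  also have "\<dots> \<le> 4 * ((real n + 1) * fact n * exp (x ^ 2 / 2))"
    by (intro mult_right_mono) auto
  finally show ?thesis by (simp only: mult.assoc)
qed

lemma herm_bound: "\<bar>herm n x\<bar> \<le> 2 * (real n + 1) * sqrt (fact n) * exp (x ^ 2 / 4)"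
proof (rule power2_le_imp_le)
  have "herm n x ^ 2 \<le> 4 * (real n + 1) * fact n * exp (x ^ 2 / 2)" by (rule herm_square_bound)
  also have "\<dots> \<le> 4 * (real n + 1) ^ 2 * fact n * exp (x ^ 2 / 2)"
    by (intro mult_right_mono mult_left_mono) (auto simp: power2_eq_square)
  also have "\<dots> = (2 * (real n + 1) * sqrt (fact n) * exp (x ^ 2 / 4)) ^ 2"
  proof -
    have "exp (x ^ 2 / 4) ^ 2 = exp (x ^ 2 / 2)" by (simp add: exp_double[symmetric])
    thus ?thesis unfolding power_mult_distrib by simp
  qed
  finally show "\<bar>herm n x\<bar> ^ 2 \<le> (2 * (real n + 1) * sqrt (fact n) * exp (x ^ 2 / 4)) ^ 2" by simp
qed auto

text \<open>
  By the recurrence \<open>x\<^sup>2\<close> times a Hermite polynomial is a combination of the three of degrees \<open>n + 2\<close>, \<open>n\<close> and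
  \<open>n - 2\<close>. Hence the decay \<open>1 / (1 + x\<^sup>2)\<close> relative to \<open>exp(x\<^sup>2/4)\<close>, which makes the bound square integrable
  for the Gaussian measure, costs one further power of \<open>n\<close>.
\<close>

lemma herm_weighted_bound:
  "\<bar>herm n x\<bar> \<le> 18 * (real n + 1) ^ 2 * sqrt (fact n) * exp (x ^ 2 / 4) / (1 + x ^ 2)"
proof -
  define e where "e = exp (x ^ 2 / 4)"
  have e0: "e > 0" by (simp add: e_def)
  define f where "f = sqrt (fact n)"
  have f0: "f > 0" by (simp add: f_def)
  have x2: "x ^ 2 * herm n x = herm (n + 2) x + (2 * real n + 1) * herm n x + real n * (real n - 1) * herm (n - 2) x"
  proof (cases n)
    case 0
    then show ?thesis by (simp add: numeral_2_eq_2 herm_Suc_Suc herm_Suc_0)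
  next
    case (Suc m)
    have a: "x * herm n x = herm (Suc n) x + real n * herm m x"
      unfolding Suc by (simp add: herm_Suc_Suc)
    have b: "x * herm (Suc n) x = herm (n + 2) x + real (Suc n) * herm n x"
      by (simp add: herm_Suc_Suc)
    have c: "x * herm m x = herm n x + (real n - 1) * herm (n - 2) x"
      unfolding Suc by (cases m) (simp_all add: herm_Suc_0 herm_Suc_Suc)
    have "x ^ 2 * herm n x = x * (x * herm n x)" by (simp add: power2_eq_square)
    also have "\<dots> = x * herm (Suc n) x + real n * (x * herm m x)" unfolding a by (simp add: algebra_simps)
    finally show ?thesis unfolding b c by (simp add: algebra_simps)
  qed
  have 1: "\<bar>herm (n + 2) x\<bar> \<le> 12 * (real n + 1) ^ 2 * f * e"
  proof -
    have "fact (n + 2) = ((real n + 1) * (real n + 2)) * fact n" by (simp add: algebra_simps)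
    hence s: "sqrt (fact (n + 2)) = sqrt ((real n + 1) * (real n + 2)) * f"
      unfolding f_def by (simp only: real_sqrt_mult)
    have "sqrt ((real n + 1) * (real n + 2)) \<le> 2 * (real n + 1)"
      by (rule real_le_lsqrt) (auto simp: power2_eq_square algebra_simps)
    hence "\<bar>herm (n + 2) x\<bar> \<le> 2 * (3 * (real n + 1)) * (2 * (real n + 1) * f) * e"
      using f0 e0 unfolding e_def
      by (intro order_trans[OF herm_bound]) (unfold s, intro mult_mono, auto)
    thus ?thesis by (simp add: power2_eq_square algebra_simps)
  qed
  have 2: "\<bar>herm n x\<bar> \<le> 2 * (real n + 1) * f * e"
    using herm_bound[of n x] by (simp add: f_def e_def)
  have 3: "\<bar>real n * (real n - 1) * herm (n - 2) x\<bar> \<le> 2 * (real n + 1) ^ 2 * f * e"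
  proof (cases "n \<ge> 2")
    case True
    then obtain m where m: "n = m + 2" by (metis le_add_diff_inverse2)
    have "fact n = ((real m + 1) * (real m + 2)) * fact m" by (simp add: m algebra_simps)
    hence s: "f = sqrt ((real m + 1) * (real m + 2)) * sqrt (fact m)"
      unfolding f_def by (simp only: real_sqrt_mult)
    have g: "(real m + 1) * (real m + 2) = sqrt ((real m + 1) * (real m + 2)) * sqrt ((real m + 1) * (real m + 2))"
      by (simp only: real_sqrt_mult_self) (simp add: abs_mult)
    have "\<bar>real n * (real n - 1) * herm (n - 2) x\<bar> = (real m + 1) * (real m + 2) * \<bar>herm m x\<bar>"
    proof -
      have "real n * (real n - 1) = (real m + 1) * (real m + 2)" by (simp add: m algebra_simps)
      moreover have "n - 2 = m" by (simp add: m)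
      ultimately show ?thesis by (simp only: abs_mult)
    qed
    also have "\<dots> \<le> (real m + 1) * (real m + 2) * (2 * (real m + 1) * sqrt (fact m) * e)"
      unfolding e_def by (intro mult_left_mono herm_bound) auto
    also have "\<dots> = sqrt ((real m + 1) * (real m + 2)) * (2 * (real m + 1) * f * e)"
      by (subst g) (simp only: s mult_ac)
    also have "\<dots> \<le> (real n + 1) * (2 * (real n + 1) * f * e)"
    proof (intro mult_mono)
      show "sqrt ((real m + 1) * (real m + 2)) \<le> real n + 1"
        by (rule real_le_lsqrt) (auto simp: m power2_eq_square algebra_simps)
    qed (use f0 e0 m in auto)
    finally show ?thesis by (simp add: power2_eq_square algebra_simps)
  next
    case False
    hence "n = 0 \<or> n = 1" by linarith
    then show ?thesis using f0 e0 by auto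
  qed
  have "(1 + x ^ 2) * \<bar>herm n x\<bar> = \<bar>herm n x + x ^ 2 * herm n x\<bar>"
  proof -
    have "\<bar>herm n x + x ^ 2 * herm n x\<bar> = \<bar>1 + x ^ 2\<bar> * \<bar>herm n x\<bar>"
      unfolding abs_mult[symmetric] by (simp add: algebra_simps)
    moreover have "\<bar>1 + x ^ 2\<bar> = 1 + x ^ 2" by (simp add: add_nonneg_nonneg)
    ultimately show ?thesis by simp
  qed
  also have "\<dots> = \<bar>herm (n + 2) x + (2 * real n + 2) * herm n x + real n * (real n - 1) * herm (n - 2) x\<bar>"
    unfolding x2 by (simp add: algebra_simps)
  also have "\<dots> \<le> \<bar>herm (n + 2) x\<bar> + (2 * real n + 2) * \<bar>herm n x\<bar> + \<bar>real n * (real n - 1) * herm (n - 2) x\<bar>"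
    by (intro order_trans[OF abs_triangle_ineq] add_mono) (auto simp: abs_mult)
  also have "\<dots> \<le> 12 * (real n + 1) ^ 2 * f * e + (2 * real n + 2) * (2 * (real n + 1) * f * e) + 2 * (real n + 1) ^ 2 * f * e"
    using 1 2 3 by (intro add_mono mult_left_mono) auto
  also have "\<dots> = 18 * (real n + 1) ^ 2 * f * e" by (simp add: power2_eq_square algebra_simps)
  finally show ?thesis
    by (simp add: f_def e_def pos_le_divide_eq add_pos_nonneg mult.commute)
qed

section \<open>Gradients of complex functions on Euclidean space\<close>

text \<open>
  Total differentiability with prescribed partial derivatives; this form makes the values of \<open>partial\<close> computable.
\<close>

definition has_gradient :: "(real ^ 'n \<Rightarrow> complex) \<Rightarrow> ('n \<Rightarrow> complex) \<Rightarrow> real ^ 'n \<Rightarrow> bool" where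
  "has_gradient f D x \<longleftrightarrow> (f has_derivative (\<lambda>h. \<Sum>i\<in>UNIV. of_real (h $ i) * D i)) (at x)"

lemma partial_eqI: "has_gradient f D x \<Longrightarrow> partial i f x = D i"
proof -
  assume "has_gradient f D x"
  hence "frechet_derivative f (at x) = (\<lambda>h. \<Sum>i\<in>UNIV. of_real (h $ i) * D i)"
    unfolding has_gradient_def by (rule frechet_derivative_at[symmetric])
  thus "partial i f x = D i"
    unfolding partial_def by (simp add: axis_def if_distrib[of of_real] if_distrib[of "\<lambda>a. a * _"] cong: if_cong)
qed

lemma has_gradient_partial:
  assumes "f differentiable (at x)"
  shows "has_gradient f (\<lambda>i. partial i f x) x"
proof -
  let ?L = "frechet_derivative f (at x)"
  have d: "(f has_derivative ?L) (at x)" using assms by (simp add: frechet_derivative_works)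
  then interpret bounded_linear ?L by (rule has_derivative_bounded_linear)
  have "?L h = (\<Sum>i\<in>UNIV. of_real (h $ i) * partial i f x)" for h
  proof -
    have "?L h = ?L (\<Sum>i\<in>UNIV. h $ i *\<^sub>R axis i 1)"
      by (simp add: basis_expansion scalar_mult_eq_scaleR[symmetric])
    also have "\<dots> = (\<Sum>i\<in>UNIV. h $ i *\<^sub>R ?L (axis i 1))" by (simp add: sum scaleR)
    finally show ?thesis by (simp add: partial_def scaleR_conv_of_real)
  qed
  hence "?L = (\<lambda>h. \<Sum>i\<in>UNIV. of_real (h $ i) * partial i f x)" by auto
  with d show ?thesis unfolding has_gradient_def by simp
qed

lemma has_gradient_imp_differentiable: "has_gradient f D x \<Longrightarrow> f differentiable (at x)"
  unfolding has_gradient_def differentiable_def by blast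

lemma has_gradient_mult:
  assumes "has_gradient f D x" "has_gradient g E x"
  shows "has_gradient (\<lambda>x. f x * g x) (\<lambda>i. f x * E i + D i * g x) x"
  using has_derivative_mult[OF assms[unfolded has_gradient_def]]
  unfolding has_gradient_def
  by (rule has_derivative_eq_rhs) (simp add: fun_eq_iff sum_distrib_left sum_distrib_right sum.distrib algebra_simps)

lemma has_gradient_add:
  assumes "has_gradient f D x" "has_gradient g E x"
  shows "has_gradient (\<lambda>x. f x + g x) (\<lambda>i. D i + E i) x"
  using has_derivative_add[OF assms[unfolded has_gradient_def]]
  unfolding has_gradient_def
  by (rule has_derivative_eq_rhs) (simp add: fun_eq_iff sum.distrib algebra_simps)

lemma has_gradient_cmult:
  assumes "has_gradient f D x"
  shows "has_gradient (\<lambda>x. c * f x) (\<lambda>i. c * D i) x"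
  using has_derivative_mult_right[OF assms[unfolded has_gradient_def], of c]
  unfolding has_gradient_def
  by (rule has_derivative_eq_rhs) (simp add: fun_eq_iff sum_distrib_left algebra_simps)

lemma has_gradient_of_real:
  assumes "(f has_derivative (\<lambda>h. \<Sum>i\<in>UNIV. h $ i * D i)) (at x)"
  shows "has_gradient (\<lambda>x. of_real (f x)) (\<lambda>i. of_real (D i)) x"
  using has_derivative_of_real[OF assms]
  unfolding has_gradient_def by (rule has_derivative_eq_rhs) (simp add: fun_eq_iff)

lemma norm_sq_vec: "(norm (x :: real ^ 'n)) ^ 2 = (\<Sum>i\<in>UNIV. (x $ i) ^ 2)"
  unfolding power2_norm_eq_inner inner_vec_def by (simp add: power2_eq_square)

lemmas has_derivative_nth [derivative_intros] =
  bounded_linear.has_derivative[OF bounded_linear_vec_nth]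

lemma has_gradient_coord: "has_gradient (\<lambda>x. of_real (x $ i)) (\<lambda>j. if j = i then 1 else 0) x"
proof -
  have "((\<lambda>x. x $ i) has_derivative (\<lambda>h. \<Sum>j\<in>UNIV. h $ j * (if j = i then 1 else 0))) (at x)"
    by (auto intro!: derivative_eq_intros simp: if_distrib cong: if_cong)
  from has_gradient_of_real[OF this] show ?thesis
    by (simp add: if_distrib cong: if_cong)
qed

lemma has_gradient_exp_norm:
  "has_gradient (\<lambda>x. of_real (exp (a * (norm x) ^ 2))) (\<lambda>i. of_real (2 * a * x $ i * exp (a * (norm x) ^ 2))) x"
  unfolding norm_sq_vec
proof (rule has_gradient_of_real)
  show "((\<lambda>x. exp (a * (\<Sum>i\<in>UNIV. (x $ i)\<^sup>2))) has_derivative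
     (\<lambda>h. \<Sum>i\<in>UNIV. h $ i * (2 * a * x $ i * exp (a * (\<Sum>i\<in>UNIV. (x $ i)\<^sup>2))))) (at x)"
    by (rule derivative_eq_intros refl)+
      (simp add: fun_eq_iff sum_distrib_left sum_distrib_right algebra_simps)
qed

section \<open>Multi-indices and weights\<close>

definition deg :: "('n::finite \<Rightarrow> nat) \<Rightarrow> nat" where
  "deg \<alpha> = (\<Sum>i\<in>UNIV. \<alpha> i)"

definition qprod :: "('n::finite \<Rightarrow> nat) \<Rightarrow> real" where
  "qprod \<alpha> = (\<Prod>i\<in>UNIV. real (\<alpha> i) + 1)"

text \<open>
  The norm of the Hermite polynomial with index \<open>\<alpha>\<close> in the Gaussian Hilbert space.
\<close>

definition sfact :: "('n::finite \<Rightarrow> nat) \<Rightarrow> real" where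
  "sfact \<alpha> = (\<Prod>i\<in>UNIV. sqrt (fact (\<alpha> i)))"

definition lower :: "('n \<Rightarrow> nat) \<Rightarrow> 'n \<Rightarrow> 'n \<Rightarrow> nat" where
  "lower \<alpha> i = \<alpha>(i := \<alpha> i - 1)"

text \<open>
  A product of one-dimensional factors, so that its integral factorises; it stands for rapid decay where only
  integrability matters.
\<close>

definition weight :: "real ^ 'n \<Rightarrow> real" where
  "weight x = (\<Prod>i\<in>UNIV. 1 / (1 + (x $ i) ^ 2))"

text \<open>
  The reciprocal square root of the Gaussian density, up to a constant: multiplication by it is the passage from
  Schwartz functions to \<open>K_space\<close>.
\<close>

definition growth :: "real ^ 'n \<Rightarrow> real" where
  "growth x = exp ((norm x) ^ 2 / 4)"

lemma growth_pos: "growth x > 0" by (simp add: growth_def)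

lemma weight_pos: "weight x > 0"
  unfolding weight_def by (intro prod_pos) (auto intro!: add_pos_nonneg)

lemma weight_le_1: "weight x \<le> 1"
  unfolding weight_def by (intro prod_le_1) (auto simp: divide_simps add_pos_nonneg intro: add_nonneg_nonneg)

lemma growth_prod: "growth x = (\<Prod>i\<in>UNIV. exp ((x $ i) ^ 2 / 4))"
  by (simp add: growth_def norm_sq_vec sum_divide_distrib exp_sum)

lemma continuous_on_weight: "continuous_on S weight"
  unfolding weight_def[abs_def]
  by (intro continuous_intros) (auto simp: add_nonneg_eq_0_iff)

lemma continuous_on_growth: "continuous_on S growth"
  unfolding growth_def[abs_def] by (intro continuous_intros) auto

lemma qprod_ge_1: "qprod \<alpha> \<ge> 1"
  unfolding qprod_def by (intro prod_ge_1) auto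

lemma sfact_ge_1: "sfact \<alpha> \<ge> 1"
  unfolding sfact_def by (intro prod_ge_1) auto

lemma lower_le: "lower \<alpha> i j \<le> \<alpha> j"
  by (simp add: lower_def)

lemma qprod_lower_le: "qprod (lower \<alpha> i) \<le> qprod \<alpha>"
  unfolding qprod_def by (intro prod_mono) (simp add: lower_le)

lemma sfact_lower_le: "sfact (lower \<alpha> i) \<le> sfact \<alpha>"
  unfolding sfact_def
proof (rule prod_mono)
  fix j
  show "0 \<le> sqrt (fact (lower \<alpha> i j)) \<and> sqrt (fact (lower \<alpha> i j)) \<le> sqrt (fact (\<alpha> j))"
    using fact_mono[OF lower_le[of \<alpha> i j], where 'a = real] by simp
qed

lemma index_le_qprod: "real (\<alpha> i) + 1 \<le> qprod \<alpha>"
proof -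
  have "qprod \<alpha> = (real (\<alpha> i) + 1) * (\<Prod>j\<in>UNIV - {i}. real (\<alpha> j) + 1)"
    unfolding qprod_def by (rule prod.remove) auto
  moreover have "(\<Prod>j\<in>UNIV - {i}. real (\<alpha> j) + 1) \<ge> 1" by (intro prod_ge_1) auto
  ultimately show ?thesis
    using mult_left_mono[of 1 "\<Prod>j\<in>UNIV - {i}. real (\<alpha> j) + 1" "real (\<alpha> i) + 1"] by simp
qed

lemma deg_le_qprod: "real (deg \<alpha>) \<le> real CARD('n) * qprod (\<alpha> :: 'n::finite \<Rightarrow> nat)"
proof -
  have "real (deg \<alpha>) = (\<Sum>i\<in>UNIV. real (\<alpha> i))" by (simp add: deg_def)
  also have "\<dots> \<le> (\<Sum>i\<in>(UNIV::'n set). qprod \<alpha>)"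
  proof (rule sum_mono)
    fix i show "real (\<alpha> i) \<le> qprod \<alpha>" using index_le_qprod[of \<alpha> i] by linarith
  qed
  finally show ?thesis by simp
qed

section \<open>Hermite polynomials in several variables\<close>

lemma hermite_eq_prod: "hermite \<alpha> x = (\<Prod>i\<in>UNIV. complex_of_real (herm (\<alpha> i) (x $ i)))"
  by (simp add: hermite_def herm_def)

lemma hermite_split:
  "hermite \<alpha> x = of_real (herm (\<alpha> i) (x $ i)) * (\<Prod>j\<in>UNIV - {i}. complex_of_real (herm (\<alpha> j) (x $ j)))"
  unfolding hermite_eq_prod by (rule prod.remove) auto

lemma hermite_upd:
  "hermite (\<alpha>(i := m)) x = of_real (herm m (x $ i)) * (\<Prod>j\<in>UNIV - {i}. complex_of_real (herm (\<alpha> j) (x $ j)))"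
  unfolding hermite_split[of "\<alpha>(i := m)" x i] by simp

text \<open>
  These are the partial derivatives of first and second order, by \<open>hermite_gradient\<close> and \<open>hermiteD_gradient\<close>.
\<close>

definition hermiteD :: "'n::finite \<Rightarrow> ('n \<Rightarrow> nat) \<Rightarrow> real ^ 'n \<Rightarrow> complex" where
  "hermiteD i \<alpha> x = of_nat (\<alpha> i) * hermite (lower \<alpha> i) x"

definition hermiteDD :: "'n::finite \<Rightarrow> 'n \<Rightarrow> ('n \<Rightarrow> nat) \<Rightarrow> real ^ 'n \<Rightarrow> complex" where
  "hermiteDD j i \<alpha> x = of_nat (\<alpha> i) * hermiteD j (lower \<alpha> i) x"

text \<open>
  The dimension is passed as a type so that the constant does not depend on a chosen function or point.
\<close>

definition hconst :: "'n::finite itself \<Rightarrow> real" where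
  "hconst _ = 18 ^ CARD('n)"

lemma hconst_pos: "hconst TYPE('n::finite) > 0" by (simp add: hconst_def)

lemma hermite_bound:
  fixes \<alpha> :: "'n::finite \<Rightarrow> nat"
  shows "norm (hermite \<alpha> x) \<le> hconst TYPE('n) * (sfact \<alpha> * qprod \<alpha> ^ 2) * (growth x * weight x)"
proof -
  have "norm (hermite \<alpha> x) = (\<Prod>i\<in>UNIV. \<bar>herm (\<alpha> i) (x $ i)\<bar>)"
    by (simp add: hermite_eq_prod prod_norm[symmetric])
  also have "\<dots> \<le> (\<Prod>i\<in>UNIV. 18 * (real (\<alpha> i) + 1) ^ 2 * sqrt (fact (\<alpha> i)) * exp ((x $ i) ^ 2 / 4) * (1 / (1 + (x $ i) ^ 2)))"
    using herm_weighted_bound by (intro prod_mono) auto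
  also have "\<dots> = hconst TYPE('n) * (sfact \<alpha> * qprod \<alpha> ^ 2) * (growth x * weight x)"
    unfolding prod.distrib by (simp add: hconst_def sfact_def qprod_def growth_prod weight_def prod_power_distrib)
  finally show ?thesis .
qed

lemma hermite_gradient: "has_gradient (hermite \<alpha>) (\<lambda>i. hermiteD i \<alpha> x) x"
proof -
  have "((\<lambda>x. complex_of_real (herm (\<alpha> i) (x $ i))) has_derivative
      (\<lambda>h. of_real (h $ i) * of_real (real (\<alpha> i) * herm (\<alpha> i - 1) (x $ i)))) (at x)" for i
  proof -
    have "((\<lambda>x. herm (\<alpha> i) (x $ i)) has_derivative (\<lambda>h. h $ i * (real (\<alpha> i) * herm (\<alpha> i - 1) (x $ i)))) (at x)"
      by (rule has_derivative_eq_rhs[OF has_derivative_in_compose[of "\<lambda>x. x $ i",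
            OF _ herm_derivative[THEN has_field_derivative_imp_has_derivative, THEN has_derivative_at_withinI]]])
        (auto intro!: derivative_eq_intros)
    from has_derivative_of_real[OF this] show ?thesis by simp
  qed
  note 1 = has_derivative_prod[where I = UNIV, OF this]
  have 2: "hermiteD i \<alpha> x = of_real (real (\<alpha> i) * herm (\<alpha> i - 1) (x $ i))
      * (\<Prod>j\<in>UNIV - {i}. complex_of_real (herm (\<alpha> j) (x $ j)))" for i
    by (simp add: hermiteD_def lower_def hermite_upd)
  have 3: "hermite \<alpha> = (\<lambda>x. \<Prod>i\<in>UNIV. complex_of_real (herm (\<alpha> i) (x $ i)))"
    by (rule ext) (rule hermite_eq_prod)
  show ?thesis unfolding has_gradient_def 2 3
    using 1[of "\<lambda>i. i"] by (simp only: mult.assoc)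
qed

section \<open>Series over multi-indices\<close>

text \<open>
  A fixed enumeration of all multi-indices. It turns sums over multi-indices into series over \<open>nat\<close>, which can be
  differentiated term by term.
\<close>

definition idx :: "nat \<Rightarrow> ('n::finite \<Rightarrow> nat)" where
  "idx = from_nat_into UNIV"

lemma bij_idx: "bij (idx :: nat \<Rightarrow> ('n::finite \<Rightarrow> nat))"
proof -
  have "inj (\<lambda>k. (\<lambda>_. k) :: 'n \<Rightarrow> nat)" by (auto simp: inj_def fun_eq_iff)
  hence "infinite (UNIV :: ('n \<Rightarrow> nat) set)"
    using finite_subset[OF subset_UNIV] range_inj_infinite by blast
  thus ?thesis unfolding idx_def by (intro bij_betw_from_nat_into) auto
qed

text \<open>
  Multiplying out a product of absolutely convergent series: Fubini's theorem for the counting measure on multi-indices.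
\<close>

lemma product_series:
  fixes f :: "'n::finite \<Rightarrow> nat \<Rightarrow> 'a::{real_normed_field,banach,second_countable_topology}"
  assumes "\<And>i. summable (\<lambda>n. norm (f i n))"
  shows "summable (\<lambda>k. norm (\<Prod>i\<in>UNIV. f i (idx k i)))"
    and "(\<lambda>k. \<Prod>i\<in>UNIV. f i (idx k i)) sums (\<Prod>i\<in>UNIV. \<Sum>n. f i n)"
proof -
  have s: "Infinite_Set_Sum.abs_summable_on (f i) UNIV" for i
    using assms by (simp add: abs_summable_on_nat_iff')
  have P: "(PiE UNIV (\<lambda>_. UNIV) :: ('n \<Rightarrow> nat) set) = UNIV" by (simp add: PiE_UNIV_domain)
  have 1: "Infinite_Set_Sum.abs_summable_on (\<lambda>g. \<Prod>i\<in>UNIV. f i (g i)) (UNIV :: ('n \<Rightarrow> nat) set)"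
    using Infinite_Set_Sum.abs_summable_on_prod_PiE[of UNIV "\<lambda>_. UNIV" f] s unfolding P by simp
  have 2: "infsetsum (\<lambda>g. \<Prod>i\<in>UNIV. f i (g i)) (UNIV :: ('n \<Rightarrow> nat) set) = (\<Prod>i\<in>UNIV. infsetsum (f i) UNIV)"
    using infsetsum_prod_PiE[of UNIV "\<lambda>_. UNIV" f] s unfolding P by simp
  have 3: "Infinite_Set_Sum.abs_summable_on (\<lambda>k. \<Prod>i\<in>UNIV. f i (idx k i)) UNIV"
    using 1 Infinite_Set_Sum.abs_summable_on_reindex_bij_betw[OF bij_idx, of "\<lambda>g. \<Prod>i\<in>UNIV. f i (g i)"] by simp
  show 4: "summable (\<lambda>k. norm (\<Prod>i\<in>UNIV. f i (idx k i)))"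
    using 3 by (simp add: abs_summable_on_nat_iff')
  have "(\<Sum>k. \<Prod>i\<in>UNIV. f i (idx k i)) = infsetsum (\<lambda>k. \<Prod>i\<in>UNIV. f i (idx k i)) UNIV"
    using infsetsum_nat'[OF 3] by simp
  also have "\<dots> = infsetsum (\<lambda>g. \<Prod>i\<in>UNIV. f i (g i)) UNIV"
    by (rule infsetsum_reindex_bij_betw[OF bij_idx])
  also have "\<dots> = (\<Prod>i\<in>UNIV. \<Sum>n. f i n)"
    unfolding 2 using infsetsum_nat'[OF s] by simp
  finally show "(\<lambda>k. \<Prod>i\<in>UNIV. f i (idx k i)) sums (\<Prod>i\<in>UNIV. \<Sum>n. f i n)"
    using summable_norm_cancel[OF 4] by (simp add: sums_iff)
qed

lemma summable_qprod: "summable (\<lambda>k. 1 / qprod (idx k :: 'n::finite \<Rightarrow> nat) ^ 2)"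
proof -
  have "summable (\<lambda>n. inverse (real (Suc n) ^ 2))"
    unfolding summable_Suc_iff[of "\<lambda>n. inverse (real n ^ 2)"] by (rule inverse_power_summable) simp
  hence "summable (\<lambda>n. norm (1 / (real n + 1) ^ 2))"
    by (simp add: inverse_eq_divide add.commute)
  from product_series(1)[where f = "\<lambda>(_::'n) n. 1 / (real n + 1) ^ 2", OF this]
  show ?thesis by (simp add: qprod_def prod_dividef prod_power_distrib abs_prod flip: prod_norm)
qed

text \<open>
  The size of the term with index \<open>\<alpha>\<close>, weighted by a power of \<open>qprod\<close>. The bounds for Hermite polynomials have
  \<open>sfact \<alpha>\<close> times such a power, so these quantities majorise the terms of a Hermite series and of its derivatives.
\<close>

definition wcoef :: "nat \<Rightarrow> (('n::finite \<Rightarrow> nat) \<Rightarrow> complex) \<Rightarrow> ('n \<Rightarrow> nat) \<Rightarrow> real" where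
  "wcoef N c \<alpha> = norm (c \<alpha>) * (sfact \<alpha> * qprod \<alpha> ^ N)"

definition rapid :: "(('n::finite \<Rightarrow> nat) \<Rightarrow> complex) \<Rightarrow> bool" where
  "rapid c \<longleftrightarrow> (\<forall>N. \<exists>C. \<forall>\<alpha>. wcoef N c \<alpha> \<le> C)"

lemma qprod_pos: "qprod \<alpha> > 0" using qprod_ge_1[of \<alpha>] by linarith
lemma qprod_nonzero [simp]: "qprod \<alpha> \<noteq> 0" using qprod_pos[of \<alpha>] by simp
lemma sfact_pos: "sfact \<alpha> > 0" using sfact_ge_1[of \<alpha>] by linarith

lemma wcoef_nonneg: "wcoef N c \<alpha> \<ge> 0"
  unfolding wcoef_def using qprod_pos[of \<alpha>] sfact_pos[of \<alpha>] by simp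

lemma rapid_summable:
  fixes c :: "('n::finite \<Rightarrow> nat) \<Rightarrow> complex"
  assumes "rapid c"
  shows "summable (\<lambda>k. wcoef N c (idx k))"
proof -
  obtain C where C: "\<And>\<alpha>. wcoef (N + 2) c \<alpha> \<le> C"
    using assms unfolding rapid_def by blast
  have le: "wcoef N c \<alpha> \<le> C * (1 / qprod \<alpha> ^ 2)" for \<alpha>
  proof -
    have "wcoef N c \<alpha> = wcoef (N + 2) c \<alpha> * (1 / qprod \<alpha> ^ 2)"
      by (simp add: wcoef_def power_add power2_eq_square)
    also have "\<dots> \<le> C * (1 / qprod \<alpha> ^ 2)" by (intro mult_right_mono C) auto
    finally show ?thesis .
  qed
  have "summable (\<lambda>k. C * (1 / qprod (idx k :: 'n \<Rightarrow> nat) ^ 2))" by (intro summable_mult summable_qprod)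
  thus ?thesis
    by (rule summable_comparison_test'[where N = 0]) (use le in \<open>simp add: wcoef_nonneg\<close>)
qed

lemma rapid_mult:
  assumes "rapid c" "\<And>\<alpha>. norm (m \<alpha>) \<le> K * qprod \<alpha> ^ M"
  shows "rapid (\<lambda>\<alpha>. m \<alpha> * c \<alpha>)"
  unfolding rapid_def
proof
  fix N
  have K: "K \<ge> 0" using order_trans[OF norm_ge_zero assms(2)[of "\<lambda>_. 0"]] by (simp add: qprod_def)
  obtain C where C: "\<And>\<alpha>. norm (c \<alpha>) * (sfact \<alpha> * qprod \<alpha> ^ (N + M)) \<le> C"
    using assms(1) unfolding rapid_def wcoef_def by blast
  have "norm (m \<alpha> * c \<alpha>) * (sfact \<alpha> * qprod \<alpha> ^ N) \<le> K * C" for \<alpha>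
  proof -
    have "norm (m \<alpha> * c \<alpha>) * (sfact \<alpha> * qprod \<alpha> ^ N) = norm (m \<alpha>) * (norm (c \<alpha>) * (sfact \<alpha> * qprod \<alpha> ^ N))"
      by (simp add: norm_mult)
    also have "\<dots> \<le> (K * qprod \<alpha> ^ M) * (norm (c \<alpha>) * (sfact \<alpha> * qprod \<alpha> ^ N))"
      using qprod_pos[of \<alpha>] sfact_pos[of \<alpha>] by (intro mult_right_mono assms(2)) auto
    also have "\<dots> = K * (norm (c \<alpha>) * (sfact \<alpha> * qprod \<alpha> ^ (N + M)))" by (simp add: power_add)
    also have "\<dots> \<le> K * C" by (intro mult_left_mono C K)
    finally show ?thesis .
  qed
  thus "\<exists>C. \<forall>\<alpha>. wcoef N (\<lambda>\<alpha>. m \<alpha> * c \<alpha>) \<alpha> \<le> C" unfolding wcoef_def by blast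
qed

text \<open>
  A majorant of the form \<open>M\<^sub>k e(p)\<close> is uniform on each open set \<open>{p. e p < B}\<close>, and these sets cover the space.
\<close>

lemma continuous_on_suminf_weighted:
  fixes F :: "nat \<Rightarrow> 'a::topological_space \<Rightarrow> 'b::banach"
  assumes "\<And>k. continuous_on UNIV (F k)" "continuous_on UNIV (e :: 'a \<Rightarrow> real)"
    and "\<And>k p. norm (F k p) \<le> M k * e p" "summable M" "\<And>k. M k \<ge> 0"
  shows "continuous_on UNIV (\<lambda>p. \<Sum>k. F k p)"
proof -
  define S where "S B = {p. e p < B}" for B
  have op: "open (S B)" for B
    unfolding S_def using assms(2) by (intro open_Collect_less) auto
  have c: "continuous_on (S B) (\<lambda>p. \<Sum>k. F k p)" for B
  proof (rule uniform_limit_theorem)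
    show "\<forall>\<^sub>F n in sequentially. continuous_on (S B) (\<lambda>p. \<Sum>k<n. F k p)"
      by (intro always_eventually allI continuous_intros continuous_on_subset[OF assms(1)]) auto
    show "uniform_limit (S B) (\<lambda>n p. \<Sum>k<n. F k p) (\<lambda>p. \<Sum>k. F k p) sequentially"
    proof (rule Weierstrass_m_test)
      fix k p assume "p \<in> S B"
      thus "norm (F k p) \<le> M k * B" unfolding S_def
        using assms(3)[of k p] assms(5)[of k] by (smt (verit) mem_Collect_eq mult_left_mono)
    qed (intro summable_mult2 assms)
  qed auto
  have "(\<Union>B. S B) = UNIV" unfolding S_def by (auto intro: gt_ex)
  moreover have "continuous_on (\<Union>B. S B) (\<lambda>p. \<Sum>k. F k p)"
    by (intro continuous_on_open_UN op c)
  ultimately show ?thesis by simp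
qed

text \<open>
  Differentiation term by term, on balls, where \<open>growth\<close> is bounded and the majorant therefore uniform.
\<close>

lemma has_gradient_suminf:
  fixes f :: "nat \<Rightarrow> real ^ 'n \<Rightarrow> complex"
  assumes grad: "\<And>k x. has_gradient (f k) (\<lambda>i. D k i x) x"
    and f: "\<And>k x. norm (f k x) \<le> M k * growth x"
    and D: "\<And>k i x. norm (D k i x) \<le> M k * growth x"
    and M: "summable M" "\<And>k. M k \<ge> 0"
  shows "has_gradient (\<lambda>x. \<Sum>k. f k x) (\<lambda>i. \<Sum>k. D k i x) x"
proof -
  define R where "R = norm x + 1"
  define S where "S = ball (0 :: real ^ 'n) R"
  define B where "B = exp (R ^ 2 / 4)"
  have gB: "growth y \<le> B" if "y \<in> S" for y
    using that unfolding S_def growth_def B_def by (auto intro!: power_mono)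
  have MB: "M k * growth y \<le> M k * B" if "y \<in> S" for k y
    by (rule mult_left_mono[OF gB[OF that] M(2)])
  have sMB: "summable (\<lambda>k. M k * B)" by (intro summable_mult2 M)
  have xS: "x \<in> S" by (simp add: S_def R_def)
  have sfact: "summable (\<lambda>k. f k y)" if "y \<in> S" for y
    by (rule summable_comparison_test'[OF sMB, of 0]) (use f MB[OF that] in \<open>blast intro: order_trans\<close>)
  have unif: "uniform_limit S (\<lambda>n y. \<Sum>k<n. D k i y) (\<lambda>y. \<Sum>k. D k i y) sequentially" for i
    by (rule Weierstrass_m_test[OF _ sMB]) (use D MB in \<open>blast intro: order_trans\<close>)
  have "\<exists>g. \<forall>y\<in>S. (\<lambda>k. f k y) sums g y \<and>
      (g has_derivative (\<lambda>h. \<Sum>i\<in>UNIV. of_real (h $ i) * (\<Sum>k. D k i y))) (at y within S)"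
  proof (rule has_derivative_series[OF _ _ _ xS])
    show "convex S" by (simp add: S_def)
    show "(f k has_derivative (\<lambda>h. \<Sum>i\<in>UNIV. of_real (h $ i) * D k i y)) (at y within S)" for k y
      using grad[of k y] unfolding has_gradient_def by (rule has_derivative_at_withinI)
    show "(\<lambda>k. f k x) sums (\<Sum>k. f k x)" using sfact[OF xS] by (rule summable_sums)
    fix e :: real assume e: "e > 0"
    define e' where "e' = e / real CARD('n)"
    have e': "e' > 0" using e by (simp add: e'_def)
    have "\<forall>\<^sub>F n in sequentially. \<forall>i\<in>UNIV. \<forall>y\<in>S. norm ((\<Sum>k<n. D k i y) - (\<Sum>k. D k i y)) < e'"
      using unif uniform_limitD[OF unif e'] by (intro eventually_ball_finite) (auto simp: dist_norm)
    thus "\<forall>\<^sub>F n in sequentially. \<forall>y\<in>S. \<forall>h. norm ((\<Sum>k<n. \<Sum>i\<in>UNIV. of_real (h $ i) * D k i y)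
         - (\<Sum>i\<in>UNIV. of_real (h $ i) * (\<Sum>k. D k i y))) \<le> e * norm h"
    proof (rule eventually_mono, intro ballI allI)
      fix n y h assume *: "\<forall>i\<in>UNIV. \<forall>y\<in>S. norm ((\<Sum>k<n. D k i y) - (\<Sum>k. D k i y)) < e'" and y: "y \<in> S"
      have "(\<Sum>k<n. \<Sum>i\<in>UNIV. of_real (h $ i) * D k i y) - (\<Sum>i\<in>UNIV. of_real (h $ i) * (\<Sum>k. D k i y))
         = (\<Sum>i\<in>UNIV. of_real (h $ i) * ((\<Sum>k<n. D k i y) - (\<Sum>k. D k i y)))"
        by (subst sum.swap) (simp add: sum_distrib_left sum_subtractf right_diff_distrib)
      also have "norm \<dots> \<le> (\<Sum>i\<in>(UNIV::'n set). norm h * e')"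
      proof (rule sum_norm_le)
        fix i :: 'n
        show "norm (of_real (h $ i) * ((\<Sum>k<n. D k i y) - (\<Sum>k. D k i y))) \<le> norm h * e'"
          unfolding norm_mult using * y component_le_norm_cart[of h i]
          by (intro mult_mono) (auto intro: less_imp_le)
      qed
      also have "\<dots> = e * norm h" by (simp add: e'_def)
      finally show "norm ((\<Sum>k<n. \<Sum>i\<in>UNIV. of_real (h $ i) * D k i y)
         - (\<Sum>i\<in>UNIV. of_real (h $ i) * (\<Sum>k. D k i y))) \<le> e * norm h" .
    qed
  qed
  then obtain g where g: "\<And>y. y \<in> S \<Longrightarrow> (\<lambda>k. f k y) sums g y"
    "\<And>y. y \<in> S \<Longrightarrow> (g has_derivative (\<lambda>h. \<Sum>i\<in>UNIV. of_real (h $ i) * (\<Sum>k. D k i y))) (at y within S)"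
    by blast
  have op: "open S" by (simp add: S_def)
  have "(g has_derivative (\<lambda>h. \<Sum>i\<in>UNIV. of_real (h $ i) * (\<Sum>k. D k i x))) (at x)"
    using g(2)[OF xS] at_within_open[OF xS op] by simp
  thus ?thesis unfolding has_gradient_def
    by (rule has_derivative_transform_within_open[OF _ op xS]) (use g(1) in \<open>auto simp: sums_iff\<close>)
qed

section \<open>Hermite series\<close>

lemma hermiteD_bound: "norm (hermiteD i \<alpha> x) \<le> hconst TYPE('n) * (sfact \<alpha> * qprod (\<alpha> :: 'n::finite \<Rightarrow> nat) ^ 3) * (growth x * weight x)"
proof -
  have "norm (hermiteD i \<alpha> x) = real (\<alpha> i) * norm (hermite (lower \<alpha> i) x)"
    by (simp add: hermiteD_def norm_mult)
  also have "\<dots> \<le> qprod \<alpha> * (hconst TYPE('n) * (sfact (lower \<alpha> i) * qprod (lower \<alpha> i) ^ 2) * (growth x * weight x))"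
    using index_le_qprod[of \<alpha> i] qprod_pos[of \<alpha>] by (intro mult_mono hermite_bound) auto
  also have "\<dots> \<le> qprod \<alpha> * (hconst TYPE('n) * (sfact \<alpha> * qprod \<alpha> ^ 2) * (growth x * weight x))"
    using hconst_pos[where 'n = 'n] qprod_pos[of \<alpha>] qprod_pos[of "lower \<alpha> i"] sfact_pos[of \<alpha>] sfact_pos[of "lower \<alpha> i"] growth_pos[of x] weight_pos[of x]
    by (intro mult_left_mono mult_right_mono mult_mono power_mono sfact_lower_le qprod_lower_le) (auto intro: less_imp_le)
  also have "\<dots> = hconst TYPE('n) * (sfact \<alpha> * qprod \<alpha> ^ 3) * (growth x * weight x)"
    by (simp add: power2_eq_square power3_eq_cube mult_ac)
  finally show ?thesis .
qed

lemma hermiteDD_bound: "norm (hermiteDD j i \<alpha> x) \<le> hconst TYPE('n) * (sfact \<alpha> * qprod (\<alpha> :: 'n::finite \<Rightarrow> nat) ^ 4) * (growth x * weight x)"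
proof -
  have "norm (hermiteDD j i \<alpha> x) = real (\<alpha> i) * norm (hermiteD j (lower \<alpha> i) x)"
    by (simp add: hermiteDD_def norm_mult)
  also have "\<dots> \<le> qprod \<alpha> * (hconst TYPE('n) * (sfact (lower \<alpha> i) * qprod (lower \<alpha> i) ^ 3) * (growth x * weight x))"
    using index_le_qprod[of \<alpha> i] qprod_pos[of \<alpha>] by (intro mult_mono hermiteD_bound) auto
  also have "\<dots> \<le> qprod \<alpha> * (hconst TYPE('n) * (sfact \<alpha> * qprod \<alpha> ^ 3) * (growth x * weight x))"
    using hconst_pos[where 'n = 'n] qprod_pos[of \<alpha>] qprod_pos[of "lower \<alpha> i"] sfact_pos[of \<alpha>] sfact_pos[of "lower \<alpha> i"] growth_pos[of x] weight_pos[of x]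
    by (intro mult_left_mono mult_right_mono mult_mono power_mono sfact_lower_le qprod_lower_le) (auto intro: less_imp_le)
  also have "\<dots> = hconst TYPE('n) * (sfact \<alpha> * qprod \<alpha> ^ 4) * (growth x * weight x)"
    by (simp add: power3_eq_cube power4_eq_xxxx mult_ac)
  finally show ?thesis .
qed

lemma hermiteD_gradient: "has_gradient (hermiteD i \<alpha>) (\<lambda>j. hermiteDD j i \<alpha> x) x"
  using has_gradient_cmult[OF hermite_gradient[of "lower \<alpha> i" x], of "of_nat (\<alpha> i)"]
  by (simp add: hermiteD_def[abs_def] hermiteDD_def[abs_def])

text \<open>
  The common shape of the majorants below: it turns a bound on a polynomial into one on a term of a series, drops the
  weight and raises the exponent, so that a function and its derivative obtain the same majorant.
\<close>

lemma weighted_bound_mono: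
  assumes "norm a \<le> hconst TYPE('n) * (sfact \<alpha> * qprod (\<alpha> :: 'n::finite \<Rightarrow> nat) ^ m) * (growth x * weight x)" "m \<le> n"
  shows "norm (c \<alpha> * a) \<le> hconst TYPE('n) * wcoef n c \<alpha> * growth x"
proof -
  have "norm (c \<alpha> * a) \<le> norm (c \<alpha>) * (hconst TYPE('n) * (sfact \<alpha> * qprod \<alpha> ^ m) * (growth x * weight x))"
    unfolding norm_mult by (intro mult_left_mono assms) auto
  also have "\<dots> \<le> norm (c \<alpha>) * (hconst TYPE('n) * (sfact \<alpha> * qprod \<alpha> ^ n) * (growth x * 1))"
    using hconst_pos[where 'n = 'n] qprod_pos[of \<alpha>] qprod_ge_1[of \<alpha>] sfact_pos[of \<alpha>] growth_pos[of x] weight_pos[of x] weight_le_1[of x] assms(2)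
    by (intro mult_left_mono mult_mono power_increasing) (auto intro: less_imp_le)
  finally show ?thesis by (simp add: wcoef_def mult_ac)
qed

definition hseries :: "(('n::finite \<Rightarrow> nat) \<Rightarrow> complex) \<Rightarrow> real ^ 'n \<Rightarrow> complex" where
  "hseries c x = (\<Sum>k. c (idx k) * hermite (idx k) x)"

definition hseriesD :: "'n::finite \<Rightarrow> (('n \<Rightarrow> nat) \<Rightarrow> complex) \<Rightarrow> real ^ 'n \<Rightarrow> complex" where
  "hseriesD i c x = (\<Sum>k. c (idx k) * hermiteD i (idx k) x)"

definition hseriesDD :: "'n::finite \<Rightarrow> 'n \<Rightarrow> (('n \<Rightarrow> nat) \<Rightarrow> complex) \<Rightarrow> real ^ 'n \<Rightarrow> complex" where
  "hseriesDD j i c x = (\<Sum>k. c (idx k) * hermiteDD j i (idx k) x)"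

context
  fixes c :: "('n::finite \<Rightarrow> nat) \<Rightarrow> complex"
  assumes c: "rapid c"
begin

lemma majorant_summable:
  "summable (\<lambda>k. hconst TYPE('n) * wcoef m c (idx k))"
  by (intro summable_mult rapid_summable c)

lemma majorant_nonneg: "hconst TYPE('n) * wcoef m c (idx k) \<ge> 0"
  by (intro mult_nonneg_nonneg wcoef_nonneg less_imp_le[OF hconst_pos])

lemma hseries_gradient: "has_gradient (hseries c) (\<lambda>i. hseriesD i c x) x"
  unfolding hseries_def[abs_def] hseriesD_def
  by (rule has_gradient_suminf[OF has_gradient_cmult[OF hermite_gradient]
        weighted_bound_mono[OF hermite_bound] weighted_bound_mono[OF hermiteD_bound] majorant_summable[of 3] majorant_nonneg]) auto

lemma hseriesD_gradient: "has_gradient (hseriesD i c) (\<lambda>j. hseriesDD j i c x) x"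
  unfolding hseriesD_def[abs_def] hseriesDD_def
  by (rule has_gradient_suminf[OF has_gradient_cmult[OF hermiteD_gradient]
        weighted_bound_mono[OF hermiteD_bound] weighted_bound_mono[OF hermiteDD_bound] majorant_summable[of 4] majorant_nonneg]) auto

lemma partial_hseries: "partial i (hseries c) = hseriesD i c"
  by (rule ext) (rule partial_eqI[OF hseries_gradient])

lemma partial_hseriesD: "partial j (hseriesD i c) = hseriesDD j i c"
  by (rule ext) (rule partial_eqI[OF hseriesD_gradient])

lemma summable_hseries: "summable (\<lambda>k. c (idx k) * hermite (idx k) (x :: real ^ 'n))"
  by (rule summable_comparison_test'[OF summable_mult2[OF majorant_summable[of 2]], of 0])
    (rule weighted_bound_mono[OF hermite_bound], simp)

lemma summable_hseriesD: "summable (\<lambda>k. c (idx k) * hermiteD i (idx k) (x :: real ^ 'n))"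
  by (rule summable_comparison_test'[OF summable_mult2[OF majorant_summable[of 3]], of 0])
    (rule weighted_bound_mono[OF hermiteD_bound], simp)

lemma summable_hseriesDD: "summable (\<lambda>k. c (idx k) * hermiteDD j i (idx k) (x :: real ^ 'n))"
  by (rule summable_comparison_test'[OF summable_mult2[OF majorant_summable[of 4]], of 0])
    (rule weighted_bound_mono[OF hermiteDD_bound], simp)

text \<open>
  The whole series inherits the envelope of a single Hermite polynomial. Together with \<open>L2_weighted\<close> this
  controls the Gaussian \<open>L\<^sup>2\<close> norm of a Hermite series by its coefficients.
\<close>

lemma hseries_bound:
  "norm (hseries c x) \<le> hconst TYPE('n) * (\<Sum>k. wcoef 2 c (idx k)) * (growth x * weight x)"
proof -
  have s: "summable (\<lambda>k. hconst TYPE('n) * wcoef 2 c (idx k) * (growth x * weight x))"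
    by (intro summable_mult2 majorant_summable)
  have "norm (hseries c x) \<le> (\<Sum>k. hconst TYPE('n) * wcoef 2 c (idx k) * (growth x * weight x))"
    unfolding hseries_def
  proof (rule norm_suminf_le[OF _ s])
    fix k
    have "norm (c \<alpha> * hermite \<alpha> x) \<le> hconst TYPE('n) * wcoef 2 c \<alpha> * (growth x * weight x)" for \<alpha>
    proof -
      have "norm (c \<alpha> * hermite \<alpha> x) \<le> norm (c \<alpha>) * (hconst TYPE('n) * (sfact \<alpha> * qprod \<alpha> ^ 2) * (growth x * weight x))"
        unfolding norm_mult by (intro mult_left_mono hermite_bound) auto
      thus ?thesis by (simp add: wcoef_def mult_ac)
    qed
    thus "norm (c (idx k) * hermite (idx k) x) \<le> hconst TYPE('n) * wcoef 2 c (idx k) * (growth x * weight x)" .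
  qed
  also have "\<dots> = hconst TYPE('n) * (\<Sum>k. wcoef 2 c (idx k)) * (growth x * weight x)"
    by (simp add: suminf_mult2[symmetric] suminf_mult[symmetric] summable_mult rapid_summable c)
  finally show ?thesis .
qed

end

text \<open>
  Hermite's differential equation in one coordinate. Summed over the coordinates it says that \<open>hermite \<alpha>\<close> is an
  eigenfunction of the Ornstein-Uhlenbeck operator for the eigenvalue \<open>-|\<alpha>|\<close>.
\<close>

lemma hermite_ode: "hermiteDD i i \<alpha> x - of_real (x $ i) * hermiteD i \<alpha> x = - of_nat (\<alpha> i) * hermite (\<alpha> :: 'n::finite \<Rightarrow> nat) x"
proof (cases "\<alpha> i")
  case 0
  then show ?thesis by (simp add: hermiteD_def hermiteDD_def)
next
  case (Suc m)
  define P where "P = (\<Prod>j\<in>UNIV - {i}. complex_of_real (herm (\<alpha> j) (x $ j)))"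
  have 1: "hermite \<alpha> x = of_real (herm (Suc m) (x $ i)) * P"
    unfolding P_def hermite_split[of \<alpha> x i] Suc ..
  have 2: "hermiteD i \<alpha> x = of_nat (Suc m) * (of_real (herm m (x $ i)) * P)"
    unfolding hermiteD_def lower_def hermite_upd P_def Suc by simp
  have 3: "hermiteDD i i \<alpha> x = of_nat (Suc m) * (of_nat m * (of_real (herm (m - 1) (x $ i)) * P))"
    unfolding hermiteDD_def hermiteD_def lower_def fun_upd_upd hermite_upd P_def Suc by simp
  show ?thesis unfolding 1 2 3 herm_Suc Suc by (simp add: algebra_simps)
qed

text \<open>
  The action of the Ornstein-Uhlenbeck operator on Hermite coefficients.
\<close>

definition minus_deg :: "(('n::finite \<Rightarrow> nat) \<Rightarrow> complex) \<Rightarrow> ('n \<Rightarrow> nat) \<Rightarrow> complex" where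
  "minus_deg c \<alpha> = - of_nat (deg \<alpha>) * c \<alpha>"

lemma OU_diff_hseries:
  fixes c :: "('n::finite \<Rightarrow> nat) \<Rightarrow> complex"
  assumes c: "rapid c"
  shows "OU_diff (hseries c) x = hseries (minus_deg c) x"
proof -
  have "OU_diff (hseries c) x = (\<Sum>i\<in>UNIV. hseriesDD i i c x - of_real (x $ i) * hseriesD i c x)"
    unfolding OU_diff_def partial_hseries[OF c] partial_hseriesD[OF c] by (simp add: sum_subtractf)
  also have "\<dots> = (\<Sum>i\<in>(UNIV :: 'n set). \<Sum>k. c (idx k) * (- of_nat (idx k i) * hermite (idx k) x))"
  proof (rule sum.cong)
    fix i
    have "hseriesDD i i c x - of_real (x $ i) * hseriesD i c x
        = (\<Sum>k. c (idx k) * hermiteDD i i (idx k) x - of_real (x $ i) * (c (idx k) * hermiteD i (idx k) x))"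
      unfolding hseriesDD_def hseriesD_def
      by (subst suminf_mult[symmetric, OF summable_hseriesD[OF c]], subst suminf_diff)
         (auto intro: summable_mult summable_hseriesD[OF c] summable_hseriesDD[OF c])
    also have "\<dots> = (\<Sum>k. c (idx k) * (hermiteDD i i (idx k) x - of_real (x $ i) * hermiteD i (idx k) x))"
      by (simp add: algebra_simps)
    finally show "hseriesDD i i c x - of_real (x $ i) * hseriesD i c x
       = (\<Sum>k. c (idx k) * (- of_nat (idx k i) * hermite (idx k) x))"
      unfolding hermite_ode .
  qed auto
  also have "\<dots> = (\<Sum>k. \<Sum>i\<in>(UNIV :: 'n set). c (idx k) * (- of_nat (idx k i) * hermite (idx k) x))"
  proof (rule suminf_sum[symmetric])
    fix i
    have "rapid (\<lambda>\<alpha>. - of_nat (\<alpha> i) * c \<alpha>)"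
    proof (rule rapid_mult[OF c, of _ 1 1])
      fix \<alpha> :: "'n \<Rightarrow> nat" show "norm (- complex_of_nat (\<alpha> i)) \<le> 1 * qprod \<alpha> ^ 1"
        using index_le_qprod[of \<alpha> i] by simp
    qed
    from summable_hseries[OF this, of x]
    show "summable (\<lambda>k. c (idx k) * (- of_nat (idx k i) * hermite (idx k) x))" by (simp add: mult_ac)
  qed
  also have "\<dots> = hseries (\<lambda>\<alpha>. - of_nat (deg \<alpha>) * c \<alpha>) x"
    unfolding hseries_def deg_def
    by (intro suminf_cong) (simp add: sum_distrib_left sum_distrib_right sum_negf mult_ac)
  finally show ?thesis unfolding minus_deg_def[abs_def] .
qed

section \<open>Weighted bounds and the Gaussian Hilbert space\<close>

lemma Basis_vec_eq: "(Basis :: (real ^ 'n) set) = range (\<lambda>i. axis i 1)"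
  by (auto simp: Basis_vec_def)

lemma nn_integral_prod_vec:
  fixes g :: "real \<Rightarrow> real"
  assumes [measurable]: "g \<in> borel_measurable borel" and nn: "\<And>t. g t \<ge> 0"
  shows "(\<integral>\<^sup>+x. ennreal (\<Prod>i\<in>UNIV. g (x $ i)) \<partial>(lborel :: (real ^ 'n) measure)) = (\<integral>\<^sup>+t. ennreal (g t) \<partial>lborel) ^ CARD('n)"
proof -
  have inj: "inj (\<lambda>i. axis i 1 :: real ^ 'n)" by (auto simp: inj_def axis_eq_axis)
  have "(\<integral>\<^sup>+x. ennreal (\<Prod>i\<in>UNIV. g (x $ i)) \<partial>(lborel :: (real ^ 'n) measure))
      = (\<integral>\<^sup>+x. (\<Prod>b\<in>Basis. ennreal (g (x \<bullet> b))) \<partial>(lborel :: (real ^ 'n) measure))"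
    unfolding Basis_vec_eq prod.reindex[OF inj]
    by (simp add: prod_ennreal nn inner_axis o_def)
  also have "\<dots> = (\<Prod>b\<in>(Basis :: (real ^ 'n) set). \<integral>\<^sup>+t. ennreal (g t) \<partial>lborel)"
    by (rule nn_integral_lborel_prod) auto
  also have "\<dots> = (\<integral>\<^sup>+t. ennreal (g t) \<partial>lborel) ^ CARD('n)" by simp
  finally show ?thesis .
qed

lemma integrable_inverse_one_plus_square: "integrable lborel (\<lambda>t::real. 1 / (1 + t ^ 2))"
proof -
  have "(\<integral>\<^sup>+t. ennreal (1 / (1 + t ^ 2)) * indicator {0..} t \<partial>lborel) = pi / 2 - arctan 0"
    by (rule nn_integral_FTC_atLeast)
      (auto intro!: derivative_eq_intros tendsto_arctan_at_top simp: field_simps)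
  also have "(\<integral>\<^sup>+t. ennreal (1 / (1 + t ^ 2)) * indicator {0..} t \<partial>lborel)
      = (\<integral>\<^sup>+t. ennreal (indicator {0..} t *\<^sub>R (1 / (1 + t ^ 2))) \<partial>lborel)"
    by (intro nn_integral_cong) (auto split: split_indicator)
  finally have "has_bochner_integral lborel (\<lambda>t. indicator {0..} t *\<^sub>R (1 / (1 + t ^ 2))) (pi / 2 - arctan 0)"
    by (intro has_bochner_integral_nn_integral) auto
  from has_bochner_integral_even_function[OF this]
  show ?thesis by (auto simp: has_bochner_integral_iff)
qed

lemma weight_measurable [measurable]: "weight \<in> borel_measurable borel"
  by (rule borel_measurable_continuous_onI) (rule continuous_on_weight)

lemma integrable_weight: "integrable lborel (weight :: real ^ 'n \<Rightarrow> real)"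
proof (rule integrableI_nonneg)
  have "(\<integral>\<^sup>+t. ennreal (1 / (1 + t ^ 2)) \<partial>lborel) < \<infinity>"
    using integrable_inverse_one_plus_square by (subst nn_integral_eq_integral) auto
  thus "(\<integral>\<^sup>+x. ennreal (weight x) \<partial>(lborel :: (real ^ 'n) measure)) < \<infinity>"
    unfolding weight_def by (subst nn_integral_prod_vec) (auto simp: power_less_top_ennreal)
qed (auto intro: less_imp_le weight_pos)

lemma integral_weight_nonneg: "(LINT x|lborel. weight x) \<ge> 0"
  by (rule Bochner_Integration.integral_nonneg) (rule less_imp_le[OF weight_pos])

definition rho :: "real ^ 'n \<Rightarrow> real" where
  "rho x = (2 * pi) powr (- real CARD('n) / 2) * exp (- (norm x)\<^sup>2 / 2)"

lemma rho_prod: "rho (x :: real ^ 'n) = (\<Prod>i\<in>UNIV. std_normal_density (x $ i))"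
proof -
  have "(1 / sqrt (2 * pi)) ^ CARD('n) = (2 * pi) powr (- real CARD('n) / 2)"
  proof -
    have "1 / sqrt (2 * pi) = (2 * pi) powr (- (1 / 2))"
      by (simp add: powr_minus powr_half_sqrt inverse_eq_divide)
    hence "(1 / sqrt (2 * pi)) ^ CARD('n) = ((2 * pi) powr (- (1 / 2))) powr real CARD('n)"
      by (simp add: powr_realpow)
    thus ?thesis by (simp add: powr_powr)
  qed
  moreover have "exp (- (norm x)\<^sup>2 / 2) = (\<Prod>i\<in>UNIV. exp (- (x $ i)\<^sup>2 / 2))"
    by (simp add: norm_sq_vec sum_divide_distrib sum_negf flip: exp_sum)
  ultimately show ?thesis
    unfolding rho_def std_normal_density_def prod.distrib prod_constant by simp
qed

lemma rho_pos: "rho x > 0" by (simp add: rho_def)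

lemma rho_measurable [measurable]: "rho \<in> borel_measurable borel"
  unfolding rho_def[abs_def] by measurable

lemma integral_rho: "integrable lborel (rho :: real ^ 'n \<Rightarrow> real)" "(LINT x|lborel. rho (x :: real ^ 'n)) = 1"
proof -
  have 1: "(\<integral>\<^sup>+t. ennreal (std_normal_density t) \<partial>lborel) = 1"
    by (subst nn_integral_eq_integral) auto
  have "(\<integral>\<^sup>+x. ennreal (rho (x :: real ^ 'n)) \<partial>lborel) = ennreal 1"
    unfolding rho_prod by (subst nn_integral_prod_vec) (simp_all add: 1)
  hence "has_bochner_integral lborel (rho :: real ^ 'n \<Rightarrow> real) 1"
    by (intro has_bochner_integral_nn_integral) (auto intro: less_imp_le rho_pos)
  thus "integrable lborel (rho :: real ^ 'n \<Rightarrow> real)" "(LINT x|lborel. rho (x :: real ^ 'n)) = 1"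
    by (auto simp: has_bochner_integral_iff)
qed

lemma gauss_eq: "gauss = density lborel (\<lambda>x. ennreal (rho x))"
  by (simp add: gauss_def rho_def)

lemma sets_gauss [measurable_cong, simp]: "sets gauss = sets borel"
  by (simp add: gauss_eq)

lemma integrable_gauss_iff:
  fixes f :: "real ^ 'n \<Rightarrow> 'b::{banach,second_countable_topology}"
  assumes [measurable]: "f \<in> borel_measurable borel"
  shows "integrable gauss f \<longleftrightarrow> integrable lborel (\<lambda>x. rho x *\<^sub>R f x)"
  unfolding gauss_eq by (rule integrable_density) (auto intro: less_imp_le rho_pos)

lemma integral_gauss:
  fixes f :: "real ^ 'n \<Rightarrow> 'b::{banach,second_countable_topology}"
  assumes [measurable]: "f \<in> borel_measurable borel"
  shows "integral\<^sup>L gauss f = (LINT x|lborel. rho x *\<^sub>R f x)"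
  unfolding gauss_eq by (rule integral_density) (auto intro: less_imp_le rho_pos)

definition L2const :: "'n::finite itself \<Rightarrow> real" where
  "L2const _ = sqrt ((2 * pi) powr (- real CARD('n) / 2) * (LINT x|lborel. weight (x :: real ^ 'n)))"

lemma L2const_nonneg: "L2const TYPE('n::finite) \<ge> 0"
  by (simp add: L2const_def integral_weight_nonneg)

lemma rho_growth: "rho (x :: real ^ 'n) * growth x ^ 2 = (2 * pi) powr (- real CARD('n) / 2)"
proof -
  have "growth x ^ 2 = exp ((norm x) ^ 2 / 2)" by (simp add: growth_def exp_double[symmetric])
  thus ?thesis by (simp add: rho_def exp_minus)
qed

text \<open>
  The square of \<open>growth\<close> cancels the Gaussian density, which leaves the integrable function \<open>weight\<^sup>2\<close>.
\<close>

lemma L2_weighted: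
  fixes f :: "real ^ 'n \<Rightarrow> complex"
  assumes [measurable]: "f \<in> borel_measurable borel" and bound: "\<And>x. norm (f x) \<le> K * (growth x * weight x)"
  shows "f \<in> L2" "L2_norm f \<le> K * L2const TYPE('n)"
proof -
  have K: "K \<ge> 0"
  proof -
    have p: "growth (0 :: real ^ 'n) * weight (0 :: real ^ 'n) > 0" by (intro mult_pos_pos growth_pos weight_pos)
    have "0 \<le> K * (growth (0 :: real ^ 'n) * weight (0 :: real ^ 'n))"
      by (rule order_trans[OF norm_ge_zero bound])
    thus ?thesis using p by (simp only: zero_le_mult_iff) linarith
  qed
  have b: "rho x *\<^sub>R (norm (f x))\<^sup>2 \<le> K\<^sup>2 * ((2 * pi) powr (- real CARD('n) / 2) * weight x)" for x
  proof -
    have "(norm (f x))\<^sup>2 \<le> (K * (growth x * weight x))\<^sup>2" by (intro power_mono bound) auto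
    also have "\<dots> = K\<^sup>2 * (growth x)\<^sup>2 * (weight x * weight x)" by (simp add: power2_eq_square mult_ac)
    also have "\<dots> \<le> K\<^sup>2 * (growth x)\<^sup>2 * (weight x * 1)"
      using weight_pos[of x] weight_le_1[of x] by (intro mult_left_mono) auto
    finally have "rho x * (norm (f x))\<^sup>2 \<le> rho x * (K\<^sup>2 * (growth x)\<^sup>2 * (weight x * 1))"
      by (intro mult_left_mono) (auto intro: less_imp_le rho_pos)
    also have "\<dots> = K\<^sup>2 * (rho x * (growth x)\<^sup>2) * weight x" by (simp add: mult_ac)
    finally show ?thesis unfolding rho_growth by (simp add: mult_ac)
  qed
  have i: "integrable lborel (\<lambda>x. K\<^sup>2 * ((2 * pi) powr (- real CARD('n) / 2) * weight (x :: real ^ 'n)))"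
    by (intro integrable_mult_right integrable_weight)
  have i2: "integrable lborel (\<lambda>x. rho x *\<^sub>R (norm (f x))\<^sup>2)"
  proof (rule Bochner_Integration.integrable_bound[OF i])
    show "AE x in lborel. norm (rho x *\<^sub>R (norm (f x))\<^sup>2)
        \<le> norm (K\<^sup>2 * ((2 * pi) powr (- real CARD('n) / 2) * weight x))"
    proof (rule AE_I2)
      fix x :: "real ^ 'n"
      show "norm (rho x *\<^sub>R (norm (f x))\<^sup>2) \<le> norm (K\<^sup>2 * ((2 * pi) powr (- real CARD('n) / 2) * weight x))"
        using b[of x] rho_pos[of x] weight_pos[of x] by (simp add: abs_mult)
    qed
  qed simp
  have "f \<in> borel_measurable gauss"
    using assms(1) by (simp add: measurable_cong_sets[OF sets_gauss refl])
  thus "f \<in> L2" unfolding L2_def using i2 by (simp add: integrable_gauss_iff)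
  have "(LINT x|gauss. (norm (f x))\<^sup>2) = (LINT x|lborel. rho x *\<^sub>R (norm (f x))\<^sup>2)"
    by (rule integral_gauss) simp
  also have "\<dots> \<le> (LINT x|lborel. K\<^sup>2 * ((2 * pi) powr (- real CARD('n) / 2) * weight (x :: real ^ 'n)))"
    by (rule integral_mono[OF i2 i]) (rule b)
  also have "\<dots> = (K * L2const TYPE('n)) ^ 2"
    unfolding L2const_def power_mult_distrib
    by (subst real_sqrt_pow2) (simp_all add: integral_weight_nonneg)
  finally have "L2_norm f \<le> sqrt ((K * L2const TYPE('n)) ^ 2)" unfolding L2_norm_def by (simp only: real_sqrt_le_iff)
  also have "\<dots> = K * L2const TYPE('n)"
    using K L2const_nonneg[where 'n = 'n] by (simp add: abs_mult)
  finally show "L2_norm f \<le> K * L2const TYPE('n)" .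
qed

lemma L2_norm_nonneg: "L2_norm f \<ge> 0"
  unfolding L2_norm_def by simp

section \<open>The evolution of a Hermite series\<close>

definition evolve :: "(('n::finite \<Rightarrow> nat) \<Rightarrow> complex) \<Rightarrow> real \<Rightarrow> ('n \<Rightarrow> nat) \<Rightarrow> complex" where
  "evolve c t \<alpha> = cis (- (real (deg \<alpha>) * t)) * c \<alpha>"

lemma norm_evolve [simp]: "norm (evolve c t \<alpha>) = norm (c \<alpha>)"
  by (simp add: evolve_def norm_mult)

lemma wcoef_evolve [simp]: "wcoef N (evolve c t) = wcoef N c"
  by (simp add: wcoef_def[abs_def])

lemma rapid_evolve: "rapid c \<Longrightarrow> rapid (evolve c t)"
  unfolding rapid_def by simp

lemma rapid_minus_deg: "rapid c \<Longrightarrow> rapid (minus_deg (c :: ('n::finite \<Rightarrow> nat) \<Rightarrow> complex))"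
proof -
  assume "rapid c"
  moreover have "norm (- complex_of_nat (deg \<alpha>)) \<le> real CARD('n) * qprod \<alpha> ^ 1" for \<alpha> :: "'n \<Rightarrow> nat"
    using deg_le_qprod[of \<alpha>] by simp
  ultimately show ?thesis unfolding minus_deg_def[abs_def] by (rule rapid_mult)
qed

lemma rapid_comparison:
  assumes "rapid c" "\<And>\<alpha>. norm (d \<alpha>) \<le> norm (c \<alpha>)"
  shows "rapid d"
  unfolding rapid_def
proof
  fix N
  obtain C where C: "\<And>\<alpha>. wcoef N c \<alpha> \<le> C" using assms(1) unfolding rapid_def by blast
  have "wcoef N d \<alpha> \<le> C" for \<alpha>
  proof -
    have "wcoef N d \<alpha> \<le> wcoef N c \<alpha>"
      unfolding wcoef_def using sfact_pos[of \<alpha>] qprod_pos[of \<alpha>] by (intro mult_right_mono assms) auto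
    also have "\<dots> \<le> C" by (rule C)
    finally show ?thesis .
  qed
  thus "\<exists>C. \<forall>\<alpha>. wcoef N d \<alpha> \<le> C" by blast
qed

lemma hseries_cmult: "rapid c \<Longrightarrow> hseries (\<lambda>\<alpha>. a * c \<alpha>) x = a * hseries c x"
  unfolding hseries_def by (simp add: mult.assoc suminf_mult summable_hseries)

lemma hseries_diff: "rapid c \<Longrightarrow> rapid d \<Longrightarrow> hseries (\<lambda>\<alpha>. c \<alpha> - d \<alpha>) x = hseries c x - hseries d x"
  unfolding hseries_def by (simp add: suminf_diff summable_hseries left_diff_distrib)

lemma minus_deg_evolve: "minus_deg (evolve c t) = evolve (minus_deg c) t"
  by (simp add: minus_deg_def evolve_def fun_eq_iff)

lemma continuous_hermite: "continuous_on S (hermite \<alpha>)"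
  by (intro differentiable_imp_continuous_on)
    (auto simp: differentiable_on_def intro!: differentiable_at_withinI has_gradient_imp_differentiable[OF hermite_gradient])

lemma continuous_hermiteD: "continuous_on S (hermiteD i \<alpha>)"
  unfolding hermiteD_def[abs_def] by (intro continuous_intros continuous_hermite)

lemma continuous_hermiteDD: "continuous_on S (hermiteDD j i \<alpha>)"
  unfolding hermiteDD_def[abs_def] by (intro continuous_intros continuous_hermiteD)

text \<open>
  Continuity in time and space together, for the Hermite series and its derivatives alike: the phases have
  modulus 1, so the majorant does not depend on time.
\<close>

lemma joint_continuity:
  fixes c :: "('n::finite \<Rightarrow> nat) \<Rightarrow> complex" and G :: "('n \<Rightarrow> nat) \<Rightarrow> real ^ 'n \<Rightarrow> complex"
  assumes c: "rapid c" and G: "\<And>\<alpha>. continuous_on UNIV (G \<alpha>)"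
    and b: "\<And>\<alpha> x. norm (G \<alpha> x) \<le> hconst TYPE('n) * (sfact \<alpha> * qprod \<alpha> ^ m) * (growth x * weight x)"
  shows "continuous_on UNIV (\<lambda>(t, x). \<Sum>k. evolve c t (idx k) * G (idx k) x)"
  unfolding case_prod_beta
proof (rule continuous_on_suminf_weighted[where e = "\<lambda>p. growth (snd p)" and M = "\<lambda>k. hconst TYPE('n) * wcoef m c (idx k)"])
  show "continuous_on UNIV (\<lambda>p. evolve c (fst p) (idx k) * G (idx k) (snd p))" for k
    unfolding evolve_def
    by (intro continuous_intros continuous_on_compose2[OF G]) auto
  show "continuous_on UNIV (\<lambda>p. growth (snd p))"
    by (intro continuous_on_compose2[OF continuous_on_growth] continuous_intros) auto
  show "norm (evolve c (fst p) (idx k) * G (idx k) (snd p)) \<le> hconst TYPE('n) * wcoef m c (idx k) * growth (snd p)" for k p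
    using weighted_bound_mono[OF b order.refl, of "evolve c (fst p)"] by simp
qed (intro majorant_summable majorant_nonneg c)+

text \<open>
  Differentiation in time multiplies the coefficients by \<open>-i|\<alpha>|\<close>, which rapid decay absorbs; the termwise derivatives
  are summable uniformly in time.
\<close>

lemma hseries_time_derivative:
  fixes c :: "('n::finite \<Rightarrow> nat) \<Rightarrow> complex" and x :: "real ^ 'n"
  assumes c: "rapid c"
  shows "((\<lambda>t. hseries (evolve c t) x) has_vector_derivative \<i> * hseries (evolve (minus_deg c) t) x) (at t)"
proof -
  define f where "f k t = evolve c t (idx k) * hermite (idx k) x" for k t
  define g where "g k t = \<i> * (evolve (minus_deg c) t (idx k) * hermite (idx k) x)" for k t
  have df: "(f k has_vector_derivative g k t) (at t)" for k t
  proof -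
    define a b where "a = - \<i> * of_nat (deg (idx k :: 'n \<Rightarrow> nat))" and "b = c (idx k) * hermite (idx k) x"
    have "((\<lambda>z. exp (a * z) * b) has_field_derivative exp (a * of_real t) * a * b) (at (of_real t))"
      by (auto intro!: derivative_eq_intros simp: mult_ac)
    from has_vector_derivative_real_field[OF this]
    have "((\<lambda>t. exp (a * of_real t) * b) has_vector_derivative exp (a * of_real t) * a * b) (at t)" .
    moreover have "f k = (\<lambda>t. exp (a * of_real t) * b)"
      by (simp add: f_def a_def b_def evolve_def cis_conv_exp fun_eq_iff mult_ac)
    moreover have "g k t = exp (a * of_real t) * a * b"
      by (simp add: g_def a_def b_def evolve_def minus_deg_def cis_conv_exp mult_ac)
    ultimately show ?thesis by simp
  qed
  have su: "summable (\<lambda>k. hconst TYPE('n) * wcoef 2 (minus_deg c) (idx k) * growth x)"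
    by (intro summable_mult2 majorant_summable rapid_minus_deg c)
  have unif: "uniform_limit UNIV (\<lambda>n t. \<Sum>k<n. g k t) (\<lambda>t. \<Sum>k. g k t) sequentially"
  proof (rule Weierstrass_m_test[OF _ su])
    fix k t
    show "norm (g k t) \<le> hconst TYPE('n) * wcoef 2 (minus_deg c) (idx k) * growth x"
      unfolding g_def using weighted_bound_mono[OF hermite_bound order.refl, of "evolve (minus_deg c) t" "idx k" x]
      by (simp add: norm_mult)
  qed
  have sums: "(\<lambda>k. f k s) sums hseries (evolve c s) x" for s
    unfolding f_def hseries_def by (intro summable_sums summable_hseries rapid_evolve c)
  have "\<exists>h. \<forall>s\<in>UNIV. (\<lambda>k. f k s) sums h s \<and> (h has_derivative (\<lambda>d. d *\<^sub>R (\<Sum>k. g k s))) (at s within UNIV)"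
  proof (rule has_derivative_series[OF _ _ _ UNIV_I sums])
    show "(f k has_derivative (\<lambda>d. d *\<^sub>R g k s)) (at s within UNIV)" for k s
      using df[of k s] by (simp add: has_vector_derivative_def)
    fix e :: real assume "e > 0"
    from uniform_limitD[OF unif this]
    show "\<forall>\<^sub>F n in sequentially. \<forall>s\<in>UNIV. \<forall>d. norm ((\<Sum>k<n. d *\<^sub>R g k s) - d *\<^sub>R (\<Sum>k. g k s)) \<le> e * norm d"
    proof (rule eventually_mono, intro ballI allI)
      fix n s d assume *: "\<forall>x\<in>UNIV. dist (\<Sum>k<n. g k x) (\<Sum>k. g k x) < e"
      have "norm ((\<Sum>k<n. d *\<^sub>R g k s) - d *\<^sub>R (\<Sum>k. g k s)) = norm d * norm ((\<Sum>k<n. g k s) - (\<Sum>k. g k s))"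
        by (simp add: scaleR_sum_right[symmetric] scaleR_diff_right[symmetric])
      also have "\<dots> \<le> norm d * e"
        using * by (intro mult_left_mono) (auto simp: dist_norm intro: less_imp_le)
      finally show "norm ((\<Sum>k<n. d *\<^sub>R g k s) - d *\<^sub>R (\<Sum>k. g k s)) \<le> e * norm d" by (simp add: mult.commute)
    qed
  qed auto
  then obtain h where h: "\<And>s. (\<lambda>k. f k s) sums h s" "\<And>s. (h has_derivative (\<lambda>d. d *\<^sub>R (\<Sum>k. g k s))) (at s)"
    by auto
  have "h = (\<lambda>t. hseries (evolve c t) x)" using sums_unique2[OF h(1) sums] by auto
  moreover have "(\<Sum>k. g k t) = \<i> * hseries (evolve (minus_deg c) t) x"
    unfolding g_def hseries_def by (intro suminf_mult summable_hseries rapid_evolve rapid_minus_deg c)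
  ultimately show ?thesis using h(2)[of t] by (simp add: has_vector_derivative_def)
qed

lemma classical_solution_hseries:
  assumes c: "rapid (c :: ('n::finite \<Rightarrow> nat) \<Rightarrow> complex)"
  shows "classical_solution (hseries c) (\<lambda>t. hseries (evolve c t))"
proof -
  note ce = rapid_evolve[OF c]
  note cd = rapid_minus_deg[OF c]
  have vd: "vector_derivative (\<lambda>s. hseries (evolve c s) x) (at t) = \<i> * hseries (evolve (minus_deg c) t) x" for t and x :: "real ^ 'n"
    by (rule vector_derivative_at[OF hseries_time_derivative[OF c]])
  have cont: "continuous_on UNIV (\<lambda>(t, x :: real ^ 'n). hseries (evolve d t) x)" if "rapid d" for d
    unfolding hseries_def by (rule joint_continuity[OF that continuous_hermite hermite_bound])
  show ?thesis unfolding classical_solution_def partial_hseries[OF ce] partial_hseriesD[OF ce] vd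
  proof (intro conjI allI)
    show "(\<lambda>t. hseries (evolve c t) x) differentiable_on UNIV" for x
      using hseries_time_derivative[OF c, of x]
      by (auto simp: differentiable_on_def differentiable_def has_vector_derivative_def)
    show "hseries (evolve c t) differentiable_on UNIV" for t
      using has_gradient_imp_differentiable[OF hseries_gradient[OF ce]] by (simp add: differentiable_on_def)
    show "hseriesD i (evolve c t) differentiable_on UNIV" for t i
      using has_gradient_imp_differentiable[OF hseriesD_gradient[OF ce]] by (simp add: differentiable_on_def)
    show "continuous_on UNIV (\<lambda>(t, x). hseries (evolve c t) x)" by (rule cont[OF c])
    show "continuous_on UNIV (\<lambda>(t, x). \<i> * hseries (evolve (minus_deg c) t) x)"
      using continuous_on_mult_left[OF cont[OF cd], of \<i>] by (simp add: case_prod_beta)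
    show "continuous_on UNIV (\<lambda>(t, x). hseriesD i (evolve c t) x)" for i
      unfolding hseriesD_def by (rule joint_continuity[OF c continuous_hermiteD hermiteD_bound])
    show "continuous_on UNIV (\<lambda>(t, x). hseriesDD j i (evolve c t) x)" for i j
      unfolding hseriesDD_def by (rule joint_continuity[OF c continuous_hermiteDD hermiteDD_bound])
    show "\<i> * (\<i> * hseries (evolve (minus_deg c) t) x) + OU_diff (hseries (evolve c t)) x = 0" for t x
      by (simp add: OU_diff_hseries[OF ce] minus_deg_evolve mult.assoc[symmetric])
    show "hseries (evolve c 0) x = hseries c x" for x
      by (simp add: evolve_def[abs_def])
  qed
qed

lemma hseries_measurable: "rapid c \<Longrightarrow> hseries c \<in> borel_measurable borel"
  using hseries_gradient[of c] has_gradient_imp_differentiable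
  by (intro borel_measurable_continuous_onI differentiable_imp_continuous_on)
    (auto simp: differentiable_on_def)

lemma hseries_L2:
  assumes "rapid (c :: ('n::finite \<Rightarrow> nat) \<Rightarrow> complex)"
  shows "hseries c \<in> L2" "L2_norm (hseries c) \<le> hconst TYPE('n) * (\<Sum>k. wcoef 2 c (idx k)) * L2const TYPE('n)"
  using L2_weighted[OF hseries_measurable[OF assms] hseries_bound[OF assms]] by auto

text \<open>
  Truncations of a Hermite series are the elements of \<open>hermite_span\<close> that witness membership in the closure.
\<close>

definition trunc :: "nat \<Rightarrow> (('n::finite \<Rightarrow> nat) \<Rightarrow> complex) \<Rightarrow> ('n \<Rightarrow> nat) \<Rightarrow> complex" where
  "trunc N c \<alpha> = (if \<alpha> \<in> idx ` {..<N} then c \<alpha> else 0)"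

lemma trunc_idx: "trunc N c (idx k) = (if k < N then c (idx k) else 0)"
  using bij_idx[THEN bij_is_inj] by (auto simp: trunc_def inj_def image_iff)

lemma rapid_trunc: "rapid c \<Longrightarrow> rapid (trunc N c)"
  by (erule rapid_comparison) (simp add: trunc_def)

lemma hseries_trunc: "hseries (trunc N c) = (\<lambda>x. \<Sum>\<alpha>\<in>idx ` {..<N}. c \<alpha> * hermite \<alpha> x)"
proof
  fix x :: "real ^ 'a"
  have "hseries (trunc N c) x = (\<Sum>k<N. trunc N c (idx k) * hermite (idx k) x)"
    unfolding hseries_def by (rule suminf_finite) (auto simp: trunc_idx)
  also have "\<dots> = (\<Sum>k<N. c (idx k) * hermite (idx k) x)" by (simp add: trunc_idx)
  also have "\<dots> = (\<Sum>\<alpha>\<in>idx ` {..<N}. c \<alpha> * hermite \<alpha> x)"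
    using inj_on_subset[OF bij_idx[THEN bij_is_inj]] by (subst sum.reindex) auto
  finally show "hseries (trunc N c) x = (\<Sum>\<alpha>\<in>idx ` {..<N}. c \<alpha> * hermite \<alpha> x)" .
qed

lemma hseries_trunc_tendsto:
  fixes c :: "('n::finite \<Rightarrow> nat) \<Rightarrow> complex"
  assumes c: "rapid c"
  shows "(\<lambda>N. L2_norm (\<lambda>x. hseries c x - hseries (trunc N c) x)) \<longlonglongrightarrow> 0"
proof -
  define d where "d N \<alpha> = c \<alpha> - trunc N c \<alpha>" for N \<alpha>
  have d: "rapid (d N)" for N
    by (rule rapid_comparison[OF c]) (simp add: d_def trunc_def)
  have "wcoef 2 (d N) (idx k) = (if k < N then 0 else wcoef 2 c (idx k))" for N k
    by (simp add: wcoef_def d_def trunc_idx)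
  hence tail: "(\<Sum>k. wcoef 2 (d N) (idx k)) = (\<Sum>k. wcoef 2 c (idx k)) - (\<Sum>k<N. wcoef 2 c (idx k))" for N
    using suminf_minus_initial_segment[OF rapid_summable[OF c, of 2], of N]
      suminf_split_initial_segment[OF rapid_summable[OF d[of N], of 2], of N] by simp
  have "(\<lambda>N. hconst TYPE('n) * ((\<Sum>k. wcoef 2 c (idx k)) - (\<Sum>k<N. wcoef 2 c (idx k))) * L2const TYPE('n))
      \<longlonglongrightarrow> hconst TYPE('n) * ((\<Sum>k. wcoef 2 c (idx k)) - (\<Sum>k. wcoef 2 c (idx k))) * L2const TYPE('n)"
    by (intro tendsto_intros summable_LIMSEQ rapid_summable c)
  hence lim: "(\<lambda>N. hconst TYPE('n) * (\<Sum>k. wcoef 2 (d N) (idx k)) * L2const TYPE('n)) \<longlonglongrightarrow> 0"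
    by (simp add: tail)
  have "L2_norm (\<lambda>x. hseries c x - hseries (trunc N c) x) \<le> hconst TYPE('n) * (\<Sum>k. wcoef 2 (d N) (idx k)) * L2const TYPE('n)" for N
  proof -
    have "hseries (d N) = (\<lambda>x. hseries c x - hseries (trunc N c) x)"
      unfolding d_def[abs_def] by (rule ext) (rule hseries_diff[OF c rapid_trunc[OF c]])
    thus ?thesis using hseries_L2(2)[OF d[of N]] by simp
  qed
  thus ?thesis
    by (intro tendsto_sandwich[OF _ _ tendsto_const lim]) (auto simp: L2_norm_nonneg)
qed

text \<open>
  The truncations converge in the graph norm, because the operator acts on coefficients and commutes with truncation.
\<close>

lemma OU_hseries:
  fixes c :: "('n::finite \<Rightarrow> nat) \<Rightarrow> complex"
  assumes c: "rapid c"
  shows "OU (hseries c) (hseries (minus_deg c))"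
  unfolding OU_def
proof (intro conjI allI impI)
  show "hseries c \<in> L2" "hseries (minus_deg c) \<in> L2" by (intro hseries_L2 rapid_minus_deg c)+
  fix e :: real assume e: "e > 0"
  have "eventually (\<lambda>N. L2_norm (\<lambda>x. hseries c x - hseries (trunc N c) x) < e
      \<and> L2_norm (\<lambda>x. hseries (minus_deg c) x - hseries (trunc N (minus_deg c)) x) < e) sequentially"
    using e by (intro eventually_conj order_tendstoD(2)[OF hseries_trunc_tendsto] rapid_minus_deg c)
  then obtain N where N: "L2_norm (\<lambda>x. hseries c x - hseries (trunc N c) x) < e"
      "L2_norm (\<lambda>x. hseries (minus_deg c) x - hseries (trunc N (minus_deg c)) x) < e"
    by (metis (mono_tags, lifting) eventually_sequentially order_refl)
  have "trunc N (minus_deg c) = minus_deg (trunc N c)"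
    by (auto simp: trunc_def minus_deg_def fun_eq_iff)
  hence eq: "OU_diff (hseries (trunc N c)) = hseries (trunc N (minus_deg c))"
    by (intro ext) (simp only: OU_diff_hseries[OF rapid_trunc[OF c]])
  have "hseries (trunc N c) \<in> hermite_span"
    unfolding hermite_span_def hseries_trunc by blast
  with N eq show "\<exists>p\<in>hermite_span. L2_norm (\<lambda>x. hseries c x - p x) < e \<and>
      L2_norm (\<lambda>x. hseries (minus_deg c) x - OU_diff p x) < e"
    by (intro bexI[of _ "hseries (trunc N c)"]) simp_all
qed

lemma cis_quadratic: "norm (cis s - 1 - \<i> * of_real s) \<le> s ^ 2"
proof -
  have "norm (iexp s - (\<Sum>k\<le>1. (\<i> * s) ^ k / fact k)) \<le> \<bar>s\<bar> ^ Suc 1 / fact (Suc 1)"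
    by (rule iexp_approx1)
  hence "norm (cis s - 1 - \<i> * of_real s) \<le> s ^ 2 / 2"
    by (simp add: cis_conv_exp diff_diff_eq power2_eq_square)
  thus ?thesis by (smt (verit) zero_le_power2 field_sum_of_halves)
qed

text \<open>
  The difference quotient minus the derivative is again a Hermite series. By the Taylor estimate for \<open>cis\<close> its
  coefficients are at most \<open>|h| |\<alpha>|\<^sup>2 |c\<^sub>\<alpha>|\<close>, so its norm is of order \<open>|h|\<close>.
\<close>

lemma hseries_L2_derivative:
  fixes c :: "('n::finite \<Rightarrow> nat) \<Rightarrow> complex"
  assumes c: "rapid c"
  shows "has_L2_derivative (\<lambda>t. hseries (evolve c t)) (\<lambda>x. \<i> * hseries (evolve (minus_deg c) t) x) t"
proof -
  define d where "d h \<alpha> = 1 / of_real h * (evolve c (t + h) \<alpha> - evolve c t \<alpha>) - \<i> * evolve (minus_deg c) t \<alpha>" for h \<alpha>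
  define e where "e = minus_deg (minus_deg c)"
  have e: "rapid e" unfolding e_def by (intro rapid_minus_deg c)
  have d_le: "norm (d h \<alpha>) \<le> norm (of_real h * e \<alpha>)" if "h \<noteq> 0" for h \<alpha>
  proof -
    define s where "s = - (real (deg \<alpha>) * h)"
    have "evolve c (t + h) \<alpha> = cis s * evolve c t \<alpha>"
      unfolding evolve_def s_def mult.assoc[symmetric] cis_mult by (simp add: algebra_simps)
    moreover have "evolve (minus_deg c) t \<alpha> = - of_nat (deg \<alpha>) * evolve c t \<alpha>"
      by (simp add: evolve_def minus_deg_def)
    ultimately have "d h \<alpha> = (cis s - 1 - \<i> * of_real s) * evolve c t \<alpha> / of_real h"
      using that unfolding d_def s_def by (simp add: field_simps)
    hence "norm (d h \<alpha>) = norm (cis s - 1 - \<i> * of_real s) * norm (c \<alpha>) / \<bar>h\<bar>"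
      by (simp add: norm_mult norm_divide)
    also have "\<dots> \<le> s ^ 2 * norm (c \<alpha>) / \<bar>h\<bar>"
      by (intro divide_right_mono mult_right_mono cis_quadratic) auto
    also have "\<dots> = (s ^ 2 / \<bar>h\<bar>) * norm (c \<alpha>)" by simp
    also have "s ^ 2 / \<bar>h\<bar> = \<bar>h\<bar> * real (deg \<alpha>) ^ 2"
      using that by (simp add: s_def power2_eq_square field_simps)
    also have "\<bar>h\<bar> * real (deg \<alpha>) ^ 2 * norm (c \<alpha>) = norm (of_real h * e \<alpha>)"
      by (simp add: e_def minus_deg_def norm_mult power2_eq_square)
    finally show ?thesis .
  qed
  have rapid_he: "rapid (\<lambda>\<alpha>. of_real h * e \<alpha>)" for h
    by (rule rapid_mult[OF e, of _ "\<bar>h\<bar>" 0]) simp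
  have rapid_d: "rapid (d h)" if "h \<noteq> 0" for h
    by (rule rapid_comparison[OF rapid_he d_le[OF that]])
  have r1: "rapid (\<lambda>\<alpha>. evolve c (t + h) \<alpha> - evolve c t \<alpha>)" for h
    by (rule rapid_comparison[OF rapid_mult[OF c, of "\<lambda>_. 2" 2 0]])
      (auto intro!: order_trans[OF norm_triangle_ineq4] simp: norm_mult)
  have r2: "rapid (\<lambda>\<alpha>. 1 / of_real h * (evolve c (t + h) \<alpha> - evolve c t \<alpha>))" for h
    by (rule rapid_mult[OF r1, of _ "norm (1 / complex_of_real h)" 0]) simp
  have r3: "rapid (\<lambda>\<alpha>. \<i> * evolve (minus_deg c) t \<alpha>)"
    by (rule rapid_mult[OF rapid_evolve[OF rapid_minus_deg[OF c]], of _ 1 0]) simp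
  have eq: "(\<lambda>x. (hseries (evolve c (t + h)) x - hseries (evolve c t) x) / of_real h - \<i> * hseries (evolve (minus_deg c) t) x) = hseries (d h)" for h
    unfolding d_def[abs_def]
    by (rule ext) (subst hseries_diff[OF r2 r3], subst hseries_cmult[OF r1],
      subst hseries_diff[OF rapid_evolve[OF c] rapid_evolve[OF c]], subst hseries_cmult[OF rapid_evolve[OF rapid_minus_deg[OF c]]], simp)
  have bound: "L2_norm (hseries (d h)) \<le> \<bar>h\<bar> * (hconst TYPE('n) * (\<Sum>k. wcoef 2 e (idx k)) * L2const TYPE('n))" if "h \<noteq> 0" for h
  proof -
    have w: "wcoef 2 (d h) \<alpha> \<le> \<bar>h\<bar> * wcoef 2 e \<alpha>" for \<alpha>
      using mult_right_mono[OF d_le[OF that, of \<alpha>], of "sfact \<alpha> * qprod \<alpha> ^ 2"] sfact_pos[of \<alpha>]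
      by (simp add: wcoef_def norm_mult mult.assoc)
    have "(\<Sum>k. wcoef 2 (d h) (idx k)) \<le> (\<Sum>k. \<bar>h\<bar> * wcoef 2 e (idx k))"
      by (intro suminf_le w rapid_summable rapid_d that summable_mult e)
    also have "\<dots> = \<bar>h\<bar> * (\<Sum>k. wcoef 2 e (idx k))"
      by (intro suminf_mult rapid_summable e)
    finally have "hconst TYPE('n) * (\<Sum>k. wcoef 2 (d h) (idx k)) * L2const TYPE('n)
        \<le> hconst TYPE('n) * (\<bar>h\<bar> * (\<Sum>k. wcoef 2 e (idx k))) * L2const TYPE('n)"
      using hconst_pos[where 'n = 'n] by (intro mult_right_mono mult_left_mono L2const_nonneg) auto
    with hseries_L2(2)[OF rapid_d[OF that]] show ?thesis by (simp add: mult_ac)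
  qed
  have lim: "((\<lambda>h. \<bar>h\<bar> * (hconst TYPE('n) * (\<Sum>k. wcoef 2 e (idx k)) * L2const TYPE('n))) \<longlongrightarrow> 0) (at 0)"
    by (rule tendsto_eq_intros refl | simp)+
  show ?thesis unfolding has_L2_derivative_def eq
    by (rule tendsto_sandwich[OF _ _ tendsto_const lim])
      (auto simp: L2_norm_nonneg eventually_at_filter bound)
qed

lemma L2_solution_hseries:
  assumes "rapid (c :: ('n::finite \<Rightarrow> nat) \<Rightarrow> complex)"
  shows "L2_solution (hseries c) (\<lambda>t. hseries (evolve c t))"
  unfolding L2_solution_def
proof (intro conjI allI)
  fix t
  have "OU (hseries (evolve c t)) (hseries (evolve (minus_deg c) t))"
    using OU_hseries[OF rapid_evolve[OF assms, of t]] by (simp add: minus_deg_evolve)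
  thus "\<exists>g. OU (hseries (evolve c t)) g \<and> has_L2_derivative (\<lambda>t. hseries (evolve c t)) (\<lambda>x. \<i> * g x) t"
    using hseries_L2_derivative[OF assms, of t] by blast
qed (simp add: evolve_def[abs_def])

section \<open>Uniqueness in the Hilbert space\<close>

lemma L2D:
  assumes "f \<in> L2"
  shows "f \<in> borel_measurable gauss" "integrable gauss (\<lambda>x. (norm (f x))\<^sup>2)"
  using assms by (auto simp: L2_def)

lemma L2_norm_sq: "(L2_norm f)\<^sup>2 = (LINT x|gauss. (norm (f x))\<^sup>2)"
  unfolding L2_norm_def by (rule real_sqrt_pow2) (rule Bochner_Integration.integral_nonneg, simp)

lemma norm_add_sq_le: "(norm (a + b :: complex))\<^sup>2 \<le> 2 * (norm a)\<^sup>2 + 2 * (norm b)\<^sup>2"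
proof -
  have "(norm (a + b))\<^sup>2 \<le> (norm a + norm b)\<^sup>2" by (intro power_mono norm_triangle_ineq) auto
  also have "\<dots> \<le> 2 * (norm a)\<^sup>2 + 2 * (norm b)\<^sup>2"
    using zero_le_power2[of "norm a - norm b"] by (simp add: power2_eq_square algebra_simps)
  finally show ?thesis .
qed

lemma L2_cmult: "f \<in> L2 \<Longrightarrow> (\<lambda>x. a * f x) \<in> L2"
  by (auto simp: L2_def norm_mult power_mult_distrib)

lemma L2_add:
  assumes f: "f \<in> L2" and g: "g \<in> L2"
  shows "(\<lambda>x. f x + g x) \<in> L2" "(L2_norm (\<lambda>x. f x + g x))\<^sup>2 \<le> 2 * (L2_norm f)\<^sup>2 + 2 * (L2_norm g)\<^sup>2"
proof -
  note [measurable] = L2D(1)[OF f] L2D(1)[OF g]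
  have i: "integrable gauss (\<lambda>x. 2 * (norm (f x))\<^sup>2 + 2 * (norm (g x))\<^sup>2)"
    by (intro Bochner_Integration.integrable_add integrable_mult_right L2D f g)
  have i2: "integrable gauss (\<lambda>x. (norm (f x + g x))\<^sup>2)"
    by (rule Bochner_Integration.integrable_bound[OF i]) (auto simp: norm_add_sq_le)
  thus "(\<lambda>x. f x + g x) \<in> L2" by (simp add: L2_def)
  have "(LINT x|gauss. (norm (f x + g x))\<^sup>2) \<le> (LINT x|gauss. 2 * (norm (f x))\<^sup>2 + 2 * (norm (g x))\<^sup>2)"
    by (rule integral_mono[OF i2 i]) (rule norm_add_sq_le)
  also have "\<dots> = 2 * (L2_norm f)\<^sup>2 + 2 * (L2_norm g)\<^sup>2"
    unfolding L2_norm_sq by (simp add: Bochner_Integration.integral_add L2D f g)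
  finally show "(L2_norm (\<lambda>x. f x + g x))\<^sup>2 \<le> 2 * (L2_norm f)\<^sup>2 + 2 * (L2_norm g)\<^sup>2"
    unfolding L2_norm_sq .
qed

lemma L2_diff: "f \<in> L2 \<Longrightarrow> g \<in> L2 \<Longrightarrow> (\<lambda>x. f x - g x) \<in> L2"
  using L2_add(1)[OF _ L2_cmult[of g "-1"], of f] by simp

lemma L2_inner_integrable:
  assumes f: "f \<in> L2" and g: "g \<in> L2"
  shows "integrable gauss (\<lambda>x. f x * cnj (g x))"
proof -
  note [measurable] = L2D(1)[OF f] L2D(1)[OF g]
  have [measurable]: "(\<lambda>x. cnj (g x)) \<in> borel_measurable gauss"
    by (rule borel_measurable_continuous_on[OF _ L2D(1)[OF g]]) (intro continuous_intros)
  have i: "integrable gauss (\<lambda>x. (norm (f x))\<^sup>2 + (norm (g x))\<^sup>2)"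
    by (intro Bochner_Integration.integrable_add L2D f g)
  have b: "norm (f x * cnj (g x)) \<le> (norm (f x))\<^sup>2 + (norm (g x))\<^sup>2" for x
  proof -
    have "2 * (norm (f x) * norm (g x)) \<le> (norm (f x))\<^sup>2 + (norm (g x))\<^sup>2"
      using zero_le_power2[of "norm (f x) - norm (g x)"] by (simp add: power2_eq_square algebra_simps)
    moreover have "0 \<le> norm (f x) * norm (g x)" by simp
    ultimately show ?thesis unfolding norm_mult complex_mod_cnj by linarith
  qed
  show ?thesis
    by (rule Bochner_Integration.integrable_bound[OF i]) (use b in auto)
qed

text \<open>
  A weighted form of the Cauchy-Schwarz inequality; the free parameter replaces the product of the norms.
\<close>

lemma L2_inner_bound:
  assumes f: "f \<in> L2" and g: "g \<in> L2" and e: "e > 0"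
  shows "norm (L2_inner f g) \<le> (L2_norm f)\<^sup>2 / e + e * (L2_norm g)\<^sup>2"
proof -
  have b: "norm (f x * cnj (g x)) \<le> (norm (f x))\<^sup>2 / e + e * (norm (g x))\<^sup>2" for x
  proof -
    have "2 * (norm (f x) * norm (g x)) \<le> (norm (f x))\<^sup>2 / e + e * (norm (g x))\<^sup>2"
    proof -
      have "(norm (f x) / sqrt e - sqrt e * norm (g x))\<^sup>2 \<ge> 0" by simp
      thus ?thesis using e by (simp add: power2_diff power_divide power_mult_distrib)
    qed
    moreover have "0 \<le> norm (f x) * norm (g x)" by simp
    ultimately show ?thesis unfolding norm_mult complex_mod_cnj by linarith
  qed
  have i: "integrable gauss (\<lambda>x. (norm (f x))\<^sup>2 / e + e * (norm (g x))\<^sup>2)"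
    by (intro Bochner_Integration.integrable_add integrable_mult_right integrable_divide L2D f g)
  have "norm (L2_inner f g) \<le> (LINT x|gauss. norm (f x * cnj (g x)))"
    unfolding L2_inner_def by (rule integral_norm_bound)
  also have "\<dots> \<le> (LINT x|gauss. (norm (f x))\<^sup>2 / e + e * (norm (g x))\<^sup>2)"
    by (rule integral_mono[OF integrable_norm[OF L2_inner_integrable[OF f g]] i]) (rule b)
  also have "\<dots> = (L2_norm f)\<^sup>2 / e + e * (L2_norm g)\<^sup>2"
    unfolding L2_norm_sq by (simp add: Bochner_Integration.integral_add L2D f g)
  finally show ?thesis .
qed

lemma L2_inner_self: "L2_inner f f = of_real ((L2_norm f)\<^sup>2)"
  unfolding L2_inner_def L2_norm_sq complex_norm_square[symmetric] by (rule integral_complex_of_real)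

lemma L2_norm_AE:
  assumes "f \<in> L2" "g \<in> L2" "AE x in gauss. f x = g x"
  shows "L2_norm f = L2_norm g"
proof -
  note [measurable] = L2D(1)[OF assms(1)] L2D(1)[OF assms(2)]
  have "(LINT x|gauss. (norm (f x))\<^sup>2) = (LINT x|gauss. (norm (g x))\<^sup>2)"
    by (rule integral_cong_AE) (use assms(3) in auto)
  thus ?thesis by (simp add: L2_norm_def)
qed

lemma L2_norm_zero_AE:
  assumes "f \<in> L2" "L2_norm f = 0"
  shows "AE x in gauss. f x = 0"
proof -
  have "(LINT x|gauss. (norm (f x))\<^sup>2) = 0" using L2_norm_sq[of f] assms(2) by simp
  hence "AE x in gauss. (norm (f x))\<^sup>2 = 0"
    using integral_nonneg_eq_0_iff_AE[OF L2D(2)[OF assms(1)]] by simp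
  thus ?thesis by simp
qed

lemma unitary_groupD:
  assumes "unitary_group U"
  shows "f \<in> L2 \<Longrightarrow> U t f \<in> L2"
    and "f \<in> L2 \<Longrightarrow> g \<in> L2 \<Longrightarrow> AE x in gauss. U t (\<lambda>y. f y - g y) x = U t f x - U t g x"
    and "f \<in> L2 \<Longrightarrow> L2_norm (U t f) = L2_norm f"
    and "f \<in> L2 \<Longrightarrow> AE x in gauss. U 0 f x = f x"
    and "f \<in> L2 \<Longrightarrow> AE x in gauss. U (s + t) f x = U s (U t f) x"
proof -
  show "f \<in> L2 \<Longrightarrow> U t f \<in> L2" and "f \<in> L2 \<Longrightarrow> AE x in gauss. U 0 f x = f x"
    and "f \<in> L2 \<Longrightarrow> AE x in gauss. U (s + t) f x = U s (U t f) x"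
    using assms unfolding unitary_group_def by blast+
  show "AE x in gauss. U t (\<lambda>y. f y - g y) x = U t f x - U t g x" if "f \<in> L2" "g \<in> L2"
  proof -
    have "AE x in gauss. U t (\<lambda>y. 1 * f y + (-1) * g y) x = 1 * U t f x + (-1) * U t g x"
      using assms that unfolding unitary_group_def by blast
    thus ?thesis by simp
  qed
  show "L2_norm (U t f) = L2_norm f" if "f \<in> L2"
  proof -
    have "L2_inner (U t f) (U t f) = L2_inner f f" using assms that unfolding unitary_group_def by blast
    hence "(L2_norm (U t f))\<^sup>2 = (L2_norm f)\<^sup>2" unfolding L2_inner_self of_real_eq_iff .
    thus ?thesis using L2_norm_nonneg by (metis power2_eq_iff_nonneg)
  qed
qed

lemma unitary_group_AE:
  fixes f g :: "real ^ 'n \<Rightarrow> complex"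
  assumes U: "unitary_group U" and f: "f \<in> L2" and g: "g \<in> L2" and ae: "AE x in gauss. f x = g x"
  shows "AE x in gauss. U t f x = U t g x"
proof -
  have d: "(\<lambda>y. f y - g y) \<in> L2" by (rule L2_diff[OF f g])
  have "L2_norm (\<lambda>y. f y - g y) = L2_norm (\<lambda>_ :: real ^ 'n. 0)"
    by (rule L2_norm_AE[OF d]) (use ae in \<open>auto simp: L2_def\<close>)
  hence "L2_norm (U t (\<lambda>y. f y - g y)) = 0"
    using unitary_groupD(3)[OF U d] by (simp add: L2_norm_def)
  from L2_norm_zero_AE[OF unitary_groupD(1)[OF U d] this] unitary_groupD(2)[OF U f g, of t]
  show ?thesis by eventually_elim simp
qed

text \<open>
  Let \<open>F s = U (-s) (v s)\<close>. By the group law and unitarity \<open>F (s + h) - F s\<close> has the same norm as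
  \<open>v (s + h) - U h (v s)\<close>. Both \<open>v (s + h)\<close> and \<open>U h (v s)\<close> start at \<open>v s\<close> with the same derivative
  \<open>i g\<close>, so this is \<open>o(h)\<close>. Hence the inner product of \<open>F\<close> with any fixed vector is constant; the vector
  \<open>F t - F 0\<close> itself shows that \<open>F t = F 0\<close>.
\<close>

lemma L2_solution_unique:
  fixes U :: "real \<Rightarrow> (real ^ 'n \<Rightarrow> complex) \<Rightarrow> real ^ 'n \<Rightarrow> complex"
  assumes OU: "OU_group U" and v: "L2_solution \<phi> v" and \<phi>: "\<phi> \<in> L2"
  shows "AE x in gauss. v t x = U t \<phi> x"
proof -
  have U: "unitary_group U" using OU by (simp add: OU_group_def)
  note UL2 = unitary_groupD(1)[OF U]
  have gen: "has_L2_derivative (\<lambda>t. U t f) (\<lambda>x. \<i> * g x) 0" if "OU f g" for f g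
    using OU that unfolding OU_group_def OU_def by blast
  have vL2: "v s \<in> L2" for s
    using v unfolding L2_solution_def OU_def by blast
  define F where "F s = U (- s) (v s)" for s
  have FL2: "F s \<in> L2" for s unfolding F_def by (intro UL2 vL2)
  have small: "((\<lambda>h. (L2_norm (\<lambda>x. (F (s + h) x - F s x) / of_real h))\<^sup>2) \<longlongrightarrow> 0) (at 0)" for s
  proof -
    obtain g where g: "OU (v s) g" "has_L2_derivative v (\<lambda>x. \<i> * g x) s"
      using v unfolding L2_solution_def by blast
    have gL2: "g \<in> L2" using g(1) by (simp add: OU_def)
    define A where "A h = (\<lambda>x. (v (s + h) x - v s x) / of_real h - \<i> * g x)" for h
    define B where "B h = (\<lambda>x. (U (0 + h) (v s) x - U 0 (v s) x) / of_real h - \<i> * g x)" for h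
    have dL2: "(\<lambda>x. (p x - q x) / of_real h) \<in> L2" if "p \<in> L2" "q \<in> L2" for p q :: "real ^ 'n \<Rightarrow> complex" and h
      using L2_cmult[OF L2_diff[OF that], of "inverse (of_real h)"] by (simp add: field_simps)
    have AL2: "A h \<in> L2" and BL2: "B h \<in> L2" for h
      unfolding A_def B_def by (intro L2_diff dL2 L2_cmult gL2 vL2 UL2)+
    have Alim: "((\<lambda>h. L2_norm (A h)) \<longlongrightarrow> 0) (at 0)"
      using g(2) unfolding has_L2_derivative_def A_def .
    have Blim: "((\<lambda>h. L2_norm (B h)) \<longlongrightarrow> 0) (at 0)"
      using gen[OF g(1)] unfolding has_L2_derivative_def B_def .
    have le: "(L2_norm (\<lambda>x. (F (s + h) x - F s x) / of_real h))\<^sup>2 \<le> 2 * (L2_norm (A h))\<^sup>2 + 2 * (L2_norm (B h))\<^sup>2" for h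
    proof -
      define W where "W = (\<lambda>y. v (s + h) y - U h (v s) y)"
      have UvL2: "U h (v s) \<in> L2" by (intro UL2 vL2)
      have WL2: "W \<in> L2" unfolding W_def by (intro L2_diff vL2 UvL2)
      have c: "(\<lambda>x. W x / of_real h) \<in> L2" using L2_cmult[OF WL2, of "inverse (of_real h)"] by (simp add: field_simps)
      have UW: "U (- (s + h)) W \<in> L2" by (intro UL2 WL2)
      have 1: "AE x in gauss. F (s + h) x - F s x = U (- (s + h)) W x"
        using unitary_groupD(2)[OF U vL2 UvL2, of "- (s + h)" "s + h"]
          unitary_groupD(5)[OF U vL2, of "- (s + h)" h s]
        unfolding W_def F_def by eventually_elim simp
      have "L2_norm (\<lambda>x. (F (s + h) x - F s x) / of_real h) = L2_norm (\<lambda>x. U (- (s + h)) W x / of_real h)"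
        by (rule L2_norm_AE) (use 1 L2_cmult[OF UW, of "inverse (of_real h)"] dL2[OF FL2 FL2] in \<open>auto simp: field_simps\<close>)
      also have "\<dots> = L2_norm (U (- (s + h)) W) / \<bar>h\<bar>"
        by (simp add: L2_norm_def norm_divide power_divide real_sqrt_divide)
      also have "\<dots> = L2_norm W / \<bar>h\<bar>" by (simp add: unitary_groupD(3)[OF U WL2])
      also have "\<dots> = L2_norm (\<lambda>x. W x / of_real h)"
        by (simp add: L2_norm_def norm_divide power_divide real_sqrt_divide)
      also have "\<dots> = L2_norm (\<lambda>x. A h x + (-1) * B h x)"
      proof (rule L2_norm_AE[OF c])
        show "(\<lambda>x. A h x + (-1) * B h x) \<in> L2" by (intro L2_add L2_cmult AL2 BL2)
        show "AE x in gauss. W x / of_real h = A h x + (-1) * B h x"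
          using unitary_groupD(4)[OF U vL2, of s]
          by eventually_elim (simp add: A_def B_def W_def diff_divide_distrib)
      qed
      finally have "(L2_norm (\<lambda>x. (F (s + h) x - F s x) / of_real h))\<^sup>2 = (L2_norm (\<lambda>x. A h x + (-1) * B h x))\<^sup>2" by simp
      also have "\<dots> \<le> 2 * (L2_norm (A h))\<^sup>2 + 2 * (L2_norm (\<lambda>x. (-1) * B h x))\<^sup>2"
        by (intro L2_add L2_cmult AL2 BL2)
      also have "L2_norm (\<lambda>x. (-1) * B h x) = L2_norm (B h)" by (simp add: L2_norm_def)
      finally show ?thesis .
    qed
    have lim: "((\<lambda>h. 2 * (L2_norm (A h))\<^sup>2 + 2 * (L2_norm (B h))\<^sup>2) \<longlongrightarrow> 0) (at 0)"
      using tendsto_add[OF tendsto_mult_left[OF tendsto_power[OF Alim, of 2], of 2] tendsto_mult_left[OF tendsto_power[OF Blim, of 2], of 2]]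
      by simp
    show ?thesis
      by (rule tendsto_sandwich[OF _ _ tendsto_const lim]) (auto simp: le)
  qed
  define \<xi> where "\<xi> = (\<lambda>x. F t x - F 0 x)"
  have \<xi>: "\<xi> \<in> L2" unfolding \<xi>_def by (intro L2_diff FL2)
  define p where "p s = L2_inner (F s) \<xi>" for s
  have inner_diff: "L2_inner (\<lambda>x. f x - g x) \<xi> = L2_inner f \<xi> - L2_inner g \<xi>" if "f \<in> L2" "g \<in> L2" for f g
    unfolding L2_inner_def
    by (simp add: left_diff_distrib Bochner_Integration.integral_diff L2_inner_integrable that \<xi>)
  have "(p has_vector_derivative 0) (at s)" for s
  proof -
    define D where "D h = (\<lambda>x. (F (s + h) x - F s x) / of_real h)" for h
    have DL2: "D h \<in> L2" for h
      unfolding D_def using L2_cmult[OF L2_diff[OF FL2 FL2], of "inverse (of_real h)"] by (simp add: field_simps)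
    have pD: "norm (p (s + h) - p s - h *\<^sub>R 0) / norm h = norm (L2_inner (D h) \<xi>)" for h
    proof -
      have "L2_inner (D h) \<xi> = (LINT x|gauss. (F (s + h) x - F s x) * cnj (\<xi> x) / of_real h)"
        unfolding L2_inner_def D_def by (simp add: field_simps)
      also have "\<dots> = L2_inner (\<lambda>x. F (s + h) x - F s x) \<xi> / of_real h"
        unfolding L2_inner_def by (rule integral_divide_zero)
      also have "\<dots> = (p (s + h) - p s) / of_real h" unfolding p_def inner_diff[OF FL2 FL2] ..
      finally show ?thesis by (simp add: norm_divide)
    qed
    have "((\<lambda>h. norm (L2_inner (D h) \<xi>)) \<longlongrightarrow> 0) (at 0)"
    proof (rule tendstoI)
      fix e :: real assume e: "e > 0"
      \<comment> \<open>This makes the fixed summand of \<open>L2_inner_bound\<close> at most \<open>e / 2\<close>.\<close>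
      define k where "k = e / (2 * ((L2_norm \<xi>)\<^sup>2 + 1))"
      have k: "k > 0" using e unfolding k_def by (simp add: add_nonneg_pos)
      have k2: "k * (L2_norm \<xi>)\<^sup>2 \<le> e / 2"
      proof -
        have "k * (L2_norm \<xi>)\<^sup>2 \<le> k * ((L2_norm \<xi>)\<^sup>2 + 1)" using k by (intro mult_left_mono) auto
        also have "\<dots> = e / 2"
        proof -
          have "(L2_norm \<xi>)\<^sup>2 + 1 \<noteq> 0" by (smt (verit) zero_le_power2)
          moreover have "e / (2 * q) * q = e / 2" if "q \<noteq> 0" for q :: real using that by simp
          ultimately show ?thesis unfolding k_def by blast
        qed
        finally show ?thesis .
      qed
      have "\<forall>\<^sub>F h in at 0. (L2_norm (D h))\<^sup>2 < k * (e / 2)"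
        using order_tendstoD(2)[OF small[of s], of "k * (e / 2)"] k e unfolding D_def by simp
      thus "\<forall>\<^sub>F h in at 0. dist (norm (L2_inner (D h) \<xi>)) 0 < e"
      proof eventually_elim
        case (elim h)
        have "(L2_norm (D h))\<^sup>2 / k < e / 2" using elim k by (simp add: pos_divide_less_eq mult.commute)
        with L2_inner_bound[OF DL2 \<xi> k, of h] k2 have "norm (L2_inner (D h) \<xi>) < e" by linarith
        thus ?case by simp
      qed
    qed
    thus ?thesis unfolding has_vector_derivative_def has_derivative_at pD by simp
  qed
  then obtain k where "\<And>s. s \<in> UNIV \<Longrightarrow> p s = k"
    by (rule has_vector_derivative_zero_constant[OF convex_UNIV]) blast
  hence "p t = p 0" by simp
  hence "L2_inner \<xi> \<xi> = 0"
    using inner_diff[OF FL2 FL2, of t 0] unfolding p_def \<xi>_def by simp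
  hence "L2_norm \<xi> = 0" unfolding L2_inner_self by simp
  from L2_norm_zero_AE[OF \<xi> this] have Ft: "AE x in gauss. F t x = F 0 x"
    unfolding \<xi>_def by simp
  have "AE x in gauss. F 0 x = \<phi> x"
    using unitary_groupD(4)[OF U vL2, of 0] v unfolding F_def L2_solution_def by auto
  with Ft have "AE x in gauss. F t x = \<phi> x" by eventually_elim simp
  from unitary_group_AE[OF U FL2 \<phi> this, of t]
    unitary_groupD(5)[OF U vL2, of t "- t" t] unitary_groupD(4)[OF U vL2, of t]
  show ?thesis unfolding F_def by eventually_elim simp
qed

section \<open>Functions of class K\<close>

text \<open>
  Smoothness with a bound on each derivative separately, so that the class is stable under partial derivatives by
  definition; \<open>K_space\<close> bounds the derivatives of a product instead.
\<close>

definition kclass :: "(real ^ 'n \<Rightarrow> complex) \<Rightarrow> bool" where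
  "kclass f \<longleftrightarrow> (\<forall>is. (\<forall>x. partials is f differentiable (at x)) \<and>
     (\<exists>C. \<forall>x. norm (partials is f x) \<le> C * (growth x * weight x)))"

text \<open>
  Generated from the derivatives of \<open>\<psi>\<close> by coordinates and linear combinations. All derivatives of
  \<open>exp(|x|\<^sup>2/4) \<psi>\<close> stay in this set after division by \<open>exp(|x|\<^sup>2/4)\<close>, which takes the place of a
  Leibniz formula.
\<close>

inductive schwartz_hull :: "(real ^ 'n \<Rightarrow> complex) \<Rightarrow> (real ^ 'n \<Rightarrow> complex) \<Rightarrow> bool" for \<psi> where
  schwartz_hull_partials: "schwartz_hull \<psi> (partials is \<psi>)"
| schwartz_hull_coord: "schwartz_hull \<psi> g \<Longrightarrow> schwartz_hull \<psi> (\<lambda>x. of_real (x $ i) * g x)"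
| schwartz_hull_cmult: "schwartz_hull \<psi> g \<Longrightarrow> schwartz_hull \<psi> (\<lambda>x. c * g x)"
| schwartz_hull_add: "schwartz_hull \<psi> g \<Longrightarrow> schwartz_hull \<psi> h \<Longrightarrow> schwartz_hull \<psi> (\<lambda>x. g x + h x)"

lemma schwartz_hull_props:
  assumes "\<psi> \<in> schwartz_space" "schwartz_hull \<psi> g"
  shows "(\<forall>x. g differentiable (at x)) \<and> (\<forall>k. \<exists>C. \<forall>x. norm x ^ k * norm (g x) \<le> C)
     \<and> (\<forall>i. schwartz_hull \<psi> (partial i g))"
  using assms(2)
proof induction
  case (schwartz_hull_partials "is")
  have "schwartz_hull \<psi> (partial i (partials is \<psi>))" for i
    using schwartz_hull.schwartz_hull_partials[of \<psi> "i # is"] by simp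
  moreover have "partials is \<psi> differentiable (at x)" for x
    using assms(1) by (simp add: schwartz_space_def smooth_def differentiable_on_def)
  moreover have "\<exists>C. \<forall>x. norm x ^ k * norm (partials is \<psi> x) \<le> C" for k
    using assms(1) by (simp add: schwartz_space_def)
  ultimately show ?case by blast
next
  case (schwartz_hull_coord g i)
  have gg: "has_gradient g (\<lambda>j. partial j g x) x" for x
    using schwartz_hull_coord.IH by (blast intro: has_gradient_partial)
  have G: "has_gradient (\<lambda>x. of_real (x $ i) * g x)
      (\<lambda>j. of_real (x $ i) * partial j g x + (if j = i then 1 else 0) * g x) x" for x
    by (rule has_gradient_mult[OF has_gradient_coord gg])
  have "partial j (\<lambda>x. of_real (x $ i) * g x)
      = (\<lambda>x. of_real (x $ i) * partial j g x + (if j = i then 1 else 0) * g x)" for j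
    by (rule ext) (rule partial_eqI[OF G])
  moreover have "schwartz_hull \<psi> (\<lambda>x. of_real (x $ i) * partial j g x + (if j = i then 1 else 0) * g x)" for j
    using schwartz_hull_coord by (intro schwartz_hull.intros) auto
  moreover have "\<exists>C. \<forall>x. norm x ^ k * norm (of_real (x $ i) * g x) \<le> C" for k
  proof -
    obtain C where C: "\<And>x. norm x ^ Suc k * norm (g x) \<le> C" using schwartz_hull_coord.IH by blast
    have "norm x ^ k * norm (of_real (x $ i) * g x) \<le> C" for x
    proof -
      have "norm x ^ k * norm (of_real (x $ i) * g x) \<le> norm x ^ k * (norm x * norm (g x))"
        using component_le_norm_cart[of x i]
        by (auto simp: norm_mult intro!: mult_left_mono mult_right_mono)
      also have "\<dots> \<le> C" using C[of x] by (simp add: mult_ac)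
      finally show ?thesis .
    qed
    thus ?thesis by blast
  qed
  ultimately show ?case using has_gradient_imp_differentiable[OF G] by auto
next
  case (schwartz_hull_cmult g c)
  have gg: "has_gradient g (\<lambda>j. partial j g x) x" for x
    using schwartz_hull_cmult.IH by (blast intro: has_gradient_partial)
  note G = has_gradient_cmult[OF gg, of c]
  have "partial j (\<lambda>x. c * g x) = (\<lambda>x. c * partial j g x)" for j
    by (rule ext) (rule partial_eqI[OF G])
  moreover have "schwartz_hull \<psi> (\<lambda>x. c * partial j g x)" for j
    using schwartz_hull_cmult by (intro schwartz_hull.intros) auto
  moreover have "\<exists>C. \<forall>x. norm x ^ k * norm (c * g x) \<le> C" for k
  proof -
    obtain C where C: "\<And>x. norm x ^ k * norm (g x) \<le> C" using schwartz_hull_cmult.IH by blast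
    have "norm x ^ k * norm (c * g x) \<le> norm c * C" for x
      using mult_left_mono[OF C[of x], of "norm c"] by (simp add: norm_mult mult_ac)
    thus ?thesis by blast
  qed
  ultimately show ?case using has_gradient_imp_differentiable[OF G] by auto
next
  case (schwartz_hull_add g h)
  have gg: "has_gradient g (\<lambda>j. partial j g x) x" for x
    using schwartz_hull_add.IH by (blast intro: has_gradient_partial)
  have hh: "has_gradient h (\<lambda>j. partial j h x) x" for x
    using schwartz_hull_add.IH by (blast intro: has_gradient_partial)
  note G = has_gradient_add[OF gg hh]
  have "partial j (\<lambda>x. g x + h x) = (\<lambda>x. partial j g x + partial j h x)" for j
    by (rule ext) (rule partial_eqI[OF G])
  moreover have "schwartz_hull \<psi> (\<lambda>x. partial j g x + partial j h x)" for j
    using schwartz_hull_add by (intro schwartz_hull.intros) auto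
  moreover have "\<exists>C. \<forall>x. norm x ^ k * norm (g x + h x) \<le> C" for k
  proof -
    obtain C where C: "\<And>x. norm x ^ k * norm (g x) \<le> C" using schwartz_hull_add.IH by blast
    obtain C' where C': "\<And>x. norm x ^ k * norm (h x) \<le> C'" using schwartz_hull_add.IH by blast
    have "norm x ^ k * norm (g x + h x) \<le> C + C'" for x
    proof -
      have "norm x ^ k * norm (g x + h x) \<le> norm x ^ k * (norm (g x) + norm (h x))"
        by (intro mult_left_mono norm_triangle_ineq) auto
      thus ?thesis using C[of x] C'[of x] by (simp add: distrib_left)
    qed
    thus ?thesis by blast
  qed
  ultimately show ?case using has_gradient_imp_differentiable[OF G] by auto
qed

text \<open>
  The reciprocal of the weight is at most \<open>(1 + |x|\<^sup>2)^d\<close> in dimension \<open>d\<close>, so two of the Schwartz bounds suffice.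
\<close>

lemma rapid_decrease_imp_weight:
  fixes g :: "real ^ 'n \<Rightarrow> complex"
  assumes "\<And>k. \<exists>C. \<forall>x. norm x ^ k * norm (g x) \<le> C"
  shows "\<exists>C. \<forall>x. norm (g x) \<le> C * weight x"
proof -
  let ?d = "CARD('n)"
  obtain C0 where C0: "\<And>x. norm x ^ 0 * norm (g x) \<le> C0" using assms by blast
  obtain C1 where C1: "\<And>x. norm x ^ (2 * ?d) * norm (g x) \<le> C1" using assms by blast
  have "norm (g x) \<le> 2 ^ ?d * (C0 + C1) * weight x" for x
  proof -
    have "1 / weight x = (\<Prod>i\<in>UNIV. 1 + (x $ i)\<^sup>2)"
      by (simp add: weight_def prod_dividef)
    also have "\<dots> \<le> (\<Prod>i\<in>(UNIV::'n set). 1 + (norm x)\<^sup>2)"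
    proof (rule prod_mono)
      fix i show "0 \<le> 1 + (x $ i)\<^sup>2 \<and> 1 + (x $ i)\<^sup>2 \<le> 1 + (norm x)\<^sup>2"
        using power_mono[OF component_le_norm_cart[of x i], of 2] by (simp add: add_nonneg_nonneg)
    qed
    also have "\<dots> = (1 + (norm x)\<^sup>2) ^ ?d" by simp
    also have "\<dots> \<le> (2 * max 1 ((norm x)\<^sup>2)) ^ ?d" by (intro power_mono) auto
    also have "\<dots> \<le> 2 ^ ?d * (1 + norm x ^ (2 * ?d))"
      unfolding power_mult_distrib by (intro mult_left_mono) (auto simp: max_def power_mult)
    finally have "1 / weight x * norm (g x) \<le> 2 ^ ?d * (1 + norm x ^ (2 * ?d)) * norm (g x)"
      by (rule mult_right_mono) simp
    also have "\<dots> = 2 ^ ?d * (norm x ^ 0 * norm (g x) + norm x ^ (2 * ?d) * norm (g x))"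
      by (simp add: algebra_simps)
    also have "\<dots> \<le> 2 ^ ?d * (C0 + C1)"
      using C0[of x] C1[of x] by (intro mult_left_mono add_mono) auto
    finally show ?thesis using weight_pos[of x] by (simp add: field_simps)
  qed
  thus ?thesis by blast
qed

text \<open>
  With \<open>e = exp(-|x|\<^sup>2/4)\<close> and \<open>f\<close> a derivative of \<open>\<phi>\<close>, the product rule gives
  \<open>e \<partial>\<^sub>i f = \<partial>\<^sub>i (e f) + x\<^sub>i / 2 (e f)\<close>. So by induction on the order every \<open>e f\<close> lies in the hull of
  \<open>e \<phi>\<close> and decays rapidly.
\<close>

lemma K_space_kclass:
  assumes "\<phi> \<in> K_space"
  shows "kclass \<phi>"
proof -
  define e where "e x = complex_of_real (exp (- (1 / 4) * (norm x)\<^sup>2))" for x :: "real ^ 'a"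
  define \<psi> where "\<psi> = (\<lambda>x. e x * \<phi> x)"
  have \<psi>: "\<psi> \<in> schwartz_space" and sm: "smooth \<phi>"
    using assms unfolding K_space_def \<psi>_def e_def by simp_all
  have diff: "partials is \<phi> differentiable (at x)" for "is" x
    using sm by (simp add: smooth_def differentiable_on_def)
  have sch: "schwartz_hull \<psi> (\<lambda>x. e x * partials is \<phi> x)" for "is"
  proof (induction "is")
    case Nil
    show ?case using schwartz_hull_partials[of \<psi> "[]"] by (simp add: \<psi>_def)
  next
    case (Cons i "is")
    define f where "f = partials is \<phi>"
    have G: "has_gradient (\<lambda>x. e x * f x) (\<lambda>j. e x * partial j f x + of_real (2 * - (1 / 4) * x $ j * exp (- (1 / 4) * (norm x)\<^sup>2)) * f x) x" for x
      unfolding e_def by (rule has_gradient_mult[OF has_gradient_exp_norm has_gradient_partial]) (simp add: f_def diff)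
    have "partial i (\<lambda>x. e x * f x) x = e x * partial i f x + of_real (2 * - (1 / 4) * x $ i * exp (- (1 / 4) * (norm x)\<^sup>2)) * f x" for x
      by (rule partial_eqI[OF G])
    hence "(\<lambda>x. e x * partial i f x) = (\<lambda>x. partial i (\<lambda>x. e x * f x) x + 1 / 2 * (of_real (x $ i) * (e x * f x)))"
      by (simp add: fun_eq_iff e_def)
    moreover have "schwartz_hull \<psi> (\<lambda>x. partial i (\<lambda>x. e x * f x) x + 1 / 2 * (of_real (x $ i) * (e x * f x)))"
      using Cons.IH schwartz_hull_props[OF \<psi> Cons.IH] unfolding f_def by (intro schwartz_hull_add schwartz_hull_cmult schwartz_hull_coord) auto
    ultimately show ?case by (simp add: f_def)
  qed
  have "\<exists>C. \<forall>x. norm (partials is \<phi> x) \<le> C * (growth x * weight x)" for "is"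
  proof -
    obtain C where C: "\<And>x. norm (e x * partials is \<phi> x) \<le> C * weight x"
      using rapid_decrease_imp_weight[of "\<lambda>x. e x * partials is \<phi> x"] schwartz_hull_props[OF \<psi> sch[of "is"]] by blast
    have "norm (partials is \<phi> x) \<le> C * (growth x * weight x)" for x
    proof -
      have "growth x * norm (e x) = 1"
        by (simp add: growth_def e_def norm_of_real flip: exp_add)
      hence "norm (partials is \<phi> x) = growth x * norm (e x * partials is \<phi> x)"
        by (simp add: norm_mult mult.assoc[symmetric])
      also have "\<dots> \<le> growth x * (C * weight x)" by (intro mult_left_mono C) (simp add: growth_def)
      finally show ?thesis by (simp add: mult_ac)
    qed
    thus ?thesis by blast
  qed
  thus ?thesis using diff by (simp add: kclass_def)
qed

lemma partials_append: "partials is (partial i f) = partials (is @ [i]) f"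
  by (induction "is") auto

lemma kclass_partial: "kclass f \<Longrightarrow> kclass (partial i f)"
  unfolding kclass_def partials_append by blast

lemma kclassD:
  assumes "kclass f"
  shows "has_gradient f (\<lambda>i. partial i f x) x" "\<exists>C. \<forall>x. norm (f x) \<le> C * (growth x * weight x)" "continuous_on UNIV f"
proof -
  have d: "f differentiable (at x)" for x using assms unfolding kclass_def by (metis partials.simps(1))
  thus "has_gradient f (\<lambda>i. partial i f x) x" by (rule has_gradient_partial)
  show "\<exists>C. \<forall>x. norm (f x) \<le> C * (growth x * weight x)" using assms unfolding kclass_def by (metis partials.simps(1))
  show "continuous_on UNIV f"
    using d by (intro differentiable_imp_continuous_on) (simp add: differentiable_on_def)
qed

section \<open>Integration by parts\<close>

lemma integral_translate:
  fixes G :: "real ^ 'n \<Rightarrow> complex"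
  assumes "continuous_on UNIV G"
  shows "(LINT x|lborel. G (x + v)) = (LINT x|lborel. G x)"
    and "integrable lborel G \<Longrightarrow> integrable lborel (\<lambda>x. G (x + v))"
proof -
  have [measurable]: "G \<in> borel_measurable borel" by (rule borel_measurable_continuous_onI[OF assms])
  have l: "lborel = distr lborel borel ((+) v)" by (rule lborel_distr_plus[symmetric])
  have "(LINT x|lborel. G x) = (LINT x|distr lborel borel ((+) v). G x)" by (subst l) (rule refl)
  also have "\<dots> = (LINT x|lborel. G (v + x))" by (rule integral_distr) auto
  finally show "(LINT x|lborel. G (x + v)) = (LINT x|lborel. G x)" by (simp add: add.commute)
  assume "integrable lborel G"
  hence "integrable (distr lborel borel ((+) v)) G" by (subst l[symmetric])
  hence "integrable lborel (\<lambda>x. G (v + x))" by (subst (asm) integrable_distr_eq) auto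
  thus "integrable lborel (\<lambda>x. G (x + v))" by (simp add: add.commute)
qed

text \<open>
  The weight is comparable at points of distance at most 1 along an axis; this provides the dominating function for
  difference quotients.
\<close>

lemma weight_shift:
  fixes x :: "real ^ 'n"
  assumes "\<bar>s\<bar> \<le> 1"
  shows "weight (x + s *\<^sub>R axis i 1) \<le> 3 * weight x"
proof -
  define P where "P = (\<Prod>j\<in>UNIV - {i}. 1 / (1 + (x $ j)\<^sup>2))"
  have P: "P \<ge> 0" unfolding P_def by (intro prod_nonneg) auto
  have 1: "weight x = 1 / (1 + (x $ i)\<^sup>2) * P"
    unfolding weight_def P_def by (rule prod.remove) auto
  have 2: "weight (x + s *\<^sub>R axis i 1) = 1 / (1 + (x $ i + s)\<^sup>2) * P"
  proof -
    have "weight (x + s *\<^sub>R axis i 1) = 1 / (1 + ((x + s *\<^sub>R axis i 1) $ i)\<^sup>2) *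
        (\<Prod>j\<in>UNIV - {i}. 1 / (1 + ((x + s *\<^sub>R axis i 1) $ j)\<^sup>2))"
      unfolding weight_def by (rule prod.remove) auto
    also have "(\<Prod>j\<in>UNIV - {i}. 1 / (1 + ((x + s *\<^sub>R axis i 1) $ j)\<^sup>2)) = P"
      unfolding P_def by (rule prod.cong) (auto simp: axis_def)
    finally show ?thesis by (simp add: axis_def)
  qed
  have "1 + (x $ i)\<^sup>2 \<le> 3 * (1 + (x $ i + s)\<^sup>2)"
  proof -
    have "s\<^sup>2 \<le> 1" using assms by (simp add: abs_square_le_1)
    moreover have "(x $ i + 2 * s)\<^sup>2 \<ge> 0" "(x $ i + s)\<^sup>2 \<ge> 0" by simp_all
    ultimately show ?thesis by (simp add: power2_eq_square algebra_simps)
  qed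
  hence "1 / (1 + (x $ i + s)\<^sup>2) \<le> 3 * (1 / (1 + (x $ i)\<^sup>2))"
    by (simp add: divide_simps add_pos_nonneg)
  from mult_right_mono[OF this P] show ?thesis unfolding 1 2 by simp
qed

text \<open>
  The integral of a difference quotient of \<open>G\<close> vanishes by translation invariance, and the quotients converge to the
  partial derivative, dominated by a multiple of the weight through the mean value inequality.
\<close>

lemma integral_partial_zero:
  fixes G :: "real ^ 'n \<Rightarrow> complex"
  assumes grad: "\<And>x. has_gradient G (\<lambda>i. D i x) x"
    and contD: "continuous_on UNIV (D i)"
    and bG: "\<And>x. norm (G x) \<le> K * weight x" and bD: "\<And>x. norm (D i x) \<le> K * weight x"
  shows "(LINT x|lborel. D i x) = 0"
proof -
  have contG: "continuous_on UNIV G"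
    using has_gradient_imp_differentiable[OF grad]
    by (intro differentiable_imp_continuous_on) (simp add: differentiable_on_def)
  have [measurable]: "G \<in> borel_measurable borel" "D i \<in> borel_measurable borel"
    by (rule borel_measurable_continuous_onI, fact)+
  have K: "K \<ge> 0" using order_trans[OF norm_ge_zero bG[of 0]] weight_pos[of "0 :: real ^ 'n"]
    by (simp add: zero_le_mult_iff)
  have intG: "integrable lborel G"
    by (rule Bochner_Integration.integrable_bound[OF integrable_mult_right[OF integrable_weight, of K]])
      (use bG K in \<open>auto simp: abs_mult abs_of_pos[OF weight_pos]\<close>)
  have vd: "((\<lambda>s. G (x + s *\<^sub>R axis i 1)) has_vector_derivative D i (x + s *\<^sub>R axis i 1)) (at s)" for x s
  proof -
    have "((\<lambda>s. x + s *\<^sub>R axis i 1) has_derivative (\<lambda>h. h *\<^sub>R axis i 1)) (at s)"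
      by (auto intro!: derivative_eq_intros)
    from has_derivative_compose[OF this grad[of "x + s *\<^sub>R axis i 1", unfolded has_gradient_def]]
    moreover have "(\<Sum>j\<in>UNIV. of_real ((h *\<^sub>R axis i 1) $ j) * D j y) = h *\<^sub>R D i y" for h y
    proof -
      have "of_real ((h *\<^sub>R axis i 1) $ j) * D j y = (if j = i then h *\<^sub>R D j y else 0)" for j
      proof -
        have "(h *\<^sub>R axis i 1 :: real ^ 'n) $ j = (if j = i then h else 0)" by (simp add: axis_def)
        thus ?thesis by (simp add: scaleR_conv_of_real)
      qed
      thus ?thesis by simp
    qed
    ultimately show ?thesis unfolding has_vector_derivative_def by simp
  qed
  define q where "q n x = real (Suc n) *\<^sub>R (G (x + (1 / real (Suc n)) *\<^sub>R axis i 1) - G x)" for n x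
  have int0: "(LINT x|lborel. q n x) = 0" for n
    unfolding q_def using integral_translate[OF contG] intG
    by (simp add: Bochner_Integration.integral_diff)
  have qb: "norm (q n x) \<le> 3 * K * weight x" for n x
  proof -
    define r where "r = 1 / real (Suc n)"
    have r: "0 < r" "r \<le> 1" by (simp_all add: r_def)
    have "norm (G (x + r *\<^sub>R axis i 1) - G (x + 0 *\<^sub>R axis i 1)) \<le> (3 * K * weight x) * norm (r - 0)"
    proof (rule differentiable_bound[where S = "{0..1}" and f = "\<lambda>s. G (x + s *\<^sub>R axis i 1)"])
      fix s :: real assume s: "s \<in> {0..1}"
      show "((\<lambda>s. G (x + s *\<^sub>R axis i 1)) has_derivative (\<lambda>d. d *\<^sub>R D i (x + s *\<^sub>R axis i 1))) (at s within {0..1})"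
        using vd[of x s] unfolding has_vector_derivative_def by (rule has_derivative_at_withinI)
      have "norm (D i (x + s *\<^sub>R axis i 1)) \<le> K * weight (x + s *\<^sub>R axis i 1)" by (rule bD)
      also have "\<dots> \<le> K * (3 * weight x)" using s by (intro mult_left_mono weight_shift K) auto
      finally show "onorm (\<lambda>d. d *\<^sub>R D i (x + s *\<^sub>R axis i 1)) \<le> 3 * K * weight x"
        by (intro onorm_le) (auto simp: mult.commute[of "\<bar>_\<bar>"] intro!: mult_right_mono)
    qed (use r in auto)
    hence "r * norm (q n x) \<le> r * (3 * K * weight x)"
      using r unfolding q_def r_def[symmetric] by (simp add: r_def mult_ac)
    thus ?thesis using r by simp
  qed
  have lim: "(\<lambda>n. q n x) \<longlonglongrightarrow> D i x" for x
  proof -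
    have "((\<lambda>h. (1 / h) *\<^sub>R (G (x + h *\<^sub>R axis i 1) - G x)) \<longlongrightarrow> D i x) (at 0)"
    proof (rule LIM_zero_cancel, rule tendsto_norm_zero_cancel, rule Lim_transform_eventually)
      show "((\<lambda>h. norm (G (x + (0 + h) *\<^sub>R axis i 1) - G (x + 0 *\<^sub>R axis i 1)
          - h *\<^sub>R D i (x + 0 *\<^sub>R axis i 1)) / norm h) \<longlongrightarrow> 0) (at 0)"
        using vd[of x 0] unfolding has_vector_derivative_def has_derivative_at by blast
      have "norm (a - h *\<^sub>R v) / norm h = norm ((1 / h) *\<^sub>R a - v)" if "h \<noteq> 0" for h :: real and a v :: complex
      proof -
        have "(1 / h) *\<^sub>R a - v = (1 / h) *\<^sub>R (a - h *\<^sub>R v)" using that by (simp add: scaleR_diff_right)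
        thus ?thesis by (simp add: divide_inverse)
      qed
      thus "\<forall>\<^sub>F h in at 0. norm (G (x + (0 + h) *\<^sub>R axis i 1) - G (x + 0 *\<^sub>R axis i 1)
          - h *\<^sub>R D i (x + 0 *\<^sub>R axis i 1)) / norm h
          = norm ((1 / h) *\<^sub>R (G (x + h *\<^sub>R axis i 1) - G x) - D i x)"
        by (simp add: eventually_at_filter)
    qed
    hence "((\<lambda>n. (1 / (1 / real (Suc n))) *\<^sub>R (G (x + (1 / real (Suc n)) *\<^sub>R axis i 1) - G x)) \<longlonglongrightarrow> D i x)"
    proof (rule filterlim_compose)
      show "filterlim (\<lambda>n. 1 / real (Suc n)) (at 0) sequentially"
        by (rule filterlim_atI[OF LIMSEQ_Suc[OF lim_1_over_n]]) simp
    qed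
    thus ?thesis by (simp add: q_def[abs_def])
  qed
  have "(\<lambda>n. LINT x|lborel. q n x) \<longlonglongrightarrow> (LINT x|lborel. D i x)"
  proof (rule integral_dominated_convergence[where w = "\<lambda>x. 3 * K * weight x"])
    show "integrable lborel (\<lambda>x. 3 * K * weight (x :: real ^ 'n))" by (intro integrable_mult_right integrable_weight)
    show "(\<lambda>x. q n x) \<in> borel_measurable lborel" for n unfolding q_def by measurable
  qed (auto simp: lim qb)
  thus ?thesis using LIMSEQ_unique[OF _ tendsto_const] unfolding int0 by blast
qed

lemma rho_growth_bound:
  fixes x :: "real ^ 'n" and a b :: complex
  assumes "norm a \<le> A * (growth x * weight x)" "norm b \<le> B * (growth x * weight x)"
  shows "norm (a * b * of_real (rho x)) \<le> (2 * pi) powr (- real CARD('n) / 2) * A * B * weight x"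
proof -
  have A: "A * (growth x * weight x) \<ge> 0" and B: "B * (growth x * weight x) \<ge> 0"
    using assms norm_ge_zero order_trans by blast+
  have p: "growth x * weight x > 0" by (intro mult_pos_pos growth_pos weight_pos)
  have A0: "A \<ge> 0" using A p by (simp only: zero_le_mult_iff) linarith
  have B0: "B \<ge> 0" using B p by (simp only: zero_le_mult_iff) linarith
  have "norm (a * b * of_real (rho x)) \<le> (A * (growth x * weight x)) * (B * (growth x * weight x)) * rho x"
    unfolding norm_mult using assms A mult_nonneg_nonneg[OF A B] rho_pos[of x] by (intro mult_mono) auto
  also have "\<dots> = (rho x * (growth x)\<^sup>2) * A * B * weight x * weight x" by (simp add: power2_eq_square mult_ac)
  also have "\<dots> \<le> (rho x * (growth x)\<^sup>2) * A * B * weight x * 1"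
    using A0 B0 weight_pos[of x] weight_le_1[of x] rho_pos[of x] by (intro mult_left_mono mult_nonneg_nonneg) auto
  finally show ?thesis unfolding rho_growth by simp
qed

lemma continuous_on_rho: "continuous_on S (\<lambda>x. complex_of_real (rho x))"
  unfolding rho_def by (intro continuous_intros) auto

text \<open>
  The inner product of \<open>f\<close> with a Hermite polynomial, written as an integral over Lebesgue measure.
\<close>

definition pairing :: "(real ^ 'n \<Rightarrow> complex) \<Rightarrow> ('n \<Rightarrow> nat) \<Rightarrow> complex" where
  "pairing f \<alpha> = (LINT x|lborel. f x * hermite \<alpha> x * of_real (rho x))"

lemma integrable_weighted:
  fixes f :: "real ^ 'n \<Rightarrow> complex"
  assumes "continuous_on UNIV f" "\<And>x. norm (f x) \<le> K * weight x"
  shows "integrable lborel f" "norm (LINT x|lborel. f x) \<le> K * (LINT x|lborel. weight (x :: real ^ 'n))"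
proof -
  have K: "K \<ge> 0" using order_trans[OF norm_ge_zero assms(2)[of 0]] weight_pos[of "0 :: real ^ 'n"]
    by (simp add: zero_le_mult_iff)
  have [measurable]: "f \<in> borel_measurable borel" by (rule borel_measurable_continuous_onI[OF assms(1)])
  show i: "integrable lborel f"
    by (rule Bochner_Integration.integrable_bound[OF integrable_mult_right[OF integrable_weight, of K]])
      (use assms(2) K in \<open>auto simp: abs_mult abs_of_pos[OF weight_pos]\<close>)
  have "norm (LINT x|lborel. f x) \<le> (LINT x|lborel. norm (f x))" by (rule integral_norm_bound)
  also have "\<dots> \<le> (LINT x|lborel. K * weight (x :: real ^ 'n))"
    by (rule integral_mono[OF integrable_norm[OF i] integrable_mult_right[OF integrable_weight]]) (rule assms(2))
  finally show "norm (LINT x|lborel. f x) \<le> K * (LINT x|lborel. weight (x :: real ^ 'n))" by simp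
qed

lemma kclass_pairing:
  fixes f :: "real ^ 'n \<Rightarrow> complex"
  assumes "kclass f"
  shows "integrable lborel (\<lambda>x. f x * hermite \<alpha> x * of_real (rho x))"
    and "\<exists>C\<ge>0. \<forall>\<alpha>. norm (pairing f \<alpha>) \<le> C * (sfact \<alpha> * qprod \<alpha> ^ 2)"
proof -
  obtain C where C: "\<And>x. norm (f x) \<le> C * (growth x * weight x)" using kclassD(2)[OF assms] by blast
  have cont: "continuous_on UNIV (\<lambda>x. f x * hermite \<alpha> x * of_real (rho x))" for \<alpha>
    by (intro continuous_intros kclassD(3)[OF assms] continuous_hermite continuous_on_rho)
  note b = rho_growth_bound[OF C hermite_bound]
  show "integrable lborel (\<lambda>x. f x * hermite \<alpha> x * of_real (rho x))"
    by (rule integrable_weighted(1)[OF cont b])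
  define K where "K = (2 * pi) powr (- real CARD('n) / 2) * C * hconst TYPE('n) * (LINT x|lborel. weight (x :: real ^ 'n))"
  have le: "norm (pairing f \<alpha>) \<le> K * (sfact \<alpha> * qprod \<alpha> ^ 2)" for \<alpha>
    using integrable_weighted(2)[OF cont b] unfolding pairing_def K_def by (simp add: mult_ac)
  have "K \<ge> 0" using order_trans[OF norm_ge_zero le[of "\<lambda>_. 0"]] by (simp add: sfact_def qprod_def)
  with le show "\<exists>C\<ge>0. \<forall>\<alpha>. norm (pairing f \<alpha>) \<le> C * (sfact \<alpha> * qprod \<alpha> ^ 2)" by blast
qed

text \<open>
  The raising operator \<open>x\<^sub>i - \<partial>\<^sub>i\<close> is the adjoint of \<open>\<partial>\<^sub>i\<close> for the Gaussian measure; this is what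
  integration by parts turns into \<open>pairing_step\<close>.
\<close>

lemma hermite_raise:
  assumes "\<alpha> i > 0"
  shows "hermite \<alpha> x = of_real (x $ i) * hermite (lower \<alpha> i) x - hermiteD i (lower \<alpha> i) x"
proof -
  obtain m where m: "\<alpha> i = Suc m" using assms by (cases "\<alpha> i") auto
  show ?thesis
    unfolding hermiteD_def lower_def fun_upd_upd hermite_upd fun_upd_same m
    by (subst hermite_split[of \<alpha> x i]) (simp add: m herm_Suc algebra_simps)
qed

text \<open>
  The difference of the two integrands is the partial derivative of the product of \<open>f\<close>, the lowered Hermite
  polynomial and the Gaussian density, and its integral vanishes.
\<close>

lemma pairing_step:
  fixes f :: "real ^ 'n \<Rightarrow> complex"
  assumes f: "kclass f" and i: "\<alpha> i > 0"
  shows "pairing f \<alpha> = pairing (partial i f) (lower \<alpha> i)"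
proof -
  let ?H = "hermite (lower \<alpha> i)"
  define D where "D j x = (f x * ?H x) * of_real (2 * (- (1 / 2)) * x $ j * exp (- (1 / 2) * (norm x)\<^sup>2))
      + (f x * hermiteD j (lower \<alpha> i) x + partial j f x * ?H x) * of_real (exp (- (1 / 2) * (norm x)\<^sup>2))" for j x
  define k where "k = complex_of_real ((2 * pi) powr (- real CARD('n) / 2))"
  have rho: "complex_of_real (rho x) = k * of_real (exp (- (1 / 2) * (norm x)\<^sup>2))" for x :: "real ^ 'n"
    by (simp add: rho_def k_def)
  have grad: "has_gradient (\<lambda>x. k * (f x * ?H x * of_real (exp (- (1 / 2) * (norm x)\<^sup>2)))) (\<lambda>j. k * D j x) x" for x
    unfolding D_def
    by (intro has_gradient_cmult has_gradient_mult has_gradient_exp_norm hermite_gradient kclassD(1) f)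
  have eq: "k * D i x = partial i f x * ?H x * of_real (rho x) - f x * hermite \<alpha> x * of_real (rho x)" for x
    unfolding rho hermite_raise[where \<alpha> = \<alpha> and i = i, OF i] D_def by (simp add: algebra_simps)
  note pf = kclass_partial[OF f, of i]
  obtain C where C: "\<And>x. norm (f x) \<le> C * (growth x * weight x)" using kclassD(2)[OF f] by blast
  obtain C' where C': "\<And>x. norm (partial i f x) \<le> C' * (growth x * weight x)" using kclassD(2)[OF pf] by blast
  obtain K1 where K1: "\<And>x. norm (partial i f x * ?H x * of_real (rho x)) \<le> K1 * weight x"
    using rho_growth_bound[OF C' hermite_bound] by blast
  obtain K2 where K2: "\<And>x. norm (f x * hermite \<alpha> x * of_real (rho x)) \<le> K2 * weight x"
    using rho_growth_bound[OF C hermite_bound] by blast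
  obtain K3 where K3: "\<And>x. norm (f x * ?H x * of_real (rho x)) \<le> K3 * weight x"
    using rho_growth_bound[OF C hermite_bound] by blast
  have "(LINT x|lborel. k * D i x) = 0"
  proof (rule integral_partial_zero[where D = "\<lambda>j x. k * D j x", OF grad])
    show "continuous_on UNIV (\<lambda>x. k * D i x)"
      unfolding eq by (intro continuous_intros kclassD(3) f pf continuous_hermite continuous_on_rho)
    show "norm (k * (f x * ?H x * of_real (exp (- (1 / 2) * (norm x)\<^sup>2)))) \<le> (K1 + K2 + \<bar>K3\<bar>) * weight x" for x
    proof -
      have "K1 * weight x \<ge> 0" "K2 * weight x \<ge> 0"
        using order_trans[OF norm_ge_zero K1] order_trans[OF norm_ge_zero K2] by blast+
      moreover have "K3 * weight x \<le> \<bar>K3\<bar> * weight x" using weight_pos[of x] by (intro mult_right_mono) auto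
      moreover have e: "k * (f x * ?H x * of_real (exp (- (1 / 2) * (norm x)\<^sup>2))) = f x * ?H x * of_real (rho x)"
        unfolding rho by (simp add: mult_ac)
      ultimately show ?thesis unfolding e using K3[of x] by (simp add: distrib_right)
    qed
    show "norm (k * D i x) \<le> (K1 + K2 + \<bar>K3\<bar>) * weight x" for x
    proof -
      have "norm (k * D i x) \<le> K1 * weight x + K2 * weight x"
        unfolding eq by (rule order_trans[OF norm_triangle_ineq4 add_mono[OF K1 K2]])
      moreover have "0 \<le> \<bar>K3\<bar> * weight x" using weight_pos[of x] by simp
      ultimately show ?thesis by (simp add: distrib_right)
    qed
  qed
  thus ?thesis unfolding eq pairing_def
    by (subst (asm) Bochner_Integration.integral_diff) (auto intro: kclass_pairing(1) f pf)
qed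

section \<open>Decay of the Hermite coefficients\<close>

text \<open>
  One factor is gained per list entry: \<open>pairing_step\<close> replaces \<open>\<alpha>\<close> by \<open>lower \<alpha> i\<close>, and
  \<open>sfact (lower \<alpha> i)\<close> is smaller than \<open>sfact \<alpha>\<close> by the factor \<open>\<surd>\<alpha>\<^sub>i\<close>. For \<open>\<alpha> i = 0\<close>
  the factor is 1 and nothing has to be gained. The list records the directions, so repeating all directions
  gives any power of \<open>qprod\<close>.
\<close>

lemma pairing_decay_list:
  fixes f :: "real ^ 'n \<Rightarrow> complex" and xs :: "'n list"
  assumes "kclass f"
  shows "\<exists>C\<ge>0. \<forall>\<alpha>. norm (pairing f \<alpha>) * (\<Prod>i\<leftarrow>xs. sqrt (real (\<alpha> i) + 1)) \<le> C * (sfact \<alpha> * qprod \<alpha> ^ 2)"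
  using assms
proof (induction xs arbitrary: f)
  case Nil
  then show ?case using kclass_pairing(2)[OF Nil] by simp
next
  case (Cons i xs)
  define P where "P \<alpha> = (\<Prod>i\<leftarrow>xs. sqrt (real (\<alpha> i) + 1))" for \<alpha> :: "'n \<Rightarrow> nat"
  have P_nonneg: "P \<alpha> \<ge> 0" for \<alpha> unfolding P_def by (intro prod_list_nonneg) auto
  have P_lower: "P \<alpha> \<le> 2 ^ length xs * P (lower \<alpha> i)" for \<alpha>
    unfolding P_def
  proof (induction xs)
    case (Cons j ys)
    have "sqrt (real (\<alpha> j) + 1) \<le> sqrt (4 * (real (lower \<alpha> i j) + 1))"
      by (intro real_sqrt_le_mono) (auto simp: lower_def)
    also have "\<dots> = 2 * sqrt (real (lower \<alpha> i j) + 1)" unfolding real_sqrt_mult by simp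
    finally have 1: "sqrt (real (\<alpha> j) + 1) \<le> 2 * sqrt (real (lower \<alpha> i j) + 1)" .
    have "(\<Prod>i\<leftarrow>ys. sqrt (real (\<alpha> i) + 1)) \<ge> 0" by (intro prod_list_nonneg) auto
    from mult_mono[OF 1 Cons.IH _ this] show ?case by (simp add: mult_ac)
  qed simp
  obtain C where C: "C \<ge> 0" "\<And>\<alpha>. norm (pairing f \<alpha>) * P \<alpha> \<le> C * (sfact \<alpha> * qprod \<alpha> ^ 2)"
    using Cons.IH[OF Cons.prems] unfolding P_def by blast
  obtain C' where C': "C' \<ge> 0" "\<And>\<alpha>. norm (pairing (partial i f) \<alpha>) * P \<alpha> \<le> C' * (sfact \<alpha> * qprod \<alpha> ^ 2)"
    using Cons.IH[OF kclass_partial[OF Cons.prems, of i]] unfolding P_def by blast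
  define K where "K = C + 2 * 2 ^ length xs * C'"
  have "norm (pairing f \<alpha>) * (sqrt (real (\<alpha> i) + 1) * P \<alpha>) \<le> K * (sfact \<alpha> * qprod \<alpha> ^ 2)" for \<alpha>
  proof (cases "\<alpha> i = 0")
    case True
    have "norm (pairing f \<alpha>) * (sqrt (real (\<alpha> i) + 1) * P \<alpha>) \<le> C * (sfact \<alpha> * qprod \<alpha> ^ 2)"
      using C(2)[of \<alpha>] True by simp
    also have "\<dots> \<le> K * (sfact \<alpha> * qprod \<alpha> ^ 2)"
      using C' sfact_pos[of \<alpha>] unfolding K_def by (intro mult_right_mono) auto
    finally show ?thesis .
  next
    case False
    hence a: "\<alpha> i > 0" by simp
    define \<beta> where "\<beta> = lower \<alpha> i"
    have sfact: "sfact \<alpha> = sqrt (real (\<alpha> i)) * sfact \<beta>"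
    proof -
      obtain m where m: "\<alpha> i = Suc m" using a by (cases "\<alpha> i") auto
      have "sfact \<alpha> = sqrt (fact (\<alpha> i)) * (\<Prod>j\<in>UNIV - {i}. sqrt (fact (\<alpha> j)))"
        unfolding sfact_def by (rule prod.remove) auto
      moreover have "sfact \<beta> = sqrt (fact (\<beta> i)) * (\<Prod>j\<in>UNIV - {i}. sqrt (fact (\<beta> j)))"
        unfolding sfact_def by (rule prod.remove) auto
      moreover have "(\<Prod>j\<in>UNIV - {i}. sqrt (fact (\<beta> j))) = (\<Prod>j\<in>UNIV - {i}. sqrt (fact (\<alpha> j)))"
        by (rule prod.cong) (auto simp: \<beta>_def lower_def)
      moreover have "sqrt (fact (\<alpha> i)) = sqrt (real (\<alpha> i)) * sqrt (fact (\<beta> i))"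
        by (simp add: \<beta>_def lower_def m real_sqrt_mult del: of_nat_Suc)
      ultimately show ?thesis by simp
    qed
    have s: "sqrt (real (\<alpha> i) + 1) \<le> 2 * sqrt (real (\<alpha> i))"
    proof -
      have "sqrt (real (\<alpha> i) + 1) \<le> sqrt (4 * real (\<alpha> i))" using a by (intro real_sqrt_le_mono) auto
      thus ?thesis by (simp add: real_sqrt_mult)
    qed
    have "norm (pairing f \<alpha>) * (sqrt (real (\<alpha> i) + 1) * P \<alpha>)
        \<le> norm (pairing (partial i f) \<beta>) * ((2 * sqrt (real (\<alpha> i))) * (2 ^ length xs * P \<beta>))"
      unfolding pairing_step[where \<alpha> = \<alpha> and i = i, OF Cons.prems a] \<beta>_def[symmetric]
      using s P_lower[of \<alpha>] P_nonneg unfolding \<beta>_def[symmetric]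
      by (intro mult_left_mono mult_mono) auto
    also have "\<dots> = (2 * 2 ^ length xs * sqrt (real (\<alpha> i))) * (norm (pairing (partial i f) \<beta>) * P \<beta>)"
      by (simp add: mult_ac)
    also have "\<dots> \<le> (2 * 2 ^ length xs * sqrt (real (\<alpha> i))) * (C' * (sfact \<beta> * qprod \<beta> ^ 2))"
      by (intro mult_left_mono C') auto
    also have "\<dots> = 2 * 2 ^ length xs * C' * (sfact \<alpha> * qprod \<beta> ^ 2)" by (simp add: sfact mult_ac)
    also have "\<dots> \<le> K * (sfact \<alpha> * qprod \<alpha> ^ 2)"
      unfolding K_def \<beta>_def using C C' sfact_pos[of \<alpha>] qprod_pos[of "lower \<alpha> i"]
      by (intro mult_mono mult_left_mono power_mono qprod_lower_le) (auto intro: less_imp_le)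
    finally show ?thesis .
  qed
  moreover have "K \<ge> 0" using C C' by (simp add: K_def)
  ultimately show ?case unfolding P_def by auto
qed

definition coef :: "(real ^ 'n \<Rightarrow> complex) \<Rightarrow> ('n \<Rightarrow> nat) \<Rightarrow> complex" where
  "coef f \<alpha> = pairing f \<alpha> / of_real (sfact \<alpha> ^ 2)"

text \<open>
  Choose the list in \<open>pairing_decay_list\<close> to run through all directions often enough; division by the square of
  \<open>sfact\<close> turns the factor \<open>sfact\<close> of that bound into the required decay.
\<close>

lemma rapid_coef:
  fixes f :: "real ^ 'n \<Rightarrow> complex"
  assumes "kclass f"
  shows "rapid (coef f)"
  unfolding rapid_def
proof
  fix N
  obtain ys where ys: "set ys = (UNIV :: 'n set)" "distinct ys" using finite_distinct_list[of "UNIV :: 'n set"] by auto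
  \<comment> \<open>Each pass through all directions gains \<open>\<surd>(qprod \<alpha>)\<close>; two further powers compensate the square on the right.\<close>
  define xs where "xs = concat (replicate (2 * (N + 2)) ys)"
  have pl: "(\<Prod>i\<leftarrow>concat (replicate M ys). sqrt (real (\<alpha> i) + 1)) = (\<Prod>i\<leftarrow>ys. sqrt (real (\<alpha> i) + 1)) ^ M" for M \<alpha>
    by (induction M) auto
  have q: "(\<Prod>i\<leftarrow>xs. sqrt (real (\<alpha> i) + 1)) = qprod \<alpha> ^ (N + 2)" for \<alpha>
  proof -
    have "(\<Prod>i\<leftarrow>ys. sqrt (real (\<alpha> i) + 1)) = (\<Prod>i\<in>UNIV. sqrt (real (\<alpha> i) + 1))"
      using prod.distinct_set_conv_list[OF ys(2), of "\<lambda>i. sqrt (real (\<alpha> i) + 1)"] ys(1) by simp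
    hence "(\<Prod>i\<leftarrow>ys. sqrt (real (\<alpha> i) + 1)) ^ 2 = qprod \<alpha>"
      by (simp add: prod_power_distrib qprod_def)
    thus ?thesis unfolding xs_def pl power_mult by simp
  qed
  obtain C where C: "C \<ge> 0" "\<And>\<alpha>. norm (pairing f \<alpha>) * qprod \<alpha> ^ (N + 2) \<le> C * (sfact \<alpha> * qprod \<alpha> ^ 2)"
    using pairing_decay_list[OF assms, of xs] unfolding q by blast
  have "wcoef N (coef f) \<alpha> \<le> C" for \<alpha>
  proof -
    have "(norm (pairing f \<alpha>) * qprod \<alpha> ^ N) * qprod \<alpha> ^ 2 \<le> (C * sfact \<alpha>) * qprod \<alpha> ^ 2"
      using C(2)[of \<alpha>] by (simp only: power_add mult_ac)
    hence "norm (pairing f \<alpha>) * qprod \<alpha> ^ N \<le> C * sfact \<alpha>"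
      by (rule mult_right_le_imp_le) (simp add: qprod_pos)
    hence "norm (pairing f \<alpha>) * qprod \<alpha> ^ N / sfact \<alpha> \<le> C" using sfact_pos[of \<alpha>] by (simp add: divide_le_eq)
    moreover have "wcoef N (coef f) \<alpha> = norm (pairing f \<alpha>) * qprod \<alpha> ^ N / sfact \<alpha>"
      using sfact_pos[of \<alpha>] unfolding wcoef_def coef_def norm_divide norm_of_real by (simp add: power2_eq_square)
    ultimately show ?thesis by simp
  qed
  thus "\<exists>C. \<forall>\<alpha>. wcoef N (coef f) \<alpha> \<le> C" by blast
qed

section \<open>Mehler's kernel in several variables\<close>

definition mehler_d :: "complex \<Rightarrow> real ^ 'n \<Rightarrow> real ^ 'n \<Rightarrow> complex" where
  "mehler_d z x y = (\<Prod>i\<in>UNIV. mehler z (x $ i) (y $ i))"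

definition mehler_term :: "complex \<Rightarrow> real ^ 'n \<Rightarrow> real ^ 'n \<Rightarrow> ('n \<Rightarrow> nat) \<Rightarrow> complex" where
  "mehler_term z x y \<alpha> = z ^ deg \<alpha> * hermite \<alpha> x * hermite \<alpha> y / of_real (sfact \<alpha> ^ 2)"

lemma mehler_term_prod:
  "mehler_term z x y \<alpha> = (\<Prod>i\<in>UNIV. of_real (herm (\<alpha> i) (x $ i) * herm (\<alpha> i) (y $ i) / fact (\<alpha> i)) * z ^ \<alpha> i)"
proof -
  have "sfact \<alpha> ^ 2 = (\<Prod>i\<in>UNIV. fact (\<alpha> i))" by (simp add: sfact_def prod_power_distrib)
  thus ?thesis
    by (simp add: mehler_term_def hermite_eq_prod deg_def power_sum prod.distrib prod_dividef mult_ac)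
qed

lemma mehler_term_series:
  fixes x y :: "real ^ 'n"
  assumes z: "norm z < 1"
  shows "summable (\<lambda>k. norm (mehler_term z x y (idx k)))" "(\<lambda>k. mehler_term z x y (idx k)) sums mehler_d z x y"
proof -
  define w where "w = (norm z + 1) / 2"
  have w: "norm z < norm (complex_of_real w)" "norm (complex_of_real w) < 1"
  proof -
    have "0 \<le> w" "norm z < w" "w < 1" using z norm_ge_zero[of z] unfolding w_def by auto
    thus "norm z < norm (complex_of_real w)" "norm (complex_of_real w) < 1" by simp_all
  qed
  have s: "summable (\<lambda>n. norm (of_real (herm n (x $ i) * herm n (y $ i) / fact n) * z ^ n))" for i
    by (rule powser_insidea[OF _ w(1)]) (use summable_herm_product[OF w(2), of 0 0] in simp)
  have m: "(\<Sum>n. of_real (herm n (x $ i) * herm n (y $ i) / fact n) * z ^ n) = mehler z (x $ i) (y $ i)" for i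
    using mehler_formula[OF z] by (simp add: sums_iff)
  show "summable (\<lambda>k. norm (mehler_term z x y (idx k)))"
    unfolding mehler_term_prod
    by (rule product_series(1)[where f = "\<lambda>i n. of_real (herm n (x $ i) * herm n (y $ i) / fact n) * z ^ n", OF s])
  show "(\<lambda>k. mehler_term z x y (idx k)) sums mehler_d z x y"
    unfolding mehler_term_prod mehler_d_def
    using product_series(2)[where f = "\<lambda>i n. of_real (herm n (x $ i) * herm n (y $ i) / fact n) * z ^ n", OF s]
    unfolding m .
qed

lemma summable_poly_geometric:
  fixes q :: real
  assumes "0 \<le> q" "q < 1"
  shows "summable (\<lambda>n. norm ((real n + 1) ^ 4 * q ^ n))"
proof -
  define c where "c = (q + 1) / 2"
  have c: "q < c" "c < 1" using assms by (simp_all add: c_def)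
  have "(\<lambda>n. ((real n + 2) / (real n + 1)) ^ 4) \<longlonglongrightarrow> 1" by real_asymp
  from tendsto_mult_right[OF this, of q] have "(\<lambda>n. ((real n + 2) / (real n + 1)) ^ 4 * q) \<longlonglongrightarrow> q" by simp
  from order_tendstoD(2)[OF this c(1)] obtain N where N: "\<And>n. n \<ge> N \<Longrightarrow> ((real n + 2) / (real n + 1)) ^ 4 * q < c"
    by (auto simp: eventually_sequentially)
  have "summable (\<lambda>n. (real n + 1) ^ 4 * q ^ n)"
  proof (rule summable_ratio_test[OF c(2)])
    fix n assume n: "n \<ge> N"
    have "(real (Suc n) + 1) ^ 4 * q ^ Suc n = (((real n + 2) / (real n + 1)) ^ 4 * q) * ((real n + 1) ^ 4 * q ^ n)"
      by (simp add: power_divide add.commute)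
    also have "\<dots> \<le> c * ((real n + 1) ^ 4 * q ^ n)"
      using N[OF n] assms by (intro mult_right_mono) auto
    finally show "norm ((real (Suc n) + 1) ^ 4 * q ^ Suc n) \<le> c * norm ((real n + 1) ^ 4 * q ^ n)"
      using assms by (simp add: abs_mult)
  qed
  thus ?thesis using assms by (simp add: abs_mult)
qed

text \<open>
  Interchange of sum and integral is justified by the geometric factor \<open>|z|^|\<alpha>|\<close>, which beats the fourth power of
  \<open>qprod\<close> coming from the two Hermite bounds.
\<close>

lemma mehler_integral:
  fixes f :: "real ^ 'n \<Rightarrow> complex"
  assumes f: "kclass f" and z: "norm z < 1"
  shows "hseries (\<lambda>\<alpha>. z ^ deg \<alpha> * coef f \<alpha>) x = (LINT y|lborel. f y * mehler_d z x y * of_real (rho y))"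
proof -
  define F where "F k y = f y * mehler_term z x y (idx k) * of_real (rho y)" for k y
  obtain C where C: "\<And>x. norm (f x) \<le> C * (growth x * weight x)" using kclassD(2)[OF f] by blast
  have Feq: "F k y = z ^ deg \<alpha> * hermite \<alpha> x / of_real (sfact \<alpha> ^ 2) * (f y * hermite \<alpha> y * of_real (rho y))"
    if "\<alpha> = idx k" for k y and \<alpha> :: "'n \<Rightarrow> nat"
    unfolding F_def mehler_term_def that by simp
  have intF: "integrable lborel (F k)" for k
    unfolding Feq[OF refl] by (intro integrable_mult_right kclass_pairing(1) f)
  define K where "K = hconst TYPE('n) * (growth x * weight x) * ((2 * pi) powr (- real CARD('n) / 2) * C * hconst TYPE('n))"
  have bF: "norm (F k y) \<le> K * (norm z ^ deg \<alpha> * qprod \<alpha> ^ 4) * weight y" if \<alpha>: "\<alpha> = idx k" for k y and \<alpha> :: "'n \<Rightarrow> nat"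
  proof -
    have "norm (F k y) = norm z ^ deg \<alpha> * norm (hermite \<alpha> x) / sfact \<alpha> ^ 2 * norm (f y * hermite \<alpha> y * of_real (rho y))"
      unfolding Feq[OF \<alpha>] norm_mult norm_divide norm_power norm_of_real by simp
    also have "\<dots> \<le> norm z ^ deg \<alpha> * (hconst TYPE('n) * (sfact \<alpha> * qprod \<alpha> ^ 2) * (growth x * weight x)) / sfact \<alpha> ^ 2
        * ((2 * pi) powr (- real CARD('n) / 2) * C * (hconst TYPE('n) * (sfact \<alpha> * qprod \<alpha> ^ 2)) * weight y)"
      using order_trans[OF norm_ge_zero hermite_bound[of \<alpha> x]]
      by (intro mult_mono divide_right_mono mult_left_mono hermite_bound rho_growth_bound C) auto
    also have "\<dots> = K * (norm z ^ deg \<alpha> * qprod \<alpha> ^ 4) * weight y"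
      using sfact_pos[of \<alpha>] by (simp add: K_def field_simps power2_eq_square power4_eq_xxxx)
    finally show ?thesis .
  qed
  have sq: "summable (\<lambda>k. K * ((\<lambda>\<alpha>::'n \<Rightarrow> nat. norm z ^ deg \<alpha> * qprod \<alpha> ^ 4) (idx k)) * (LINT y|lborel. weight (y :: real ^ 'n)))"
  proof (intro summable_mult2 summable_mult)
    have "summable (\<lambda>k. norm (\<Prod>i\<in>(UNIV::'n set). (real (idx k i) + 1) ^ 4 * norm z ^ idx k i))"
      by (rule product_series(1)[where f = "\<lambda>i n. (real n + 1) ^ 4 * norm z ^ n"])
        (use summable_poly_geometric[OF norm_ge_zero z] in simp)
    moreover have "(\<Prod>i\<in>(UNIV::'n set). (real (\<alpha> i) + 1) ^ 4 * norm z ^ \<alpha> i) = norm z ^ deg \<alpha> * qprod \<alpha> ^ 4" for \<alpha>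
      by (simp add: deg_def qprod_def power_sum prod.distrib prod_power_distrib)
    moreover have "norm (norm z ^ deg \<alpha> * qprod \<alpha> ^ 4) = norm z ^ deg \<alpha> * qprod \<alpha> ^ 4" for \<alpha> :: "'n \<Rightarrow> nat"
      by (simp add: abs_mult)
    ultimately show "summable (\<lambda>k. (\<lambda>\<alpha>::'n \<Rightarrow> nat. norm z ^ deg \<alpha> * qprod \<alpha> ^ 4) (idx k))" by simp
  qed
  have "(\<lambda>k. integral\<^sup>L lborel (F k)) sums (LINT y|lborel. (\<Sum>k. F k y))"
  proof (rule sums_integral[OF intF])
    have "summable (\<lambda>k. norm (f y * of_real (rho y)) * norm (mehler_term z x y (idx k)))" for y
      by (intro summable_mult mehler_term_series z)
    thus "AE y in lborel. summable (\<lambda>k. norm (F k y))"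
      unfolding F_def by (intro AE_I2) (simp add: norm_mult mult_ac)
    show "summable (\<lambda>k. LINT y|lborel. norm (F k y))"
    proof (rule summable_comparison_test'[OF sq, of 0])
      fix k
      have "(LINT y|lborel. norm (F k y)) \<le> (LINT y|lborel. K * ((\<lambda>\<alpha>::'n \<Rightarrow> nat. norm z ^ deg \<alpha> * qprod \<alpha> ^ 4) (idx k)) * weight (y :: real ^ 'n))"
        by (rule integral_mono[OF integrable_norm[OF intF] integrable_mult_right[OF integrable_weight]]) (rule bF[OF refl])
      thus "norm (LINT y|lborel. norm (F k y)) \<le> K * ((\<lambda>\<alpha>::'n \<Rightarrow> nat. norm z ^ deg \<alpha> * qprod \<alpha> ^ 4) (idx k)) * (LINT y|lborel. weight (y :: real ^ 'n))"
        by simp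
    qed
  qed
  moreover have "(\<Sum>k. F k y) = f y * mehler_d z x y * of_real (rho y)" for y
    using sums_mult[OF mehler_term_series(2)[OF z, of x y], of "f y * of_real (rho y)"]
    by (simp add: F_def sums_iff mult_ac)
  moreover have "integral\<^sup>L lborel (F k) = z ^ deg \<alpha> * coef f \<alpha> * hermite \<alpha> x" if \<alpha>: "\<alpha> = idx k" for k and \<alpha> :: "'n \<Rightarrow> nat"
  proof -
    have "integral\<^sup>L lborel (F k) = z ^ deg \<alpha> * hermite \<alpha> x / of_real (sfact \<alpha> ^ 2) * pairing f \<alpha>"
      unfolding Feq[OF \<alpha>] pairing_def by (rule integral_mult_right_zero)
    thus ?thesis by (simp add: coef_def)
  qed
  ultimately have "(\<lambda>k. z ^ deg (idx k :: 'n \<Rightarrow> nat) * coef f (idx k) * hermite (idx k) x) sums (LINT y|lborel. f y * mehler_d z x y * of_real (rho y))"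
    by simp
  thus ?thesis unfolding hseries_def by (simp add: sums_iff)
qed

section \<open>Radial limits\<close>

definition radii :: "nat \<Rightarrow> real" where
  "radii n = real (n + 1) / real (n + 2)"

lemma radii: "0 < radii n" "radii n < 1" "radii \<longlonglongrightarrow> 1"
proof -
  show "0 < radii n" "radii n < 1" by (simp_all add: radii_def)
  show "radii \<longlonglongrightarrow> 1" unfolding radii_def[abs_def] by real_asymp
qed

text \<open>
  Abel summation: the coefficients are absolutely summable against the Hermite polynomials, so the damped series is
  continuous up to the unit circle.
\<close>

lemma hseries_radial_limit:
  fixes c :: "('n::finite \<Rightarrow> nat) \<Rightarrow> complex" and x :: "real ^ 'n"
  assumes c: "rapid c"
  shows "(\<lambda>n. hseries (\<lambda>\<alpha>. (of_real (radii n) * cis (- t)) ^ deg \<alpha> * c \<alpha>) x) \<longlonglongrightarrow> hseries (evolve c t) x"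
proof -
  define F where "F r = hseries (\<lambda>\<alpha>. (of_real r * cis (- t)) ^ deg \<alpha> * c \<alpha>) x" for r
  have "continuous_on {0..1} F" unfolding F_def hseries_def
  proof (rule uniform_limit_theorem)
    show "\<forall>\<^sub>F n in sequentially. continuous_on {0..1} (\<lambda>r. \<Sum>k<n. (of_real r * cis (- t)) ^ deg (idx k :: 'n \<Rightarrow> nat) * c (idx k) * hermite (idx k) x)"
      by (intro always_eventually allI continuous_intros)
    show "uniform_limit {0..1} (\<lambda>n r. \<Sum>k<n. (of_real r * cis (- t)) ^ deg (idx k :: 'n \<Rightarrow> nat) * c (idx k) * hermite (idx k) x)
        (\<lambda>r. \<Sum>k. (of_real r * cis (- t)) ^ deg (idx k :: 'n \<Rightarrow> nat) * c (idx k) * hermite (idx k) x) sequentially"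
    proof (rule Weierstrass_m_test[OF _ summable_mult2[OF majorant_summable[OF c, of 2], of "growth x"]])
      fix k and r :: real assume r: "r \<in> {0..1}"
      have "norm ((of_real r * cis (- t)) ^ deg (idx k :: 'n \<Rightarrow> nat) * (c (idx k) * hermite (idx k) x)) \<le> 1 * norm (c (idx k) * hermite (idx k) x)"
        unfolding norm_mult[of "_ ^ _"] using r
        by (intro mult_right_mono) (auto simp: norm_power norm_mult power_le_one)
      also have "\<dots> \<le> hconst TYPE('n) * wcoef 2 c (idx k) * growth x"
        using weighted_bound_mono[OF hermite_bound order.refl, of c "idx k" x] by simp
      finally show "norm ((of_real r * cis (- t)) ^ deg (idx k :: 'n \<Rightarrow> nat) * c (idx k) * hermite (idx k) x) \<le> hconst TYPE('n) * wcoef 2 c (idx k) * growth x"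
        by (simp add: mult.assoc)
    qed
  qed auto
  from continuous_on_tendsto_compose[OF this radii(3)]
  have "(\<lambda>n. F (radii n)) \<longlonglongrightarrow> F 1" using radii by (auto intro!: always_eventually less_imp_le)
  moreover have "F 1 = hseries (evolve c t) x"
    unfolding F_def evolve_def[abs_def] by (simp add: Complex.DeMoivre)
  ultimately show ?thesis by (simp add: F_def)
qed

section \<open>The Hermite expansion of a function of class K\<close>

text \<open>
  In one variable \<open>1 + a\<^sup>2 \<le> 4 (1 + a\<^sup>2 / 4) \<le> 4 exp(a\<^sup>2/4)\<close>.
\<close>

lemma growth_inverse_le_weight: "1 / growth (x :: real ^ 'n) \<le> 4 ^ CARD('n) * weight x"
proof -
  have "1 / exp (a\<^sup>2 / 4) \<le> 4 * (1 / (1 + a\<^sup>2))" for a :: real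
  proof -
    have "1 + a\<^sup>2 \<le> 4 * (1 + a\<^sup>2 / 4)" by simp
    also have "\<dots> \<le> 4 * exp (a\<^sup>2 / 4)" by (intro mult_left_mono exp_ge_add_one_self) auto
    finally show ?thesis by (simp add: divide_simps add_pos_nonneg)
  qed
  hence "(\<Prod>i\<in>UNIV. 1 / exp ((x $ i)\<^sup>2 / 4)) \<le> (\<Prod>i\<in>UNIV. 4 * (1 / (1 + (x $ i)\<^sup>2)))"
    by (intro prod_mono) auto
  thus ?thesis by (simp add: growth_prod weight_def prod_dividef prod.distrib)
qed

lemma integral_affine:
  fixes h :: "real ^ 'n \<Rightarrow> complex" and v :: "real ^ 'n"
  assumes "continuous_on UNIV h" "s > 0"
  shows "(LINT y|lborel. h y) = (LINT w|lborel. of_real (s ^ CARD('n)) * h (v + s *\<^sub>R w))"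
proof -
  have [measurable]: "h \<in> borel_measurable borel" by (rule borel_measurable_continuous_onI[OF assms(1)])
  have l: "lborel = density (distr lborel borel (\<lambda>x. v + s *\<^sub>R x)) (\<lambda>_. ennreal (s ^ CARD('n)))"
    using lborel_affine[of s v] assms(2) by simp
  have "(LINT y|lborel. h y) = (LINT y|density (distr lborel borel (\<lambda>x. v + s *\<^sub>R x)) (\<lambda>_. ennreal (s ^ CARD('n))). h y)"
    by (subst l) (rule refl)
  also have "\<dots> = (LINT y|distr lborel borel (\<lambda>x. v + s *\<^sub>R x). (s ^ CARD('n)) *\<^sub>R h y)"
    using assms(2) by (subst integral_density) auto
  also have "\<dots> = (LINT w|lborel. (s ^ CARD('n)) *\<^sub>R h (v + s *\<^sub>R w))"
    by (rule integral_distr) auto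
  finally show ?thesis by (simp add: scaleR_conv_of_real)
qed

text \<open>
  For real \<open>r\<close> the kernel times the Gaussian in \<open>y\<close> is the Gaussian centred at \<open>r a\<close> of variance
  \<open>s\<^sup>2 = 1 - r\<^sup>2\<close>, so the substitution \<open>y = r a + s b\<close> reduces it to the standard Gaussian.
\<close>

lemma mehler_real:
  assumes r: "0 < r" "r < 1" and s: "s = sqrt (1 - r\<^sup>2)"
  shows "mehler (of_real r) a (r * a + s * b) * of_real (exp (- (r * a + s * b)\<^sup>2 / 2)) = of_real (exp (- b\<^sup>2 / 2) / s)"
proof -
  have r2: "1 - r\<^sup>2 > 0" using r by (simp add: power_less_one_iff)
  hence s2: "s\<^sup>2 = 1 - r\<^sup>2" and s0: "s > 0" by (simp_all add: s)
  define y where "y = r * a + s * b"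
  have "(r * (a * y) - r\<^sup>2 * (a\<^sup>2 + y\<^sup>2) / 2) / (1 - r\<^sup>2) + (- y\<^sup>2 / 2) = - b\<^sup>2 / 2"
  proof -
    have "(r * (a * y) - r\<^sup>2 * (a\<^sup>2 + y\<^sup>2) / 2) / (1 - r\<^sup>2) + (- y\<^sup>2 / 2)
      = ((r * (a * y) - r\<^sup>2 * (a\<^sup>2 + y\<^sup>2) / 2) - (1 - r\<^sup>2) * y\<^sup>2 / 2) / (1 - r\<^sup>2)"
      using r2 by (simp add: field_simps)
    also have "(r * (a * y) - r\<^sup>2 * (a\<^sup>2 + y\<^sup>2) / 2) - (1 - r\<^sup>2) * y\<^sup>2 / 2 = - (y - r * a)\<^sup>2 / 2"
      by (simp add: power2_eq_square field_simps)
    also have "y - r * a = s * b" by (simp add: y_def)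
    finally have 1: "(r * (a * y) - r\<^sup>2 * (a\<^sup>2 + y\<^sup>2) / 2) / (1 - r\<^sup>2) + (- y\<^sup>2 / 2)
       = - (s * b)\<^sup>2 / 2 / (1 - r\<^sup>2)" .
    have "- (q * c) / 2 / q = - c / 2" if "q > 0" for q c :: real using that by (simp add: field_simps)
    from this[OF r2] show ?thesis unfolding 1 power_mult_distrib s2 .
  qed
  note 1 = this
  have 2: "mehler (of_real r) a y
     = of_real (exp ((r * (a * y) - r\<^sup>2 * (a\<^sup>2 + y\<^sup>2) / 2) / (1 - r\<^sup>2)) / s)"
    using csqrt_of_pos_real[OF r2] unfolding mehler_def s by (simp add: exp_of_real[symmetric])
  have 3: "exp A / s * exp B = exp (A + B) / s" for A B by (simp add: exp_add)
  show ?thesis unfolding y_def[symmetric] 2 of_real_mult[symmetric] 3 1 ..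
qed

lemma mehler_d_real:
  fixes x w :: "real ^ 'n"
  assumes r: "0 < r" "r < 1" and s: "s = sqrt (1 - r\<^sup>2)"
  shows "of_real (s ^ CARD('n)) * (mehler_d (of_real r) x (r *\<^sub>R x + s *\<^sub>R w) * of_real (rho (r *\<^sub>R x + s *\<^sub>R w)))
    = of_real (rho w)"
proof -
  have s0: "s > 0" using r by (simp add: s power_less_one_iff)
  define c where "c = (2 * pi) powr (- real CARD('n) / 2)"
  have rho: "complex_of_real (rho v) = of_real c * (\<Prod>i\<in>UNIV. of_real (exp (- (v $ i)\<^sup>2 / 2)))" for v :: "real ^ 'n"
  proof -
    have "exp (- (norm v)\<^sup>2 / 2) = (\<Prod>i\<in>UNIV. exp (- (v $ i)\<^sup>2 / 2))"
      by (simp add: norm_sq_vec sum_divide_distrib sum_negf flip: exp_sum)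
    thus ?thesis by (simp add: rho_def c_def)
  qed
  have "of_real (s ^ CARD('n)) * (mehler_d (of_real r) x (r *\<^sub>R x + s *\<^sub>R w) * of_real (rho (r *\<^sub>R x + s *\<^sub>R w)))
     = of_real c * (\<Prod>i\<in>(UNIV :: 'n set). of_real s * (mehler (of_real r) (x $ i) (r * x $ i + s * w $ i) * of_real (exp (- (r * x $ i + s * w $ i)\<^sup>2 / 2))))"
    unfolding rho mehler_d_def by (simp add: prod.distrib)
  also have "\<dots> = of_real c * (\<Prod>i\<in>(UNIV :: 'n set). of_real (exp (- (w $ i)\<^sup>2 / 2)))"
    unfolding mehler_real[OF r s] using s0 by simp
  finally show ?thesis unfolding rho .
qed

text \<open>
  The point is one component of a rotation of the pair \<open>(x, w)\<close>. This is the exact form that allows \<open>f\<close> to grow like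
  \<open>exp(|y|\<^sup>2/4)\<close>: after the substitution its growth is at most \<open>exp(|x|\<^sup>2/4) exp(|w|\<^sup>2/4)\<close>.
\<close>

lemma norm_rotation_le:
  fixes x w :: "real ^ 'n"
  assumes "r\<^sup>2 + s\<^sup>2 = 1"
  shows "(norm (r *\<^sub>R x + s *\<^sub>R w))\<^sup>2 \<le> (norm x)\<^sup>2 + (norm w)\<^sup>2"
proof -
  have "(norm (r *\<^sub>R x + s *\<^sub>R w))\<^sup>2 + (norm (s *\<^sub>R x - r *\<^sub>R w))\<^sup>2 = (r\<^sup>2 + s\<^sup>2) * ((norm x)\<^sup>2 + (norm w)\<^sup>2)"
    unfolding power2_norm_eq_inner
    by (simp add: inner_add_left inner_add_right inner_diff_left inner_diff_right inner_commute power2_eq_square algebra_simps)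
  hence "(norm (r *\<^sub>R x + s *\<^sub>R w))\<^sup>2 + (norm (s *\<^sub>R x - r *\<^sub>R w))\<^sup>2 = (norm x)\<^sup>2 + (norm w)\<^sup>2"
    by (simp add: assms)
  moreover have "(norm (s *\<^sub>R x - r *\<^sub>R w))\<^sup>2 \<ge> 0" by simp
  ultimately show ?thesis by linarith
qed

lemma continuous_mehler_d: "continuous_on S (mehler_d z x)"
  unfolding mehler_d_def mehler_def divide_inverse by (intro continuous_intros)

text \<open>
  As \<open>z\<close> increases to 1 the Mehler integrals of \<open>f\<close> are averages of \<open>f\<close> over Gaussians contracting to \<open>x\<close>; they
  converge to \<open>f x\<close>, and the damped series converges to the Hermite series of \<open>f\<close>.
\<close>

lemma hermite_expansion:
  fixes f :: "real ^ 'n \<Rightarrow> complex"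
  assumes f: "kclass f"
  shows "hseries (coef f) x = f x"
proof -
  define s where "s n = sqrt (1 - (radii n)\<^sup>2)" for n
  have s0: "s n > 0" for n using radii(1,2)[of n] by (simp add: s_def power_less_one_iff)
  have rs: "(radii n)\<^sup>2 + (s n)\<^sup>2 = 1" for n using radii(1,2)[of n] by (simp add: s_def power_le_one)
  have slim: "s \<longlonglongrightarrow> 0"
  proof -
    have "(\<lambda>n. sqrt (1 - (radii n)\<^sup>2)) \<longlonglongrightarrow> sqrt (1 - 1\<^sup>2)" by (intro tendsto_intros radii)
    thus ?thesis by (simp add: s_def[abs_def])
  qed
  obtain C where C: "\<And>x. norm (f x) \<le> C * (growth x * weight x)" using kclassD(2)[OF f] by blast
  have C0: "C \<ge> 0"
  proof -
    have p: "growth (0 :: real ^ 'n) * weight (0 :: real ^ 'n) > 0" by (intro mult_pos_pos growth_pos weight_pos)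
    have "0 \<le> C * (growth (0 :: real ^ 'n) * weight (0 :: real ^ 'n))" by (rule order_trans[OF norm_ge_zero C])
    thus ?thesis using p by (simp only: zero_le_mult_iff) linarith
  qed
  have [measurable]: "f \<in> borel_measurable borel" by (rule borel_measurable_continuous_onI[OF kclassD(3)[OF f]])
  have eq: "hseries (\<lambda>\<alpha>. (of_real (radii n) * cis (- 0)) ^ deg \<alpha> * coef f \<alpha>) x
      = (LINT w|lborel. f (radii n *\<^sub>R x + s n *\<^sub>R w) * of_real (rho w))" for n
  proof -
    have "hseries (\<lambda>\<alpha>. (of_real (radii n) * cis (- 0)) ^ deg \<alpha> * coef f \<alpha>) x
       = (LINT y|lborel. f y * mehler_d (of_real (radii n)) x y * of_real (rho y))"
      using mehler_integral[OF f, of "of_real (radii n)" x] radii(1,2)[of n] by simp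
    also have "\<dots> = (LINT w|lborel. of_real (s n ^ CARD('n)) * (f (radii n *\<^sub>R x + s n *\<^sub>R w)
        * mehler_d (of_real (radii n)) x (radii n *\<^sub>R x + s n *\<^sub>R w) * of_real (rho (radii n *\<^sub>R x + s n *\<^sub>R w))))"
      by (rule integral_affine[OF _ s0])
        (intro continuous_intros kclassD(3) f continuous_mehler_d continuous_on_rho)
    also have "\<dots> = (LINT w|lborel. f (radii n *\<^sub>R x + s n *\<^sub>R w) * of_real (rho w))"
    proof (rule Bochner_Integration.integral_cong[OF refl])
      fix w
      have "a * (b * c * d) = b * (a * (c * d))" for a b c d :: complex by simp
      thus "of_real (s n ^ CARD('n)) * (f (radii n *\<^sub>R x + s n *\<^sub>R w)
        * mehler_d (of_real (radii n)) x (radii n *\<^sub>R x + s n *\<^sub>R w) * of_real (rho (radii n *\<^sub>R x + s n *\<^sub>R w)))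
        = f (radii n *\<^sub>R x + s n *\<^sub>R w) * of_real (rho w)"
        by (simp only: mehler_d_real[OF radii(1,2) s_def])
    qed
    finally show ?thesis .
  qed
  define K where "K = C * growth x * (2 * pi) powr (- real CARD('n) / 2) * 4 ^ CARD('n)"
  have "(\<lambda>n. LINT w|lborel. f (radii n *\<^sub>R x + s n *\<^sub>R w) * of_real (rho w)) \<longlonglongrightarrow> (LINT w|lborel. f x * of_real (rho (w :: real ^ 'n)))"
  proof (rule integral_dominated_convergence[where M = lborel and f = "\<lambda>w. f x * of_real (rho w)"
        and s = "\<lambda>n w. f (radii n *\<^sub>R x + s n *\<^sub>R w) * of_real (rho w)" and w = "\<lambda>w. K * weight w"])
    show "integrable lborel (\<lambda>w. K * weight (w :: real ^ 'n))" by (intro integrable_mult_right integrable_weight)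
    show "AE w in lborel. (\<lambda>n. f (radii n *\<^sub>R x + s n *\<^sub>R w) * of_real (rho w)) \<longlonglongrightarrow> f x * of_real (rho w)"
    proof (intro AE_I2 tendsto_mult tendsto_const)
      fix w :: "real ^ 'n"
      have "(\<lambda>n. radii n *\<^sub>R x + s n *\<^sub>R w) \<longlonglongrightarrow> 1 *\<^sub>R x + 0 *\<^sub>R w"
        by (intro tendsto_intros radii slim)
      thus "(\<lambda>n. f (radii n *\<^sub>R x + s n *\<^sub>R w)) \<longlonglongrightarrow> f x"
        by (intro continuous_on_tendsto_compose[OF kclassD(3)[OF f]]) auto
    qed
    show "AE w in lborel. norm (f (radii n *\<^sub>R x + s n *\<^sub>R w) * of_real (rho w)) \<le> K * weight w" for n
    proof (rule AE_I2)
      fix w :: "real ^ 'n"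
      define v where "v = radii n *\<^sub>R x + s n *\<^sub>R w"
      have "growth v \<le> growth x * growth w"
        using norm_rotation_le[OF rs, of n x w] unfolding growth_def v_def
        by (simp add: exp_add[symmetric] add_divide_distrib[symmetric])
      hence "norm (f v) \<le> C * (growth x * growth w * 1)"
        using C0 weight_pos[of v] weight_le_1[of v] growth_pos[of x] growth_pos[of w]
        by (intro order_trans[OF C] mult_left_mono mult_mono) auto
      hence "norm (f v) * rho w \<le> C * (growth x * growth w * 1) * rho w"
        using rho_pos[of w] by (intro mult_right_mono) auto
      also have "\<dots> = C * growth x * (rho w * (growth w)\<^sup>2) * (1 / growth w)"
        using growth_pos[of w] by (simp add: power2_eq_square field_simps)
      also have "\<dots> \<le> C * growth x * (rho w * (growth w)\<^sup>2) * (4 ^ CARD('n) * weight w)"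
        using C0 growth_pos[of x] rho_pos[of w] by (intro mult_left_mono growth_inverse_le_weight) auto
      also have "\<dots> = K * weight w" by (simp add: rho_growth K_def)
      finally show "norm (f (radii n *\<^sub>R x + s n *\<^sub>R w) * of_real (rho w)) \<le> K * weight w"
        using rho_pos[of w] by (simp add: v_def norm_mult)
    qed
  qed auto
  moreover have "(LINT w|lborel. f x * of_real (rho (w :: real ^ 'n))) = f x"
    using integral_rho(2)[where 'n = 'n] by simp
  moreover have "evolve (coef f) 0 = coef f" by (simp add: evolve_def fun_eq_iff)
  moreover note hseries_radial_limit[OF rapid_coef[OF f], of 0 x, unfolded eq]
  ultimately show ?thesis using LIMSEQ_unique by force
qed

section \<open>The kernel at regular times\<close>

text \<open>
  With \<open>w = 1 - z\<^sup>2\<close> and \<open>\<kappa> = (1 - r\<^sup>2) / |w|\<^sup>2\<close>, the real part of the total exponent is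
  \<open>-b\<^sup>2/4 + \<kappa> (r cos t a b - (1 + r\<^sup>2) b\<^sup>2/4)\<close> plus a multiple of \<open>a\<^sup>2\<close>. The bracket is at most \<open>a\<^sup>2\<close>, and
  \<open>|w| \<ge> |sin t|\<close> bounds \<open>\<kappa>\<close> and the square root uniformly in \<open>r\<close>.
\<close>

lemma mehler_bound:
  assumes t: "sin t \<noteq> 0" and r: "0 \<le> r" "r < 1"
  shows "norm (mehler (of_real r * cis (- t)) a b) * exp (- b\<^sup>2 / 2)
      \<le> exp (a\<^sup>2 / (sin t)\<^sup>2 + a\<^sup>2 / (2 * \<bar>sin t\<bar>)) / sqrt \<bar>sin t\<bar> * exp (- b\<^sup>2 / 4)"
proof -
  define z where "z = of_real r * cis (- t)"
  define w where "w = 1 - z\<^sup>2"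
  define S where "S = (norm w)\<^sup>2"
  have z1: "norm z < 1" using r by (simp add: z_def norm_mult)
  have Rew: "Re w = 1 - r\<^sup>2 * cos (2 * t)" and Imw: "Im w = r\<^sup>2 * sin (2 * t)"
    unfolding w_def z_def power_mult_distrib Complex.DeMoivre by (simp_all flip: of_real_power)
  have S: "S = (1 - r\<^sup>2)\<^sup>2 + 4 * r\<^sup>2 * (sin t)\<^sup>2"
  proof -
    define \<rho> c d \<sigma> where "\<rho> = r\<^sup>2" and "c = cos (2 * t)" and "d = sin (2 * t)" and "\<sigma> = (sin t)\<^sup>2"
    have cd: "c\<^sup>2 + d\<^sup>2 = 1" by (simp add: c_def d_def)
    have c: "c = 1 - 2 * \<sigma>" unfolding c_def \<sigma>_def by (rule cos_double_sin)
    have "S = (1 - \<rho> * c)\<^sup>2 + (\<rho> * d)\<^sup>2"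
      unfolding S_def cmod_power2 Rew Imw \<rho>_def c_def d_def ..
    also have "\<dots> = 1 - 2 * \<rho> * c + \<rho>\<^sup>2 * (c\<^sup>2 + d\<^sup>2)"
      by (simp add: power2_eq_square algebra_simps)
    also have "\<dots> = (1 - \<rho>)\<^sup>2 + 4 * \<rho> * \<sigma>"
      unfolding cd unfolding c by (simp add: power2_eq_square algebra_simps)
    finally show ?thesis unfolding \<rho>_def \<sigma>_def .
  qed
  have Sge: "S \<ge> (sin t)\<^sup>2"
  proof (cases "4 * r\<^sup>2 \<ge> 1")
    case True
    hence "1 * (sin t)\<^sup>2 \<le> 4 * r\<^sup>2 * (sin t)\<^sup>2" by (intro mult_right_mono) auto
    thus ?thesis unfolding S by (smt (verit) zero_le_power2)
  next
    case False
    have "(1 - 4 * r\<^sup>2) * (sin t)\<^sup>2 \<le> (1 - 4 * r\<^sup>2) * 1"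
      using False by (intro mult_left_mono) (auto simp: abs_square_le_1)
    moreover have "(1 - r\<^sup>2)\<^sup>2 - (1 - 4 * r\<^sup>2) = 2 * r\<^sup>2 + r ^ 4"
      by (simp add: power2_eq_square power4_eq_xxxx algebra_simps)
    moreover have "2 * r\<^sup>2 + r ^ 4 \<ge> 0" by simp
    moreover have "S = (1 - r\<^sup>2)\<^sup>2 - (1 - 4 * r\<^sup>2) * (sin t)\<^sup>2 + (sin t)\<^sup>2"
      unfolding S by (simp add: algebra_simps)
    moreover have "X \<le> Y * 1 \<Longrightarrow> Z - Y = W \<Longrightarrow> 0 \<le> W \<Longrightarrow> S = Z - X + q \<Longrightarrow> q \<le> S" for X Y Z W q :: real
      by simp
    ultimately show ?thesis by blast
  qed
  have st: "(sin t)\<^sup>2 > 0" using t by simp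
  hence S0: "S > 0" using Sge by linarith
  have w0: "w \<noteq> 0" using S0 by (auto simp: S_def)
  have nw: "norm w \<ge> \<bar>sin t\<bar>"
    using Sge unfolding S_def by (metis abs_le_square_iff abs_norm_cancel)
  have div: "Re (u / w) = Re (u * cnj w) / S" for u
    by (simp add: complex_div_cnj[of u w] S_def flip: of_real_power)
  have R1: "Re (1 / w) = (1 - r\<^sup>2 * cos (2 * t)) / S" unfolding div by (simp add: Rew)
  have half: "(1 - r\<^sup>2 * cos (2 * t)) / S = 1 / 2 + (1 - r ^ 4) / (2 * S)"
  proof -
    have "2 * (1 - r\<^sup>2 * cos (2 * t)) = S + (1 - r ^ 4)"
      unfolding S cos_double_sin by (simp add: power2_eq_square power4_eq_xxxx algebra_simps)
    moreover have "X / S = 1 / 2 + B / (2 * S)" if "2 * X = S + B" for X B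
    proof -
      have "X = (S + B) / 2" using that by simp
      thus ?thesis using S0 by (simp add: field_simps)
    qed
    ultimately show ?thesis by blast
  qed
  have R2: "Re (z / w) = r * cos t * (1 - r\<^sup>2) / S"
  proof -
    have zc: "z * cnj w = z - of_real (r\<^sup>2) * cnj z"
    proof -
      have "z * cnj z = of_real (r\<^sup>2)" by (simp add: z_def cis_cnj cis_mult power2_eq_square mult_ac)
      moreover have "z * cnj w = z - z * cnj z * cnj z"
        by (simp add: w_def power2_eq_square algebra_simps)
      ultimately show ?thesis by (simp only:)
    qed
    show ?thesis unfolding div zc by (simp add: z_def algebra_simps)
  qed
  have "Re ((z * (of_real a * of_real b) - z\<^sup>2 * (of_real a ^ 2 + of_real b ^ 2) / 2) / w) - b\<^sup>2 / 2
     = Re (z / w) * (a * b) - Re (1 / w) * b\<^sup>2 / 2 - Re (z\<^sup>2 / w) * a\<^sup>2 / 2"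
  proof -
    have zz: "z\<^sup>2 / w = 1 / w - 1" using w0 by (simp add: w_def field_simps)
    have ee: "(z * (of_real a * of_real b) - z\<^sup>2 * (of_real a ^ 2 + of_real b ^ 2) / 2) / w
       = z / w * of_real (a * b) - z\<^sup>2 / w * of_real (a\<^sup>2 / 2) - (1 / w - 1) * of_real (b\<^sup>2 / 2)"
      unfolding zz[symmetric] by (simp add: diff_divide_distrib add_divide_distrib algebra_simps)
    have rr: "Re (u * of_real p) = Re u * p" for u p by simp
    show ?thesis unfolding ee minus_complex.sel rr one_complex.sel by (simp add: field_simps)
  qed
  also have "\<dots> \<le> - b\<^sup>2 / 4 + a\<^sup>2 / (sin t)\<^sup>2 + a\<^sup>2 / (2 * \<bar>sin t\<bar>)"
  proof -
    define \<kappa> where "\<kappa> = (1 - r\<^sup>2) / S"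
    have k0: "\<kappa> \<ge> 0" using r S0 by (simp add: \<kappa>_def power_le_one)
    have "\<kappa> \<le> 1 / (sin t)\<^sup>2"
      unfolding \<kappa>_def using S0 Sge st r by (intro frac_le) auto
    hence k1: "\<kappa> * a\<^sup>2 \<le> a\<^sup>2 / (sin t)\<^sup>2" using mult_right_mono[of \<kappa> "1 / (sin t)\<^sup>2" "a\<^sup>2"] by simp
    have e1: "(1 - r ^ 4) / (2 * S) = \<kappa> * (1 + r\<^sup>2) / 2"
      unfolding \<kappa>_def using S0 by (simp add: field_simps power2_eq_square power4_eq_xxxx)
    have "r * cos t * (a * b) \<le> \<bar>a\<bar> * \<bar>b\<bar>"
    proof -
      have "\<bar>r * cos t\<bar> \<le> 1" using r by (simp add: abs_mult mult_le_one)
      hence "\<bar>r * cos t\<bar> * \<bar>a * b\<bar> \<le> 1 * \<bar>a * b\<bar>" by (intro mult_right_mono) auto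
      thus ?thesis using abs_ge_self[of "r * cos t * (a * b)"] by (simp add: abs_mult)
    qed
    moreover have "\<bar>a\<bar> * \<bar>b\<bar> \<le> a\<^sup>2 + b\<^sup>2 / 4"
    proof -
      have "(\<bar>a\<bar> - \<bar>b\<bar> / 2)\<^sup>2 \<ge> 0" by simp
      thus ?thesis by (simp add: power2_diff power_divide)
    qed
    moreover have "b\<^sup>2 \<le> (1 + r\<^sup>2) * b\<^sup>2" by (simp add: distrib_right)
    ultimately have "r * cos t * (a * b) - (1 + r\<^sup>2) * b\<^sup>2 / 4 \<le> a\<^sup>2" by linarith
    hence "\<kappa> * (r * cos t * (a * b) - (1 + r\<^sup>2) * b\<^sup>2 / 4) \<le> \<kappa> * a\<^sup>2"
      by (intro mult_left_mono k0)
    moreover have "- Re (z\<^sup>2 / w) * a\<^sup>2 / 2 \<le> a\<^sup>2 / (2 * \<bar>sin t\<bar>)"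
    proof -
      have "- Re (z\<^sup>2 / w) \<le> norm (z\<^sup>2 / w)" using abs_Re_le_cmod[of "z\<^sup>2 / w"] by linarith
      also have "\<dots> \<le> 1 / \<bar>sin t\<bar>"
        unfolding norm_divide norm_power using nw z1 t by (intro frac_le) (auto simp: power_le_one)
      finally have "- Re (z\<^sup>2 / w) * (a\<^sup>2 / 2) \<le> 1 / \<bar>sin t\<bar> * (a\<^sup>2 / 2)" by (rule mult_right_mono) simp
      thus ?thesis by (simp add: mult.commute)
    qed
    moreover have "Re (z / w) * (a * b) - Re (1 / w) * b\<^sup>2 / 2
        = - b\<^sup>2 / 4 + \<kappa> * (r * cos t * (a * b) - (1 + r\<^sup>2) * b\<^sup>2 / 4)"
    proof -
      have R2': "Re (z / w) = r * cos t * \<kappa>" unfolding R2 by (simp add: \<kappa>_def)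
      show ?thesis unfolding R1 half e1 R2' by (simp add: field_simps)
    qed
    ultimately show ?thesis using k1 by linarith
  qed
  finally have E: "Re ((z * (of_real a * of_real b) - z\<^sup>2 * (of_real a ^ 2 + of_real b ^ 2) / 2) / w) - b\<^sup>2 / 2
     \<le> - b\<^sup>2 / 4 + a\<^sup>2 / (sin t)\<^sup>2 + a\<^sup>2 / (2 * \<bar>sin t\<bar>)" .
  have nc: "norm (csqrt w) = sqrt (norm w)"
  proof -
    have "(norm (csqrt w))\<^sup>2 = norm w" unfolding norm_power[symmetric] power2_csqrt ..
    from real_sqrt_unique[OF this] show ?thesis by simp
  qed
  have "norm (mehler z a b) * exp (- b\<^sup>2 / 2)
     = exp (Re ((z * (of_real a * of_real b) - z\<^sup>2 * (of_real a ^ 2 + of_real b ^ 2) / 2) / w) - b\<^sup>2 / 2) / sqrt (norm w)"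
  proof -
    have "exp A / q * exp (- B / 2) = exp (A - B / 2) / q" for A B q :: real
      by (simp add: mult_exp_exp)
    thus ?thesis unfolding mehler_def w_def[symmetric] norm_divide nc norm_exp_eq_Re .
  qed
  also have "\<dots> \<le> exp (- b\<^sup>2 / 4 + a\<^sup>2 / (sin t)\<^sup>2 + a\<^sup>2 / (2 * \<bar>sin t\<bar>)) / sqrt \<bar>sin t\<bar>"
    using E nw t by (intro frac_le) auto
  also have "\<dots> = exp (a\<^sup>2 / (sin t)\<^sup>2 + a\<^sup>2 / (2 * \<bar>sin t\<bar>)) / sqrt \<bar>sin t\<bar> * exp (- b\<^sup>2 / 4)"
    by (simp add: exp_add[symmetric])
  finally show ?thesis unfolding z_def .
qed

lemma one_minus_cis_square:
  assumes "sin t \<noteq> 0"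
  shows "1 - cis (- t) ^ 2 = 2 * \<i> * of_real (sin t) * cis (- t)" "Re (1 - cis (- t) ^ 2) > 0"
proof -
  have d: "cis (- t) ^ 2 = cis (- (2 * t))" by (simp add: Complex.DeMoivre)
  show "1 - cis (- t) ^ 2 = 2 * \<i> * of_real (sin t) * cis (- t)"
    unfolding d by (simp add: complex_eq_iff cos_double_sin sin_double power2_eq_square)
  have "Re (1 - cis (- t) ^ 2) = 2 * (sin t)\<^sup>2" unfolding d by (simp add: cos_double_sin)
  thus "Re (1 - cis (- t) ^ 2) > 0" using assms by simp
qed

lemma mehler_radial_limit:
  assumes t: "sin t \<noteq> 0"
  shows "(\<lambda>n. mehler (of_real (radii n) * cis (- t)) a b) \<longlonglongrightarrow> mehler (cis (- t)) a b"
proof -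
  have z: "(\<lambda>n. of_real (radii n) * cis (- t)) \<longlonglongrightarrow> cis (- t)"
  proof -
    have "(\<lambda>n. of_real (radii n) * cis (- t)) \<longlonglongrightarrow> of_real 1 * cis (- t)"
      by (intro tendsto_intros radii)
    thus ?thesis by simp
  qed
  have w: "(\<lambda>n. 1 - (of_real (radii n) * cis (- t)) ^ 2) \<longlonglongrightarrow> 1 - cis (- t) ^ 2"
    by (intro tendsto_intros z)
  have nz: "1 - cis (- t) ^ 2 \<notin> \<real>\<^sub>\<le>\<^sub>0" "1 - cis (- t) ^ 2 \<noteq> 0"
    using one_minus_cis_square(2)[OF t] by (auto simp: complex_nonpos_Reals_iff)
  have c: "(\<lambda>n. csqrt (1 - (of_real (radii n) * cis (- t)) ^ 2)) \<longlonglongrightarrow> csqrt (1 - cis (- t) ^ 2)"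
    using continuous_at_csqrt[OF nz(1)] w by (rule isCont_tendsto_compose)
  show ?thesis unfolding mehler_def
    by (intro tendsto_intros z w c) (use nz in auto)
qed

lemma exp_norm_prod: "exp (- (norm (y :: real ^ 'n))\<^sup>2 / 2) = (\<Prod>i\<in>UNIV. exp (- (y $ i)\<^sup>2 / 2))"
  by (simp add: norm_sq_vec sum_divide_distrib sum_negf flip: exp_sum)

text \<open>
  Dominated convergence along \<open>z = r exp(-it)\<close>, \<open>r \<rightarrow> 1\<close>: the bound \<open>exp(-|y|\<^sup>2/4)\<close> from \<open>mehler_bound\<close> is exactly what
  cancels the growth of \<open>f\<close>.
\<close>

lemma kernel_limit:
  fixes f :: "real ^ 'n \<Rightarrow> complex" and x :: "real ^ 'n"
  assumes f: "kclass f" and t: "sin t \<noteq> 0"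
  shows "integrable lborel (\<lambda>y. f y * mehler_d (cis (- t)) x y * of_real (rho y))"
    and "hseries (evolve (coef f) t) x = (LINT y|lborel. f y * mehler_d (cis (- t)) x y * of_real (rho y))"
proof -
  define B where "B a = exp (a\<^sup>2 / (sin t)\<^sup>2 + a\<^sup>2 / (2 * \<bar>sin t\<bar>)) / sqrt \<bar>sin t\<bar>" for a :: real
  have B0: "B a \<ge> 0" for a by (simp add: B_def)
  obtain C where C: "\<And>x. norm (f x) \<le> C * (growth x * weight x)" using kclassD(2)[OF f] by blast
  define c where "c = (2 * pi) powr (- real CARD('n) / 2)"
  define K where "K = c * C * (\<Prod>i\<in>UNIV. B (x $ i))"
  have mb: "norm (f y * mehler_d (of_real (radii n) * cis (- t)) x y * of_real (rho y)) \<le> K * weight y" for n y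
  proof -
    have "norm (mehler_d (of_real (radii n) * cis (- t)) x y * of_real (rho y))
      = c * (\<Prod>i\<in>UNIV. norm (mehler (of_real (radii n) * cis (- t)) (x $ i) (y $ i)) * exp (- (y $ i)\<^sup>2 / 2))"
      using rho_pos[of y]
      unfolding norm_mult mehler_d_def prod_norm[symmetric] prod.distrib exp_norm_prod[symmetric] norm_of_real
      by (simp add: rho_def c_def)
    also have "\<dots> \<le> c * (\<Prod>i\<in>UNIV. B (x $ i) * exp (- (y $ i)\<^sup>2 / 4))"
      unfolding B_def using mehler_bound[OF t, of "radii n"] radii(1,2)[of n]
      by (intro mult_left_mono prod_mono) (auto simp: c_def)
    also have "\<dots> = c * (\<Prod>i\<in>UNIV. B (x $ i)) * (1 / growth y)"
      by (simp add: prod.distrib growth_prod exp_minus prod_inversef inverse_eq_divide prod_dividef)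
    finally have "norm (f y) * norm (mehler_d (of_real (radii n) * cis (- t)) x y * of_real (rho y))
       \<le> C * (growth y * weight y) * (c * (\<Prod>i\<in>UNIV. B (x $ i)) * (1 / growth y))"
      using order_trans[OF norm_ge_zero C] by (intro mult_mono C) auto
    also have "\<dots> = K * weight y" using growth_pos[of y] by (simp add: K_def)
    finally show ?thesis by (simp add: norm_mult mult.assoc)
  qed
  have cont: "continuous_on UNIV (\<lambda>y. f y * mehler_d z x y * of_real (rho y))" for z
    by (intro continuous_intros kclassD(3) f continuous_mehler_d continuous_on_rho)
  have meas: "(\<lambda>y. f y * mehler_d z x y * of_real (rho y)) \<in> borel_measurable lborel" for z
    using borel_measurable_continuous_onI[OF cont] by simp
  have lim: "AE y in lborel. (\<lambda>n. f y * mehler_d (of_real (radii n) * cis (- t)) x y * of_real (rho y))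
      \<longlonglongrightarrow> f y * mehler_d (cis (- t)) x y * of_real (rho y)"
    unfolding mehler_d_def by (intro AE_I2 tendsto_intros mehler_radial_limit t)
  have int: "integrable lborel (\<lambda>y. K * weight (y :: real ^ 'n))" by (intro integrable_mult_right integrable_weight)
  note dc = meas meas int lim AE_I2[OF mb]
  show "integrable lborel (\<lambda>y. f y * mehler_d (cis (- t)) x y * of_real (rho y))"
    by (rule integrable_dominated_convergence[OF dc])
  have "(\<lambda>n. LINT y|lborel. f y * mehler_d (of_real (radii n) * cis (- t)) x y * of_real (rho y))
     \<longlonglongrightarrow> (LINT y|lborel. f y * mehler_d (cis (- t)) x y * of_real (rho y))"
    by (rule integral_dominated_convergence[OF dc])
  moreover have "(LINT y|lborel. f y * mehler_d (of_real (radii n) * cis (- t)) x y * of_real (rho y))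
     = hseries (\<lambda>\<alpha>. (of_real (radii n) * cis (- t)) ^ deg \<alpha> * coef f \<alpha>) x" for n
    using mehler_integral[OF f, of "of_real (radii n) * cis (- t)" x] radii(1,2)[of n] by (simp add: norm_mult)
  ultimately show "hseries (evolve (coef f) t) x = (LINT y|lborel. f y * mehler_d (cis (- t)) x y * of_real (rho y))"
    using LIMSEQ_unique[OF hseries_radial_limit[OF rapid_coef[OF f], of t x]] by simp
qed

text \<open>
  On the unit circle \<open>1 - z\<^sup>2 = 2 i z sin t\<close>, and the Gaussian factor completes the coefficient of \<open>b\<^sup>2\<close> to
  \<open>-1 / (2 (1 - z\<^sup>2))\<close>.
\<close>

lemma mehler_boundary:
  fixes t a b :: real
  assumes t: "sin t \<noteq> 0"
  defines "\<kappa> \<equiv> \<i> / (4 * of_real (sin t))"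
  shows "mehler (cis (- t)) a b * of_real (exp (- b\<^sup>2 / 2))
    = exp (\<kappa> * (cis t * of_real (b\<^sup>2) + cis (- t) * of_real (a\<^sup>2) - 2 * of_real (a * b))) / csqrt (1 - cis (- t) ^ 2)"
proof -
  define z where "z = cis (- t)"
  define A B s where "A = complex_of_real a" and "B = complex_of_real b" and "s = complex_of_real (sin t)"
  have s0: "s \<noteq> 0" using t by (simp add: s_def)
  have zc: "cis t = 1 / z" by (simp add: z_def cis_inverse divide_inverse)
  have z0: "z \<noteq> 0" by (simp add: z_def)
  have w: "1 - z\<^sup>2 = 2 * \<i> * s * z" unfolding z_def s_def by (rule one_minus_cis_square(1)[OF t])
  have "(z * (A * B) - z\<^sup>2 * (A\<^sup>2 + B\<^sup>2) / 2) / (1 - z\<^sup>2) - B\<^sup>2 / 2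
      = \<kappa> * (1 / z * B\<^sup>2 + z * A\<^sup>2 - 2 * (A * B))"
  proof -
    have "(z * (A * B) - z\<^sup>2 * (A\<^sup>2 + B\<^sup>2) / 2) / (1 - z\<^sup>2) - B\<^sup>2 / 2
      = (z * (A * B) - z\<^sup>2 * A\<^sup>2 / 2 - (z\<^sup>2 + (1 - z\<^sup>2)) * B\<^sup>2 / 2) / (1 - z\<^sup>2)"
      using s0 z0 by (simp only: w) (simp add: field_simps)
    also have "\<dots> = (z * (A * B) - z\<^sup>2 * A\<^sup>2 / 2 - B\<^sup>2 / 2) / (2 * \<i> * s * z)"
      unfolding w[symmetric] by simp
    also have "\<dots> = \<kappa> * (1 / z * B\<^sup>2 + z * A\<^sup>2 - 2 * (A * B))"
      unfolding \<kappa>_def s_def[symmetric] using s0 z0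
      by (simp add: field_simps power2_eq_square)
    finally show ?thesis .
  qed
  moreover have "complex_of_real (exp (- b\<^sup>2 / 2)) = exp (- (B\<^sup>2 / 2))"
    by (simp add: B_def exp_of_real[symmetric])
  ultimately show ?thesis
    unfolding mehler_def zc z_def[symmetric] A_def[symmetric] B_def[symmetric] of_real_power of_real_mult
    by (simp add: mult_exp_exp)
qed

text \<open>
  Squaring the candidate gives \<open>2 |sin t| exp(-it) i (-1)\<^sup>k\<close>, and \<open>(-1)\<^sup>k\<close> is the sign of \<open>sin t\<close>. The
  candidate is the principal root because \<open>t / 2 - \<pi> (2 k + 1) / 4\<close> lies between \<open>-\<pi>/4\<close> and \<open>\<pi>/4\<close>; this is
  where the floor comes from.
\<close>

lemma csqrt_boundary:
  fixes t :: real
  assumes t: "sin t \<noteq> 0"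
  defines "k \<equiv> \<lfloor>t / pi\<rfloor>"
  shows "1 / csqrt (1 - cis (- t) ^ 2)
    = of_real ((2 * \<bar>sin t\<bar>) powr (- (1 / 2))) * (cis (t / 2) * cis (- (pi / 4 * (2 * of_int k + 1))))"
proof -
  define \<theta> where "\<theta> = t / 2 - pi / 4 * (2 * of_int k + 1)"
  define q where "q = sqrt (2 * \<bar>sin t\<bar>)"
  have q: "q > 0" "q\<^sup>2 = 2 * \<bar>sin t\<bar>" using t by (simp_all add: q_def)
  have "of_int k \<le> t / pi" "t / pi < of_int k + 1" unfolding k_def by linarith+
  hence k1: "of_int k * pi \<le> t" "t < (of_int k + 1) * pi"
    by (simp_all add: pos_le_divide_eq pos_divide_less_eq)
  have abs_sin: "\<bar>sin t\<bar> * cos (of_int k * pi) = sin t"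
  proof -
    define d where "d = t - of_int k * pi"
    have d: "0 \<le> d" "d \<le> pi" using k1 by (simp_all add: d_def algebra_simps)
    have sk: "sin (of_int k * pi) = 0" by (simp add: sin_zero_iff_int2)
    have "sin t = sin (d + of_int k * pi)" by (simp add: d_def)
    also have "\<dots> = sin d * cos (of_int k * pi)" by (simp add: sin_add sk)
    finally have st: "sin t = sin d * cos (of_int k * pi)" .
    have c2: "(cos (of_int k * pi))\<^sup>2 = 1" using sin_cos_squared_add[of "of_int k * pi"] sk by simp
    hence "\<bar>cos (of_int k * pi)\<bar> = 1" by (simp add: power2_eq_1_iff abs_if) linarith
    moreover have "sin d \<ge> 0" using d by (rule sin_ge_zero)
    ultimately have "\<bar>sin t\<bar> = sin d" unfolding st by (simp add: abs_mult)
    thus ?thesis by (simp add: st)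
  qed
  have ck: "cis (of_int k * pi) = of_real (cos (of_int k * pi))"
  proof -
    have "sin (of_int k * pi) = 0" by (simp add: sin_zero_iff_int2)
    thus ?thesis by (simp add: complex_eq_iff)
  qed
  have sq: "(of_real q * cis (- \<theta>))\<^sup>2 = 1 - cis (- t) ^ 2"
  proof -
    have "(of_real q * cis (- \<theta>))\<^sup>2 = of_real (2 * \<bar>sin t\<bar>) * cis (2 * (- \<theta>))"
      unfolding power_mult_distrib Complex.DeMoivre of_real_power[symmetric] q(2) by simp
    also have "2 * (- \<theta>) = (of_int k * pi + pi / 2) + (- t)" by (simp add: \<theta>_def algebra_simps)
    also have "cis \<dots> = of_real (cos (of_int k * pi)) * \<i> * cis (- t)"
      unfolding cis_mult[symmetric] ck by simp
    also have "of_real (2 * \<bar>sin t\<bar>) * (of_real (cos (of_int k * pi)) * \<i> * cis (- t))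
       = 2 * \<i> * of_real (\<bar>sin t\<bar> * cos (of_int k * pi)) * cis (- t)" by simp
    also have "\<dots> = 1 - cis (- t) ^ 2" unfolding abs_sin one_minus_cis_square(1)[OF t] ..
    finally show ?thesis .
  qed
  have "cos \<theta> > 0"
  proof (rule cos_gt_zero_pi)
    define d where "d = t - of_int k * pi"
    have e: "\<theta> = d / 2 - pi / 4" by (simp add: \<theta>_def d_def field_simps)
    have d: "0 \<le> d" "d < pi" using k1 by (simp_all add: d_def algebra_simps)
    have "- (pi / 2) < \<theta>" unfolding e using d by linarith
    moreover have "\<theta> < pi / 2" unfolding e using d by linarith
    ultimately have "- (pi / 2) < \<theta> \<and> \<theta> < pi / 2" by blast
    thus "- (pi / 2) < \<theta>" "\<theta> < pi / 2" by blast+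
  qed
  hence "csqrt (1 - cis (- t) ^ 2) = of_real q * cis (- \<theta>)"
    using q(1) by (intro csqrt_unique sq) simp
  hence "1 / csqrt (1 - cis (- t) ^ 2) = of_real (1 / q) * cis \<theta>"
    by (simp add: divide_inverse cis_inverse)
  moreover have "1 / q = (2 * \<bar>sin t\<bar>) powr (- (1 / 2))"
    using t by (simp add: q_def powr_minus powr_half_sqrt inverse_eq_divide)
  moreover have "cis \<theta> = cis (t / 2) * cis (- (pi / 4 * (2 * of_int k + 1)))"
    by (simp add: cis_mult \<theta>_def)
  ultimately show ?thesis by simp
qed

text \<open>
  The exponents of the coordinates add up to the exponent of the kernel, and the \<open>d\<close>-th power of the reciprocal square
  root of \<open>1 - z\<^sup>2\<close> combines with the normalisation of the Gaussian density to the constant in front of the integral.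
\<close>

lemma kernel_eq:
  fixes x y :: "real ^ 'n"
  assumes t: "sin t \<noteq> 0"
  shows "f y * mehler_d (cis (- t)) x y * of_real (rho y)
    = of_real ((4 * pi) powr (- real CARD('n) / 2))
         * exp (\<i> * of_real (real CARD('n) * t / 2))
         * exp (- \<i> * of_real (pi * real CARD('n) / 4 * (2 * of_int \<lfloor>t / pi\<rfloor> + 1)))
         / of_real (\<bar>sin t\<bar> powr (real CARD('n) / 2)) * kernel_integrand f t x y"
proof -
  define \<kappa> where "\<kappa> = \<i> / (4 * of_real (sin t))"
  define v where "v = 1 / csqrt (1 - cis (- t) ^ 2)"
  define E where "E a b = \<kappa> * (cis t * of_real (b\<^sup>2) + cis (- t) * of_real (a\<^sup>2) - 2 * of_real (a * b))" for a b
  have "mehler_d (cis (- t)) x y * of_real (exp (- (norm y)\<^sup>2 / 2))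
     = (\<Prod>i\<in>UNIV. mehler (cis (- t)) (x $ i) (y $ i) * of_real (exp (- (y $ i)\<^sup>2 / 2)))"
    unfolding exp_norm_prod mehler_d_def by (simp add: prod.distrib)
  also have "\<dots> = (\<Prod>i\<in>(UNIV :: 'n set). v * exp (E (x $ i) (y $ i)))"
    unfolding mehler_boundary[OF t] E_def \<kappa>_def v_def by simp
  also have "\<dots> = v ^ CARD('n) * exp (\<Sum>i\<in>UNIV. E (x $ i) (y $ i))"
    by (simp add: prod.distrib exp_sum)
  also have "(\<Sum>i\<in>UNIV. E (x $ i) (y $ i)) = \<kappa> * (cis t * of_real ((norm y)\<^sup>2) + cis (- t) * of_real ((norm x)\<^sup>2) - 2 * of_real (x \<bullet> y))"
    unfolding E_def norm_sq_vec inner_vec_def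
    by (simp add: sum_distrib_left sum_distrib_right sum.distrib sum_subtractf algebra_simps)
  finally have 1: "mehler_d (cis (- t)) x y * of_real (exp (- (norm y)\<^sup>2 / 2))
     = v ^ CARD('n) * exp (\<kappa> * (cis t * of_real ((norm y)\<^sup>2) + cis (- t) * of_real ((norm x)\<^sup>2) - 2 * of_real (x \<bullet> y)))" .
  have \<kappa>: "\<kappa> = \<i> * of_real (sgn (sin t)) / of_real (4 * \<bar>sin t\<bar>)"
    using t by (cases "sin t > 0") (auto simp: \<kappa>_def sgn_if abs_if)
  have ker: "kernel_integrand f t x y
     = exp (\<kappa> * (cis t * of_real ((norm y)\<^sup>2) + cis (- t) * of_real ((norm x)\<^sup>2) - 2 * of_real (x \<bullet> y))) * f y"
    unfolding kernel_integrand_def \<kappa> cis_conv_exp by simp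
  have vn: "v ^ CARD('n) = of_real ((2 * \<bar>sin t\<bar>) powr (- real CARD('n) / 2)) * exp (\<i> * of_real (real CARD('n) * t / 2))
         * exp (- \<i> * of_real (pi * real CARD('n) / 4 * (2 * of_int \<lfloor>t / pi\<rfloor> + 1)))"
  proof -
    have "((2 * \<bar>sin t\<bar>) powr (- (1 / 2))) ^ CARD('n) = (2 * \<bar>sin t\<bar>) powr (- real CARD('n) / 2)"
      using t by (simp add: powr_realpow[symmetric] powr_powr)
    moreover have v: "v = of_real ((2 * \<bar>sin t\<bar>) powr (- (1 / 2))) * (cis (t / 2) * cis (- (pi / 4 * (2 * of_int \<lfloor>t / pi\<rfloor> + 1))))"
      unfolding v_def by (rule csqrt_boundary[OF t])
    ultimately show ?thesis
      unfolding v power_mult_distrib Complex.DeMoivre of_real_power[symmetric]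
      by (simp add: cis_conv_exp mult_ac)
  qed
  have pw: "(2 * pi) powr (- real CARD('n) / 2) * (2 * \<bar>sin t\<bar>) powr (- real CARD('n) / 2)
     = (4 * pi) powr (- real CARD('n) / 2) / \<bar>sin t\<bar> powr (real CARD('n) / 2)"
  proof -
    have "(2 * pi) powr (- real CARD('n) / 2) * (2 * \<bar>sin t\<bar>) powr (- real CARD('n) / 2) = ((4 * pi) * \<bar>sin t\<bar>) powr (- real CARD('n) / 2)"
      by (simp add: powr_mult[symmetric] mult_ac)
    also have "\<dots> = (4 * pi) powr (- real CARD('n) / 2) * \<bar>sin t\<bar> powr (- real CARD('n) / 2)"
      by (simp add: powr_mult)
    also have "\<bar>sin t\<bar> powr (- real CARD('n) / 2) = inverse (\<bar>sin t\<bar> powr (real CARD('n) / 2))"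
      using powr_minus[of "\<bar>sin t\<bar>" "real CARD('n) / 2"] by simp
    finally show ?thesis by (simp only: divide_inverse)
  qed
  have "f y * mehler_d (cis (- t)) x y * of_real (rho y)
     = of_real ((2 * pi) powr (- real CARD('n) / 2)) * f y * (mehler_d (cis (- t)) x y * of_real (exp (- (norm y)\<^sup>2 / 2)))"
    by (simp add: rho_def)
  also have "\<dots> = of_real ((2 * pi) powr (- real CARD('n) / 2)) * v ^ CARD('n) * kernel_integrand f t x y"
    unfolding 1 ker by simp
  also have "of_real ((2 * pi) powr (- real CARD('n) / 2)) * v ^ CARD('n)
     = of_real ((2 * pi) powr (- real CARD('n) / 2) * (2 * \<bar>sin t\<bar>) powr (- real CARD('n) / 2)) * (exp (\<i> * of_real (real CARD('n) * t / 2))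
         * exp (- \<i> * of_real (pi * real CARD('n) / 4 * (2 * of_int \<lfloor>t / pi\<rfloor> + 1))))"
    unfolding vn of_real_mult[of "(2 * pi) powr _"] by (simp only: mult.assoc)
  finally show ?thesis unfolding pw by simp
qed

lemma kernel_formula:
  fixes f :: "real ^ 'n \<Rightarrow> complex" and x :: "real ^ 'n"
  assumes f: "kclass f" and t: "sin t \<noteq> 0"
  shows "integrable lborel (kernel_integrand f t x)"
    and "hseries (evolve (coef f) t) x = of_real ((4 * pi) powr (- real CARD('n) / 2))
         * exp (\<i> * of_real (real CARD('n) * t / 2))
         * exp (- \<i> * of_real (pi * real CARD('n) / 4 * (2 * of_int \<lfloor>t / pi\<rfloor> + 1)))
         / of_real (\<bar>sin t\<bar> powr (real CARD('n) / 2)) * (LINT y|lborel. kernel_integrand f t x y)"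
proof -
  define P where "P = of_real ((4 * pi) powr (- real CARD('n) / 2))
         * exp (\<i> * of_real (real CARD('n) * t / 2))
         * exp (- \<i> * of_real (pi * real CARD('n) / 4 * (2 * of_int \<lfloor>t / pi\<rfloor> + 1)))
         / of_real (\<bar>sin t\<bar> powr (real CARD('n) / 2))"
  have P: "P \<noteq> 0" using t by (simp add: P_def)
  have eq: "f y * mehler_d (cis (- t)) x y * of_real (rho y) = P * kernel_integrand f t x y" for y
    unfolding P_def by (rule kernel_eq[OF t])
  have "integrable lborel (\<lambda>y. P * kernel_integrand f t x y)"
    using kernel_limit(1)[OF f t, of x] unfolding eq .
  hence "integrable lborel (\<lambda>y. 1 / P * (P * kernel_integrand f t x y))"
    by (rule integrable_mult_right)
  moreover have "(\<lambda>y. 1 / P * (P * kernel_integrand f t x y)) = kernel_integrand f t x"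
    using P by (auto simp: fun_eq_iff)
  ultimately show "integrable lborel (kernel_integrand f t x)" by simp
  show "hseries (evolve (coef f) t) x = of_real ((4 * pi) powr (- real CARD('n) / 2))
         * exp (\<i> * of_real (real CARD('n) * t / 2))
         * exp (- \<i> * of_real (pi * real CARD('n) / 4 * (2 * of_int \<lfloor>t / pi\<rfloor> + 1)))
         / of_real (\<bar>sin t\<bar> powr (real CARD('n) / 2)) * (LINT y|lborel. kernel_integrand f t x y)"
    using kernel_limit(2)[OF f t, of x] unfolding eq P_def[symmetric] by simp
qed

section \<open>Half-periods and the main result\<close>

lemma hermite_minus: "hermite \<alpha> (- x) = (- 1) ^ deg \<alpha> * hermite \<alpha> x"
  by (simp add: hermite_eq_prod herm_minus deg_def power_sum prod.distrib)

lemma hseries_half_period: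
  fixes c :: "('n::finite \<Rightarrow> nat) \<Rightarrow> complex" and x :: "real ^ 'n" and k :: int
  shows "hseries (evolve c (of_int k * pi)) x = hseries c (((- 1) powi k) *\<^sub>R x)"
proof -
  have e: "evolve c (of_int k * pi) \<alpha> = (if even k then 1 else (- 1) ^ deg \<alpha>) * c \<alpha>" for \<alpha>
  proof -
    have "cis (- (real (deg \<alpha>) * (of_int k * pi))) = cis (- (pi * of_int k)) ^ deg \<alpha>"
      unfolding Complex.DeMoivre by (simp add: mult_ac)
    also have "cis (- (pi * of_int k)) = (if even k then 1 else - 1)"
      by (simp add: complex_eq_iff cos_npi_int)
    finally show ?thesis by (simp add: evolve_def)
  qed
  show ?thesis
  proof (cases "even k")
    case True
    then show ?thesis by (simp only: hseries_def e power_int_minus_left) simp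
  next
    case False
    then show ?thesis by (simp only: hseries_def e power_int_minus_left) (simp add: hermite_minus mult_ac)
  qed
qed

theorem proposition2p1:
  fixes \<phi> :: "real ^ 'n \<Rightarrow> complex"
    and U :: "real \<Rightarrow> (real ^ 'n \<Rightarrow> complex) \<Rightarrow> real ^ 'n \<Rightarrow> complex"
  assumes "OU_group U"
    and "\<phi> \<in> K_space"
  shows "\<exists>u :: real \<Rightarrow> real ^ 'n \<Rightarrow> complex.
    (\<forall>t. continuous_on UNIV (u t) \<and> (AE x in gauss. U t \<phi> x = u t x)) \<and>
    (\<forall>t x. (\<forall>k::int. t \<noteq> of_int k * pi) \<longrightarrow>
       integrable lborel (kernel_integrand \<phi> t x) \<and>
       u t x =
         of_real ((4 * pi) powr (- real CARD('n) / 2))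
         * exp (\<i> * of_real (real CARD('n) * t / 2))
         * exp (- \<i> * of_real (pi * real CARD('n) / 4 * (2 * of_int \<lfloor>t / pi\<rfloor> + 1)))
         / of_real (\<bar>sin t\<bar> powr (real CARD('n) / 2))
         * (LINT y|lborel. kernel_integrand \<phi> t x y)) \<and>
    (\<forall>(k::int) x. u (of_int k * pi) x = \<phi> (((- 1) powi k) *\<^sub>R x)) \<and>
    classical_solution \<phi> u \<and>
    L2_solution \<phi> u \<and>
    (\<forall>v. L2_solution \<phi> v \<longrightarrow> (\<forall>t. AE x in gauss. v t x = u t x))"
proof -
  have f: "kclass \<phi>" by (rule K_space_kclass[OF assms(2)])
  note c = rapid_coef[OF f]
  have \<phi>: "hseries (coef \<phi>) = \<phi>" by (rule ext) (rule hermite_expansion[OF f])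
  have \<phi>L2: "\<phi> \<in> L2" using hseries_L2(1)[OF c] by (simp only: \<phi>)
  define u where "u t = hseries (evolve (coef \<phi>) t)" for t
  have L2: "L2_solution \<phi> u" using L2_solution_hseries[OF c] unfolding \<phi> u_def[abs_def] .
  have Uu: "AE x in gauss. U t \<phi> x = u t x" for t
    using L2_solution_unique[OF assms(1) L2 \<phi>L2, of t] by eventually_elim simp
  show ?thesis
  proof (intro exI[of _ u] conjI allI impI)
    show "continuous_on UNIV (u t)" for t
      unfolding u_def using has_gradient_imp_differentiable[OF hseries_gradient[OF rapid_evolve[OF c]]]
      by (intro differentiable_imp_continuous_on) (simp add: differentiable_on_def)
    show "AE x in gauss. U t \<phi> x = u t x" for t by (rule Uu)
    fix t x assume "\<forall>k::int. t \<noteq> of_int k * pi"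
    hence t: "sin t \<noteq> 0" by (simp add: sin_zero_iff_int2)
    show "integrable lborel (kernel_integrand \<phi> t x)" by (rule kernel_formula(1)[OF f t])
    show "u t x = of_real ((4 * pi) powr (- real CARD('n) / 2))
         * exp (\<i> * of_real (real CARD('n) * t / 2))
         * exp (- \<i> * of_real (pi * real CARD('n) / 4 * (2 * of_int \<lfloor>t / pi\<rfloor> + 1)))
         / of_real (\<bar>sin t\<bar> powr (real CARD('n) / 2))
         * (LINT y|lborel. kernel_integrand \<phi> t x y)"
      unfolding u_def by (rule kernel_formula(2)[OF f t])
  next
    show "u (of_int k * pi) x = \<phi> (((- 1) powi k) *\<^sub>R x)" for k :: int and x
      unfolding u_def hseries_half_period \<phi> ..
    show "classical_solution \<phi> u"
      using classical_solution_hseries[OF c] unfolding \<phi> u_def[abs_def] .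
    show "L2_solution \<phi> u" by (rule L2)
    show "AE x in gauss. v t x = u t x" if "L2_solution \<phi> v" for v t
      using L2_solution_unique[OF assms(1) that \<phi>L2, of t] Uu[of t] by eventually_elim simp
  qed
qed

end
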